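(* Let $\mathbb X=(X,\tau,\mathsf d,\mathfrak m)$ be an extended metric-topological measure space and $p\in(1,\infty)$. Then $$H^{1,p}(\mathbb X)=W^{1,p}(\mathbb X)$$ and it holds that $|Df|=|Df|_H$ for every $f\in W^{1,p}(\mathbb X)$.
   Context: An extended distance on a set $X$ is a symmetric function $\mathsf d\colon X\times X\to[0,+\infty]$ satisfying the triangle inequality and with $\mathsf d(x,y)=0$ iff $x=y$. For $f\colon X\to\mathbb R$ and $A\subseteq X$, $\mathrm{Lip}(f,A,\mathsf d)=\sup\{|f(x)-f(y)|/\mathsf d(x,y):x,y\in A,\ x\neq y\}$ (with $c/(+\infty)=0$, $\sup\varnothing=0$), $\mathrm{Lip}(f,\mathsf d)=\mathrm{Lip}(f,X,\mathsf d)$. $\mathrm{Lip}_b(X,\tau,\mathsf d)$ is the algebra of bounded $\tau$-continuous $\mathsf d$-Lipschitz functions $f\colon X\to\mathbb R$. $(X,\tau,\mathsf d)$ is an extended metric-topological space if $\tau$ is Hausdorff, $\mathsf d$ is an extended distance, $\tau$ is the initial topology of $\mathrm{Lip}_b(X,\tau,\mathsf d)$, and $\mathsf d(x,y)=\sup\{|f(x)-f(y)|:f\in\mathrm{Lip}_b(X,\tau,\mathsf d),\ \mathrm{Lip}(f,\mathsf d)\leq 1\}$ for all $x,y$. It becomes an extended metric-topological measure space when equipped with a finite Radon (inner regular with respect to $\tau$-compact sets) measure $\mathfrak m$ on the Borel sets of $\tau$. The asymptotic slope of $f\in\mathrm{Lip}_b(X,\tau,\mathsf d)$ is $\mathrm{lip}_{\mathsf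 d}(f)(x)=\inf\{\mathrm{Lip}(f,U,\mathsf d):x\in U\in\tau\}$. $\bigwedge$ denotes the $\mathfrak m$-essential infimum; a superscript $+$ denotes nonnegative elements; $L^0(\mathfrak m)$ is the algebra of real-valued $\tau$-Borel functions up to $\mathfrak m$-a.e. equality. The space $H^{1,p}(\mathbb X)$: for $f\in L^p(\mathfrak m)$ let $\mathcal E_p(f)=\inf\{\liminf_n\frac1p\int\mathrm{lip}_{\mathsf d}(f_n)^p\,d\mathfrak m:(f_n)_n\subseteq\mathrm{Lip}_b(X,\tau,\mathsf d),\ f_n\to f\text{ in }L^p(\mathfrak m)\}$ and $H^{1,p}(\mathbb X)=\{f\in L^p(\mathfrak m):\mathcal E_p(f)<+\infty\}$. A function $G\in L^p(\mathfrak m)^+$ is a $p$-relaxed slope of $f$ if there exist $(f_n)_n\subseteq\mathrm{Lip}_b(X,\tau,\mathsf d)$ and $\tilde G\in L^p(\mathfrak m)^+$ with $f_n\to f$ strongly in $L^p(\mathfrak m)$, $\mathrm{lip}_{\mathsf d}(f_n)\rightharpoonup\tilde G$ weakly in $L^p(\mathfrak m)$ and $\tilde G\leq G$ $\mathfrak m$-a.e. For $f\in H^{1,p}(\mathbb X)$, $|Df|_H$ denotes the ($\mathfrak m$-a.e. unique) minimal $p$-relaxed slope of $f$, i.e. the $p$-relaxed slope that is $\mathfrak m$-a.e. smaller than or equal to every other. The space $W^{1,p}(\mathbb X)$: let $q$ be the conjugate exponent of $p$. A Lipschitz derivation on $\mathbb X$ is a linear map $b\colon\mathrm{Lip}_b(X,\tau,\mathsf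 d)\to L^0(\mathfrak m)$ with $b(fg)=f\,b(g)+g\,b(f)$ for all $f,g$; $hb$ denotes the derivation $f\mapsto h\,b(f)$. $b$ has divergence if $b(f)\in L^1(\mathfrak m)$ for every $f$ and there is a (unique) $\mathrm{div}(b)\in L^1(\mathfrak m)$ with $\int b(f)\,d\mathfrak m=-\int f\,\mathrm{div}(b)\,d\mathfrak m$ for every $f\in\mathrm{Lip}_b(X,\tau,\mathsf d)$. $\mathrm{Der}^q(\mathbb X)$ is the set of Lipschitz derivations $b$ for which there is $g\in L^q(\mathfrak m)^+$ with $|b(f)|\leq g\,\mathrm{lip}_{\mathsf d}(f)$ $\mathfrak m$-a.e. for every $f\in\mathrm{Lip}_b(X,\tau,\mathsf d)$; $|b|\in L^q(\mathfrak m)^+$ is the $\mathfrak m$-essential infimum of all such $g$. $\mathrm{Der}^q_q(\mathbb X)$ is the set of $b\in\mathrm{Der}^q(\mathbb X)$ having divergence with $\mathrm{div}(b)\in L^q(\mathfrak m)$. $W^{1,p}(\mathbb X)$ is the set of $f\in L^p(\mathfrak m)$ for which there is a (necessarily unique) linear operator $L_f\colon\mathrm{Der}^q_q(\mathbb X)\to L^1(\mathfrak m)$ such that: (i) there is $g\in L^p(\mathfrak m)^+$ with $|L_f(b)|\leq g|b|$ for every $b\in\mathrm{Der}^q_q(\mathbb X)$; (ii) $L_f(hb)=h\,L_f(b)$ for every $h\in\mathrm{Lip}_b(X,\tau,\mathsf d)$ and $b\in\mathrm{Der}^q_q(\mathbb X)$; (iii) $\int L_f(b)\,d\mathfrak m=-\int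 f\,\mathrm{div}(b)\,d\mathfrak m$ for every $b\in\mathrm{Der}^q_q(\mathbb X)$. For $f\in W^{1,p}(\mathbb X)$, $|Df|=\bigwedge\{g\in L^p(\mathfrak m)^+:|L_f(b)|\leq g|b|\ \forall b\in\mathrm{Der}^q_q(\mathbb X)\}$. *)

theory Defs
  imports "HOL-Analysis.Analysis"
begin

section \<open>Extended metric-topological measure spaces\<close>

text \<open>
  The set \<open>X\<close> is the universe of a type \<open>'a\<close> and \<open>\<tau>\<close> is its type-class topology.  Division is that
  of \<^typ>\<open>ennreal\<close>: it satisfies \<open>c / \<infinity> = 0\<close>, and a supremum over the empty set is \<open>0\<close>.
\<close>

locale extended_distance =
  fixes d :: "'a \<Rightarrow> 'a \<Rightarrow> ennreal"
  assumes dist_sym: "d x y = d y x"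
    and dist_triangle: "d x z \<le> d x y + d y z"
    and dist_eq_0_iff: "d x y = 0 \<longleftrightarrow> x = y"

definition Lip :: "('a \<Rightarrow> 'a \<Rightarrow> ennreal) \<Rightarrow> ('a \<Rightarrow> real) \<Rightarrow> 'a set \<Rightarrow> ennreal" where
  "Lip d f A = (SUP (x, y) \<in> {(x, y). x \<in> A \<and> y \<in> A \<and> x \<noteq> y}. ennreal \<bar>f x - f y\<bar> / d x y)"

definition Lipb :: "('a::topological_space \<Rightarrow> 'a \<Rightarrow> ennreal) \<Rightarrow> ('a \<Rightarrow> real) set" where
  "Lipb d = {f. bounded (range f) \<and> continuous_on UNIV f \<and> Lip d f UNIV < \<infinity>}"

locale ext_metric_top_space = extended_distance d
  for d :: "'a::t2_space \<Rightarrow> 'a \<Rightarrow> ennreal" +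
  assumes initial_topology:
      "open U \<longleftrightarrow> generate_topology {f -` V | f V. f \<in> Lipb d \<and> open V} U"
    and dist_eq_SUP: "d x y = (SUP f \<in> {f \<in> Lipb d. Lip d f UNIV \<le> 1}. ennreal \<bar>f x - f y\<bar>)"

locale ext_metric_top_measure_space = ext_metric_top_space d + finite_measure m
  for d :: "'a::t2_space \<Rightarrow> 'a \<Rightarrow> ennreal" and m :: "'a measure" +
  assumes sets_eq_borel: "sets m = sets borel"
    and inner_regular:
      "B \<in> sets borel \<Longrightarrow> emeasure m B = (SUP K \<in> {K. compact K \<and> K \<subseteq> B}. emeasure m K)"

text \<open>
  The asymptotic slope.  For \<open>f\<close> in \<^term>\<open>Lipb d\<close> the infimum is at most \<^term>\<open>Lip d f UNIV\<close>, hence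
  finite, so \<^const>\<open>enn2real\<close> loses nothing.
\<close>

definition lip :: "('a::topological_space \<Rightarrow> 'a \<Rightarrow> ennreal) \<Rightarrow> ('a \<Rightarrow> real) \<Rightarrow> 'a \<Rightarrow> real" where
  "lip d f x = enn2real (INF U \<in> {U. open U \<and> x \<in> U}. Lip d f U)"


section \<open>Lebesgue spaces\<close>

text \<open>
  Elements of \<open>L\<^sup>0\<close>, \<open>L\<^sup>1\<close> and \<open>L\<^sup>p\<close> are represented by functions, equality and order being understood
  almost everywhere: \<open>L\<^sup>0\<close> is \<^term>\<open>borel_measurable m\<close> and \<open>L\<^sup>1\<close> is given by \<^term>\<open>integrable m\<close>.
  The objects that are unique only up to almost everywhere equality (essential infima, divergences,
  minimal slopes, the operators \<open>L\<^sub>f\<close>) are chosen with \<open>SOME\<close>.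
\<close>

definition conj_exp :: "real \<Rightarrow> real" where
  "conj_exp p = p / (p - 1)"

definition Lp :: "real \<Rightarrow> 'a measure \<Rightarrow> ('a \<Rightarrow> real) set" where
  "Lp p m = {f \<in> borel_measurable m. integrable m (\<lambda>x. \<bar>f x\<bar> powr p)}"

definition Lp_nonneg :: "real \<Rightarrow> 'a measure \<Rightarrow> ('a \<Rightarrow> real) set" where
  "Lp_nonneg p m = {f \<in> Lp p m. AE x in m. 0 \<le> f x}"

definition Lp_norm :: "real \<Rightarrow> 'a measure \<Rightarrow> ('a \<Rightarrow> real) \<Rightarrow> real" where
  "Lp_norm p m f = (\<integral>x. \<bar>f x\<bar> powr p \<partial>m) powr (1 / p)"

definition Lp_tendsto :: "real \<Rightarrow> 'a measure \<Rightarrow> (nat \<Rightarrow> 'a \<Rightarrow> real) \<Rightarrow> ('a \<Rightarrow> real) \<Rightarrow> bool" where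
  "Lp_tendsto p m s f \<longleftrightarrow> (\<forall>n. s n \<in> Lp p m) \<and> f \<in> Lp p m \<and>
     (\<lambda>n. Lp_norm p m (\<lambda>x. s n x - f x)) \<longlonglongrightarrow> 0"

text \<open>
  Continuous linear functionals on \<open>L\<^sup>p\<close>; boundedness makes them invariant under almost everywhere
  equality.
\<close>

definition Lp_functional :: "real \<Rightarrow> 'a measure \<Rightarrow> (('a \<Rightarrow> real) \<Rightarrow> real) \<Rightarrow> bool" where
  "Lp_functional p m \<phi> \<longleftrightarrow>
     (\<forall>f\<in>Lp p m. \<forall>g\<in>Lp p m. \<forall>\<alpha> \<beta>. \<phi> (\<lambda>x. \<alpha> * f x + \<beta> * g x) = \<alpha> * \<phi> f + \<beta> * \<phi> g) \<and>
     (\<exists>C. \<forall>f\<in>Lp p m. \<bar>\<phi> f\<bar> \<le> C * Lp_norm p m f)"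

definition Lp_weak_tendsto ::
    "real \<Rightarrow> 'a measure \<Rightarrow> (nat \<Rightarrow> 'a \<Rightarrow> real) \<Rightarrow> ('a \<Rightarrow> real) \<Rightarrow> bool" where
  "Lp_weak_tendsto p m s f \<longleftrightarrow> (\<forall>n. s n \<in> Lp p m) \<and> f \<in> Lp p m \<and>
     (\<forall>\<phi>. Lp_functional p m \<phi> \<longrightarrow> (\<lambda>n. \<phi> (s n)) \<longlonglongrightarrow> \<phi> f)"

text \<open>The greatest lower bound of a family in \<open>L\<^sup>0\<close> for the almost everywhere order.\<close>

definition is_ess_inf :: "'a measure \<Rightarrow> ('a \<Rightarrow> real) set \<Rightarrow> ('a \<Rightarrow> real) \<Rightarrow> bool" where
  "is_ess_inf m S G \<longleftrightarrow> G \<in> borel_measurable m \<and> (\<forall>g\<in>S. AE x in m. G x \<le> g x) \<and>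
     (\<forall>G'\<in>borel_measurable m. (\<forall>g\<in>S. AE x in m. G' x \<le> g x) \<longrightarrow> (AE x in m. G' x \<le> G x))"

definition ess_inf :: "'a measure \<Rightarrow> ('a \<Rightarrow> real) set \<Rightarrow> 'a \<Rightarrow> real" where
  "ess_inf m S = (SOME G. is_ess_inf m S G)"


section \<open>The space \<open>H\<^sup>1\<^sup>,\<^sup>p\<close>\<close>

definition cheeger_energy ::
    "real \<Rightarrow> ('a::topological_space \<Rightarrow> 'a \<Rightarrow> ennreal) \<Rightarrow> 'a measure \<Rightarrow> ('a \<Rightarrow> real) \<Rightarrow> ennreal" where
  "cheeger_energy p d m f =
     (INF s \<in> {s. (\<forall>n. s n \<in> Lipb d) \<and> Lp_tendsto p m s f}.
        liminf (\<lambda>n. ennreal (1 / p) * (\<integral>\<^sup>+x. ennreal (lip d (s n) x powr p) \<partial>m)))"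

definition H1p ::
    "real \<Rightarrow> ('a::topological_space \<Rightarrow> 'a \<Rightarrow> ennreal) \<Rightarrow> 'a measure \<Rightarrow> ('a \<Rightarrow> real) set" where
  "H1p p d m = {f \<in> Lp p m. cheeger_energy p d m f < \<infinity>}"

definition relaxed_slope ::
    "real \<Rightarrow> ('a::topological_space \<Rightarrow> 'a \<Rightarrow> ennreal) \<Rightarrow> 'a measure \<Rightarrow> ('a \<Rightarrow> real) \<Rightarrow> ('a \<Rightarrow> real) \<Rightarrow> bool"
  where
  "relaxed_slope p d m f G \<longleftrightarrow> G \<in> Lp_nonneg p m \<and>
     (\<exists>s. \<exists>G'\<in>Lp_nonneg p m. (\<forall>n. s n \<in> Lipb d) \<and> Lp_tendsto p m s f \<and>
        Lp_weak_tendsto p m (\<lambda>n. lip d (s n)) G' \<and> (AE x in m. G' x \<le> G x))"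

definition min_relaxed_slope ::
    "real \<Rightarrow> ('a::topological_space \<Rightarrow> 'a \<Rightarrow> ennreal) \<Rightarrow> 'a measure \<Rightarrow> ('a \<Rightarrow> real) \<Rightarrow> 'a \<Rightarrow> real" where
  "min_relaxed_slope p d m f =
     (SOME G. relaxed_slope p d m f G \<and>
        (\<forall>G'. relaxed_slope p d m f G' \<longrightarrow> (AE x in m. G x \<le> G' x)))"


section \<open>Lipschitz derivations\<close>

text \<open>
  A derivation is represented by a map into representatives of \<open>L\<^sup>0\<close>; two such maps represent the same
  derivation if they agree almost everywhere on each member of \<^term>\<open>Lipb d\<close>.
\<close>

type_synonym 'a deriv_map = "('a \<Rightarrow> real) \<Rightarrow> 'a \<Rightarrow> real"

definition lipschitz_derivation ::
    "('a::topological_space \<Rightarrow> 'a \<Rightarrow> ennreal) \<Rightarrow> 'a measure \<Rightarrow> 'a deriv_map \<Rightarrow> bool" where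
  "lipschitz_derivation d m b \<longleftrightarrow>
     (\<forall>f\<in>Lipb d. b f \<in> borel_measurable m) \<and>
     (\<forall>f\<in>Lipb d. \<forall>g\<in>Lipb d. \<forall>\<alpha> \<beta>.
        AE x in m. b (\<lambda>y. \<alpha> * f y + \<beta> * g y) x = \<alpha> * b f x + \<beta> * b g x) \<and>
     (\<forall>f\<in>Lipb d. \<forall>g\<in>Lipb d. AE x in m. b (\<lambda>y. f y * g y) x = f x * b g x + g x * b f x)"

definition is_divergence ::
    "('a::topological_space \<Rightarrow> 'a \<Rightarrow> ennreal) \<Rightarrow> 'a measure \<Rightarrow> 'a deriv_map \<Rightarrow> ('a \<Rightarrow> real) \<Rightarrow> bool" where
  "is_divergence d m b D \<longleftrightarrow> integrable m D \<and>
     (\<forall>f\<in>Lipb d. (\<integral>x. b f x \<partial>m) = - (\<integral>x. f x * D x \<partial>m))"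

definition has_divergence ::
    "('a::topological_space \<Rightarrow> 'a \<Rightarrow> ennreal) \<Rightarrow> 'a measure \<Rightarrow> 'a deriv_map \<Rightarrow> bool" where
  "has_divergence d m b \<longleftrightarrow> (\<forall>f\<in>Lipb d. integrable m (b f)) \<and> (\<exists>D. is_divergence d m b D)"

definition divergence ::
    "('a::topological_space \<Rightarrow> 'a \<Rightarrow> ennreal) \<Rightarrow> 'a measure \<Rightarrow> 'a deriv_map \<Rightarrow> 'a \<Rightarrow> real" where
  "divergence d m b = (SOME D. is_divergence d m b D)"

definition deriv_bounds ::
    "real \<Rightarrow> ('a::topological_space \<Rightarrow> 'a \<Rightarrow> ennreal) \<Rightarrow> 'a measure \<Rightarrow> 'a deriv_map \<Rightarrow> ('a \<Rightarrow> real) set"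
  where
  "deriv_bounds q d m b =
     {g \<in> Lp_nonneg q m. \<forall>f\<in>Lipb d. AE x in m. \<bar>b f x\<bar> \<le> g x * lip d f x}"

definition Der ::
    "real \<Rightarrow> ('a::topological_space \<Rightarrow> 'a \<Rightarrow> ennreal) \<Rightarrow> 'a measure \<Rightarrow> 'a deriv_map set" where
  "Der q d m = {b. lipschitz_derivation d m b \<and> deriv_bounds q d m b \<noteq> {}}"

definition deriv_norm ::
    "real \<Rightarrow> ('a::topological_space \<Rightarrow> 'a \<Rightarrow> ennreal) \<Rightarrow> 'a measure \<Rightarrow> 'a deriv_map \<Rightarrow> 'a \<Rightarrow> real" where
  "deriv_norm q d m b = ess_inf m (deriv_bounds q d m b)"

definition Der_div ::
    "real \<Rightarrow> ('a::topological_space \<Rightarrow> 'a \<Rightarrow> ennreal) \<Rightarrow> 'a measure \<Rightarrow> 'a deriv_map set" where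
  "Der_div q d m = {b \<in> Der q d m. has_divergence d m b \<and> divergence d m b \<in> Lp q m}"


section \<open>The space \<open>W\<^sup>1\<^sup>,\<^sup>p\<close>\<close>

definition slope_bounds ::
    "real \<Rightarrow> ('a::topological_space \<Rightarrow> 'a \<Rightarrow> ennreal) \<Rightarrow> 'a measure \<Rightarrow>
      ('a deriv_map \<Rightarrow> 'a \<Rightarrow> real) \<Rightarrow> ('a \<Rightarrow> real) set" where
  "slope_bounds p d m L =
     {g \<in> Lp_nonneg p m. \<forall>b\<in>Der_div (conj_exp p) d m.
        AE x in m. \<bar>L b x\<bar> \<le> g x * deriv_norm (conj_exp p) d m b x}"

text \<open>
  The operator acts on representatives of derivations.  It descends to almost everywhere classes: if
  \<open>b\<close> and \<open>b'\<close> represent the same derivation then \<open>b - b'\<close> has norm zero, so linearity and the bound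
  by some element of \<^const>\<open>slope_bounds\<close> force \<open>L b = L b'\<close> almost everywhere.
\<close>

definition is_weak_diff ::
    "real \<Rightarrow> ('a::topological_space \<Rightarrow> 'a \<Rightarrow> ennreal) \<Rightarrow> 'a measure \<Rightarrow> ('a \<Rightarrow> real) \<Rightarrow>
      ('a deriv_map \<Rightarrow> 'a \<Rightarrow> real) \<Rightarrow> bool" where
  "is_weak_diff p d m f L \<longleftrightarrow>
     (\<forall>b\<in>Der_div (conj_exp p) d m. integrable m (L b)) \<and>
     (\<forall>b\<in>Der_div (conj_exp p) d m. \<forall>b'\<in>Der_div (conj_exp p) d m. \<forall>\<alpha> \<beta>.
        AE x in m. L (\<lambda>g y. \<alpha> * b g y + \<beta> * b' g y) x = \<alpha> * L b x + \<beta> * L b' x) \<and>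
     slope_bounds p d m L \<noteq> {} \<and>
     (\<forall>h\<in>Lipb d. \<forall>b\<in>Der_div (conj_exp p) d m.
        AE x in m. L (\<lambda>g y. h y * b g y) x = h x * L b x) \<and>
     (\<forall>b\<in>Der_div (conj_exp p) d m.
        (\<integral>x. L b x \<partial>m) = - (\<integral>x. f x * divergence d m b x \<partial>m))"

definition W1p ::
    "real \<Rightarrow> ('a::topological_space \<Rightarrow> 'a \<Rightarrow> ennreal) \<Rightarrow> 'a measure \<Rightarrow> ('a \<Rightarrow> real) set" where
  "W1p p d m = {f \<in> Lp p m. \<exists>L. is_weak_diff p d m f L}"

definition weak_diff ::
    "real \<Rightarrow> ('a::topological_space \<Rightarrow> 'a \<Rightarrow> ennreal) \<Rightarrow> 'a measure \<Rightarrow> ('a \<Rightarrow> real) \<Rightarrow>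
      'a deriv_map \<Rightarrow> 'a \<Rightarrow> real" where
  "weak_diff p d m f = (SOME L. is_weak_diff p d m f L)"

definition weak_slope ::
    "real \<Rightarrow> ('a::topological_space \<Rightarrow> 'a \<Rightarrow> ennreal) \<Rightarrow> 'a measure \<Rightarrow> ('a \<Rightarrow> real) \<Rightarrow> 'a \<Rightarrow> real" where
  "weak_slope p d m f = ess_inf m (slope_bounds p d m (weak_diff p d m f))"

end

theory Submission imports Defs begin

text \<open>
  Suppose \<open>f\<close> is the \<open>L\<^sup>p\<close> limit of Lipschitz functions \<open>u\<^sub>n\<close> with \<open>lip u\<^sub>n \<rightarrow> G\<close> strongly.  For a derivation \<open>b\<close>
  with divergence the functions \<open>b (u\<^sub>n)\<close> are dominated by \<open>|b| lip u\<^sub>n\<close>, and integrating by parts shows that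
  they converge weakly in \<open>L\<^sup>1\<close>; the limit is \<open>L\<^sub>f (b)\<close>, and \<open>G\<close> bounds it.  The same computation shows that
  every relaxed slope is bounded from below by \<open>|Df|\<close>.

  Conversely, if \<open>g\<close> bounds \<open>L\<^sub>f\<close>, then \<open>inf\<^sub>u \<parallel>\<lambda> |u - f| + lip u\<parallel> \<le> \<parallel>g\<parallel>\<close> for every \<open>\<lambda>\<close>: by Hahn-Banach the infimum is
  attained by a functional on the space of jets, normed by \<open>\<lambda> |J (x, x)| + lip (J (x, \<cdot>)) (x)\<close>, that vanishes on
  the jets of Lipschitz functions.  Its differential part is a derivation \<open>b\<close> with \<open>\<parallel>b\<parallel> \<le> 1\<close> in \<open>L\<^sup>q\<close>, its value part is
  the divergence of \<open>b\<close>, and hence the infimum equals \<open>\<integral> f div b = - \<integral> L\<^sub>f (b) \<le> \<parallel>g\<parallel>\<close>.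

  Letting \<open>\<lambda>\<close> grow, almost minimizers converge to \<open>f\<close>, and since \<open>L\<^sup>p\<close> is uniformly convex their slopes converge
  strongly to some \<open>G\<close> with \<open>\<parallel>G\<parallel> \<le> \<parallel>g\<parallel>\<close>.  For \<open>g = |Df|\<close> this \<open>G\<close> is a relaxed slope, so \<open>|Df| \<le> G\<close> and the two agree.
\<close>

section \<open>A Hahn-Banach theorem for spaces of real functions\<close>

text \<open>The slope is only sublinear and is measured pointwise, so a derivation appears only
  after the dual functional is localized: it must act on \<open>h du\<close> for bounded measurable
  \<open>h\<close>, although such products are not differentials of Lipschitz functions. Jets supply
  them. Since the jet norm is pointwise and homogeneous under multiplication by functions of the
  base point, a functional bounded by its \<open>L^p\<close> norm is dominated by integration
  against one density \<open>\<beta>\<close> in \<open>L^q\<close>. Value and slope are added before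
  the \<open>L^p\<close> norm is taken, so the same \<open>\<beta>\<close> bounds the derivation (by
  \<open>\<beta> lip\<close>) and its divergence (by \<open>\<lambda> \<beta>\<close>), which puts
  the divergence in \<open>L^q\<close>. Strong convergence of slopes is what builds
  \<open>L\<close>: the dominating functions \<open>|b| lip u_n\<close> then converge in
  \<open>L^1\<close>, and weak limits follow from a Cauchy argument instead of weak compactness. The
  topology need not be metrizable, so passing from Lipschitz test functions to indicators rests on
  inner regularity and Stone-Weierstrass on compact sets.\<close>

definition fun_space :: "('i \<Rightarrow> real) set \<Rightarrow> bool" where
  "fun_space V \<longleftrightarrow> (\<lambda>_. 0) \<in> V \<and> (\<forall>f\<in>V. \<forall>g\<in>V. \<forall>\<alpha> \<beta>. (\<lambda>i. \<alpha> * f i + \<beta> * g i) \<in> V)"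

definition sublinear_on :: "('i \<Rightarrow> real) set \<Rightarrow> (('i \<Rightarrow> real) \<Rightarrow> real) \<Rightarrow> bool" where
  "sublinear_on V q \<longleftrightarrow> (\<forall>f\<in>V. \<forall>g\<in>V. q (\<lambda>i. f i + g i) \<le> q f + q g) \<and>
     (\<forall>f\<in>V. \<forall>c>0. q (\<lambda>i. c * f i) = c * q f)"

definition linear_on_funs :: "('i \<Rightarrow> real) set \<Rightarrow> (('i \<Rightarrow> real) \<Rightarrow> real) \<Rightarrow> bool" where
  "linear_on_funs V T \<longleftrightarrow> (\<forall>f\<in>V. \<forall>g\<in>V. \<forall>\<alpha> \<beta>. T (\<lambda>i. \<alpha> * f i + \<beta> * g i) = \<alpha> * T f + \<beta> * T g)"

lemma fun_space_add: "fun_space V \<Longrightarrow> f \<in> V \<Longrightarrow> g \<in> V \<Longrightarrow> (\<lambda>i. f i + g i) \<in> V"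
  unfolding fun_space_def by (drule conjunct2) (force dest: bspec[of _ _ f] bspec[of _ _ g] spec[of _ "1::real"])

lemma fun_space_scale: "fun_space V \<Longrightarrow> f \<in> V \<Longrightarrow> (\<lambda>i. c * f i) \<in> V" for c :: real
proof -
  assume V: "fun_space V" "f \<in> V"
  then have "(\<lambda>i. c * f i + 0 * f i) \<in> V" unfolding fun_space_def by blast
  then show ?thesis by simp
qed

lemma fun_space_uminus: "fun_space V \<Longrightarrow> f \<in> V \<Longrightarrow> (\<lambda>i. - f i) \<in> V"
  using fun_space_scale[of V f "-1"] by simp

lemma fun_space_zero: "fun_space V \<Longrightarrow> (\<lambda>i. 0) \<in> V"
  by (simp add: fun_space_def)

lemma sublinear_on_add: "sublinear_on V q \<Longrightarrow> f \<in> V \<Longrightarrow> g \<in> V \<Longrightarrow> q (\<lambda>i. f i + g i) \<le> q f + q g"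
  and sublinear_on_scale: "sublinear_on V q \<Longrightarrow> f \<in> V \<Longrightarrow> c > 0 \<Longrightarrow> q (\<lambda>i. c * f i) = c * q f"
  by (auto simp: sublinear_on_def)

lemma sublinear_on_zero: "fun_space V \<Longrightarrow> sublinear_on V q \<Longrightarrow> q (\<lambda>i. 0) = 0"
  using sublinear_on_scale[of V q "\<lambda>i. 0" 2] fun_space_zero by fastforce

lemma sublinear_on_lower:
  assumes "fun_space V" "sublinear_on V q" "f \<in> V"
  shows "- q (\<lambda>i. - f i) \<le> q f"
proof -
  have "q (\<lambda>i. f i + - f i) \<le> q f + q (\<lambda>i. - f i)"
    using assms fun_space_uminus sublinear_on_add by blast
  then show ?thesis using sublinear_on_zero[OF assms(1,2)] by simp
qed

text \<open>A minimal sublinear functional is fixed by this modification, for every \<open>v\<^sub>0\<close>, and is therefore additive.\<close>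

lemma sublinear_on_directional:
  assumes V: "fun_space V" and q: "sublinear_on V q" and v0: "v0 \<in> V"
  defines "r \<equiv> (\<lambda>v. INF t\<in>{0..}. q (\<lambda>i. v i + t * v0 i) - t * q v0)"
  shows "sublinear_on V r" and "\<And>v t. v \<in> V \<Longrightarrow> 0 \<le> t \<Longrightarrow> r v \<le> q (\<lambda>i. v i + t * v0 i) - t * q v0"
proof -
  note cl = fun_space_add[OF V] fun_space_scale[OF V] fun_space_uminus[OF V]
  have qt: "q (\<lambda>i. t * v0 i) = t * q v0" if "t \<ge> 0" for t
    using that sublinear_on_zero[OF V q] sublinear_on_scale[OF q v0, of t] by (cases "t = 0") auto
  \<comment> \<open>This bound, uniform in \<open>t\<close>, makes the real infimum defining
    \<open>r\<close> a genuine one.\<close>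
  have lower: "- q (\<lambda>i. - v i) \<le> q (\<lambda>i. v i + t * v0 i) - t * q v0" if "v \<in> V" "t \<ge> 0" for v t
  proof -
    have "q (\<lambda>i. (v i + t * v0 i) + - v i) \<le> q (\<lambda>i. v i + t * v0 i) + q (\<lambda>i. - v i)"
      by (intro sublinear_on_add[OF q] cl that v0)
    then show ?thesis using qt[OF that(2)] by simp
  qed
  have bdd: "bdd_below ((\<lambda>t. q (\<lambda>i. v i + t * v0 i) - t * q v0) ` {0..})" if "v \<in> V" for v
    using lower[OF that] by (intro bdd_belowI) auto
  show le: "r v \<le> q (\<lambda>i. v i + t * v0 i) - t * q v0" if "v \<in> V" "0 \<le> t" for v t
    unfolding r_def by (rule cINF_lower[OF bdd[OF that(1)]]) (use that in auto)
  have ge: "x \<le> r v" if "\<And>t. t \<ge> 0 \<Longrightarrow> x \<le> q (\<lambda>i. v i + t * v0 i) - t * q v0" for x v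
    unfolding r_def by (rule cINF_greatest) (use that in auto)
  have add: "r (\<lambda>i. f i + g i) \<le> r f + r g" if fg: "f \<in> V" "g \<in> V" for f g
  proof -
    have *: "r (\<lambda>i. f i + g i) \<le> (q (\<lambda>i. f i + t * v0 i) - t * q v0) + (q (\<lambda>i. g i + s * v0 i) - s * q v0)"
      if "t \<ge> 0" "s \<ge> 0" for t s
    proof -
      \<comment> \<open>The two infima are tested at unrelated \<open>t\<close> and
        \<open>s\<close>; the parameter \<open>t + s\<close> serves the sum, which is why the family
        ranges over all nonnegative parameters.\<close>
      have "r (\<lambda>i. f i + g i) \<le> q (\<lambda>i. (f i + g i) + (t + s) * v0 i) - (t + s) * q v0"
        by (rule le) (use that fg cl in auto)
      also have "(\<lambda>i. (f i + g i) + (t + s) * v0 i) = (\<lambda>i. (f i + t * v0 i) + (g i + s * v0 i))"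
        by (auto simp: algebra_simps)
      also have "q \<dots> \<le> q (\<lambda>i. f i + t * v0 i) + q (\<lambda>i. g i + s * v0 i)"
        by (intro sublinear_on_add[OF q] cl fg v0)
      finally show ?thesis by (simp add: algebra_simps)
    qed
    have "r (\<lambda>i. f i + g i) - (q (\<lambda>i. f i + t * v0 i) - t * q v0) \<le> r g" if "t \<ge> 0" for t
      by (rule ge) (use *[OF that] in \<open>simp add: algebra_simps\<close>)
    then have "r (\<lambda>i. f i + g i) - r g \<le> r f"
      by (intro ge) (simp add: algebra_simps)
    then show ?thesis by simp
  qed
  have scale1: "c * r f \<le> r (\<lambda>i. c * f i)" if f: "f \<in> V" and c: "c > 0" for f c
  proof (rule ge)
    fix t :: real assume t: "t \<ge> 0"
    have "c * r f \<le> c * (q (\<lambda>i. f i + (t/c) * v0 i) - (t/c) * q v0)"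
      by (rule mult_left_mono[OF le]) (use f c t in auto)
    also have "\<dots> = q (\<lambda>i. c * (f i + (t/c) * v0 i)) - t * q v0"
      using c by (simp add: sublinear_on_scale[OF q cl(1)[OF f cl(2)[OF v0]] c, of "t/c"] right_diff_distrib del: times_divide_eq_left)
    also have "(\<lambda>i. c * (f i + (t/c) * v0 i)) = (\<lambda>i. c * f i + t * v0 i)"
      using c by (auto simp: field_simps)
    finally show "c * r f \<le> q (\<lambda>i. c * f i + t * v0 i) - t * q v0" .
  qed
  have scale: "r (\<lambda>i. c * f i) = c * r f" if f: "f \<in> V" and c: "c > 0" for f c
  proof (rule antisym[OF _ scale1[OF f c]])
    have "(1/c) * r (\<lambda>i. c * f i) \<le> r (\<lambda>i. (1/c) * (c * f i))"
      by (rule scale1) (use cl f c in auto)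
    then show "r (\<lambda>i. c * f i) \<le> c * r f" using c by (simp add: field_simps)
  qed
  show "sublinear_on V r" unfolding sublinear_on_def using add scale by blast
qed

text \<open>Zorn's lemma: domination by \<open>P\<close> bounds each candidate at \<open>f\<close>
  below by \<open>- P (- f)\<close>, so a chain has a finite pointwise infimum. That infimum is
  subadditive because any two members of the chain lie above a common one.\<close>

lemma minimal_sublinear_exists:
  assumes V: "fun_space V" and P: "sublinear_on V P"
  shows "\<exists>q. sublinear_on V q \<and> (\<forall>f\<in>V. q f \<le> P f) \<and>
    (\<forall>r. sublinear_on V r \<longrightarrow> (\<forall>f\<in>V. r f \<le> q f) \<longrightarrow> (\<forall>f\<in>V. r f = q f))"
proof -
  note cl = fun_space_add[OF V] fun_space_scale[OF V] fun_space_uminus[OF V]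
  \<comment> \<open>Candidates are set to 0 off \<open>V\<close>, so that the pointwise order on all
    functions compares only their values on \<open>V\<close>.\<close>
  define A where "A = {q. sublinear_on V q \<and> (\<forall>f\<in>V. q f \<le> P f) \<and> (\<forall>f. f \<notin> V \<longrightarrow> q f = 0)}"
  have restr: "(\<lambda>f. if f \<in> V then r f else 0) \<in> A" if "sublinear_on V r" "\<forall>f\<in>V. r f \<le> P f" for r
    using that cl by (auto simp: A_def sublinear_on_def)
  have lower: "- P (\<lambda>i. - f i) \<le> q f" if "q \<in> A" "f \<in> V" for q f
    using sublinear_on_lower[OF V _ that(2), of q] that cl(3)[OF that(2)] by (fastforce simp: A_def)
  have "\<exists>m \<in> A. \<forall>a \<in> A. a \<le> m \<longrightarrow> a = m"
  proof (rule predicate_Zorn)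
    show "partial_order_on A (relation_of (\<lambda>x y. y \<le> x) A)"
      by (auto simp: partial_order_on_def preorder_on_def refl_on_def trans_def antisym_def relation_of_def)
  next
    fix C assume "C \<in> Chains (relation_of (\<lambda>x y. y \<le> x) A)"
    then have CA: "C \<subseteq> A" and tot: "\<And>a b. a \<in> C \<Longrightarrow> b \<in> C \<Longrightarrow> a \<le> b \<or> b \<le> a"
      by (auto simp: Chains_def relation_of_def)
    show "\<exists>u\<in>A. \<forall>a\<in>C. u \<le> a"
    proof (cases "C = {}")
      case True
      then show ?thesis using restr[OF P] by auto
    next
      case False
      define u where "u = (\<lambda>f. INF q\<in>C. q f)"
      have bdd: "bdd_below ((\<lambda>q. q f) ` C)" if "f \<in> V" for f
        using lower[OF _ that] CA by (intro bdd_belowI) auto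
      have le: "u f \<le> q f" if "f \<in> V" "q \<in> C" for f q
        unfolding u_def by (rule cINF_lower[OF bdd[OF that(1)] that(2)])
      have ge: "x \<le> u f" if "\<And>q. q \<in> C \<Longrightarrow> x \<le> q f" for x f
        unfolding u_def by (rule cINF_greatest) (use that False in auto)
      have add: "u (\<lambda>i. f i + g i) \<le> u f + u g" if fg: "f \<in> V" "g \<in> V" for f g
      proof -
        have *: "u (\<lambda>i. f i + g i) \<le> q f + r g" if qr: "q \<in> C" "r \<in> C" for q r
        proof -
          obtain s where s: "s \<in> C" "s \<le> q" "s \<le> r" using tot[OF qr] qr by blast
          have "u (\<lambda>i. f i + g i) \<le> s (\<lambda>i. f i + g i)" by (rule le) (use s cl fg in auto)
          also have "\<dots> \<le> s f + s g" using s CA fg by (auto simp: A_def sublinear_on_def)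
          also have "\<dots> \<le> q f + r g" using s by (simp add: le_fun_def add_mono)
          finally show ?thesis .
        qed
        have "u (\<lambda>i. f i + g i) - q f \<le> u g" if "q \<in> C" for q
          by (rule ge) (use *[OF that] in \<open>simp add: algebra_simps\<close>)
        then have "u (\<lambda>i. f i + g i) - u g \<le> u f"
          by (intro ge) (simp add: algebra_simps)
        then show ?thesis by simp
      qed
      have scale1: "c * u f \<le> u (\<lambda>i. c * f i)" if "f \<in> V" "c > 0" for f c
      proof (rule ge)
        fix q assume q: "q \<in> C"
        then show "c * u f \<le> q (\<lambda>i. c * f i)"
          using le[OF that(1) q] CA that by (auto simp: A_def sublinear_on_def)
      qed
      have scale: "u (\<lambda>i. c * f i) = c * u f" if f: "f \<in> V" and c: "c > 0" for f c
      proof (rule antisym[OF _ scale1[OF f c]])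
        have "(1/c) * u (\<lambda>i. c * f i) \<le> u (\<lambda>i. (1/c) * (c * f i))"
          by (rule scale1) (use cl f c in auto)
        then show "u (\<lambda>i. c * f i) \<le> c * u f" using c by (simp add: field_simps)
      qed
      obtain q0 where q0: "q0 \<in> C" using False by blast
      have "sublinear_on V u" using add scale by (auto simp: sublinear_on_def)
      moreover have "\<forall>f\<in>V. u f \<le> P f" using le[OF _ q0] q0 CA by (fastforce simp: A_def)
      ultimately have "(\<lambda>f. if f \<in> V then u f else 0) \<in> A" by (rule restr)
      moreover have "\<forall>a\<in>C. (\<lambda>f. if f \<in> V then u f else 0) \<le> a"
        using le CA by (auto simp: le_fun_def A_def)
      ultimately show ?thesis by blast
    qed
  qed
  then obtain m where m: "m \<in> A" and min: "\<And>a. a \<in> A \<Longrightarrow> a \<le> m \<Longrightarrow> a = m" by blast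
  show ?thesis
  proof (intro exI[of _ m] conjI allI impI ballI)
    show "sublinear_on V m" using m by (simp add: A_def)
    show "m f \<le> P f" if "f \<in> V" for f using m that by (simp add: A_def)
    fix r f assume r: "sublinear_on V r" "\<forall>f\<in>V. r f \<le> m f" and f: "f \<in> V"
    have "(\<lambda>f. if f \<in> V then r f else 0) \<in> A"
      by (rule restr) (use r m in \<open>force simp: A_def\<close>)+
    moreover have "(\<lambda>f. if f \<in> V then r f else 0) \<le> m"
      using r m by (auto simp: le_fun_def A_def)
    ultimately have "(\<lambda>f. if f \<in> V then r f else 0) = m" by (rule min)
    from fun_cong[OF this, of f] show "r f = m f" using f by simp
  qed
qed

text \<open>The minimal functional \<open>T\<close> is taken below the modification
  \<open>P'\<close> of \<open>P\<close>, not below \<open>P\<close> itself: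
  \<open>P' (- v0) \<le> P 0 - P v0\<close> then forces \<open>T v0 \<ge> P v0\<close>. Additivity
  comes from modifying \<open>T\<close> in direction \<open>g\<close>; by minimality the result
  equals \<open>T\<close>, and its parameter 1 gives
  \<open>T f \<le> T (f + g) - T g\<close>.\<close>

theorem hahn_banach_funs:
  assumes V: "fun_space V" and P: "sublinear_on V P" and v0: "v0 \<in> V"
  shows "\<exists>T. linear_on_funs V T \<and> (\<forall>f\<in>V. T f \<le> P f) \<and> T v0 = P v0"
proof -
  note cl = fun_space_add[OF V] fun_space_scale[OF V] fun_space_uminus[OF V]
  define P' where "P' = (\<lambda>v. INF t\<in>{0..}. P (\<lambda>i. v i + t * v0 i) - t * P v0)"
  have P': "sublinear_on V P'" and P'le: "\<And>v t. v \<in> V \<Longrightarrow> 0 \<le> t \<Longrightarrow> P' v \<le> P (\<lambda>i. v i + t * v0 i) - t * P v0"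
    using sublinear_on_directional[OF V P v0] unfolding P'_def by blast+
  obtain T where T: "sublinear_on V T" and TP': "\<And>f. f \<in> V \<Longrightarrow> T f \<le> P' f"
    and min: "\<And>r f. sublinear_on V r \<Longrightarrow> \<forall>f\<in>V. r f \<le> T f \<Longrightarrow> f \<in> V \<Longrightarrow> r f = T f"
    using minimal_sublinear_exists[OF V P'] by blast
  have add: "T (\<lambda>i. f i + g i) = T f + T g" if f: "f \<in> V" and g: "g \<in> V" for f g
  proof -
    define r where "r = (\<lambda>v. INF t\<in>{0..}. T (\<lambda>i. v i + t * g i) - t * T g)"
    have r: "sublinear_on V r" and rle: "\<And>v t. v \<in> V \<Longrightarrow> 0 \<le> t \<Longrightarrow> r v \<le> T (\<lambda>i. v i + t * g i) - t * T g"
      using sublinear_on_directional[OF V T g] unfolding r_def by blast+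
    have "r f = T f"
      by (rule min[OF r _ f]) (use rle[where t=0] in simp)
    then show ?thesis using rle[OF f, of 1] sublinear_on_add[OF T f g] by simp
  qed
  have neg: "T (\<lambda>i. - f i) = - T f" if "f \<in> V" for f
    using add[OF that cl(3)[OF that]] sublinear_on_zero[OF V T] by simp
  have scale: "T (\<lambda>i. c * f i) = c * T f" if f: "f \<in> V" for f c
  proof -
    consider "c > 0" | "c = 0" | "c < 0" by linarith
    then show ?thesis
    proof cases
      case 1 then show ?thesis using sublinear_on_scale[OF T f] by simp
    next
      case 2 then show ?thesis using sublinear_on_zero[OF V T] by simp
    next
      case 3 then show ?thesis
        using sublinear_on_scale[OF T f, of "-c"] neg[OF cl(2)[OF f, of c]] by simp
    qed
  qed
  have "linear_on_funs V T"
    unfolding linear_on_funs_def by (simp add: add scale cl)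
  moreover have TP: "T f \<le> P f" if "f \<in> V" for f
    using TP'[OF that] P'le[OF that, of 0] by simp
  moreover have "P v0 \<le> T v0"
    using TP'[OF cl(3)[OF v0]] P'le[OF cl(3)[OF v0], of 1] neg[OF v0] sublinear_on_zero[OF V P] by simp
  ultimately show ?thesis using v0 TP[OF v0] by (intro exI[of _ T] conjI ballI TP) auto
qed

section \<open>Lebesgue spaces over a finite measure\<close>

lemma powr_convex_combination:
  fixes x y :: real
  assumes "1 \<le> p" "0 \<le> x" "0 \<le> y" "0 \<le> u" "0 \<le> v" "u + v = 1"
  shows "(u * x + v * y) powr p \<le> u * x powr p + v * y powr p"
proof -
  have small: "(w * z) powr p \<le> w * z powr p" if "0 \<le> w" "w \<le> 1" "0 \<le> z" for w z :: real
  proof -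
    have "w powr p \<le> w powr 1"
      using that assms(1) by (intro powr_mono') auto
    then have "w powr p * z powr p \<le> w * z powr p"
      using that by (intro mult_right_mono) auto
    then show ?thesis using that by (simp add: powr_mult)
  qed
  consider "x = 0" | "y = 0" | "x > 0 \<and> y > 0" using assms by linarith
  then show ?thesis
  proof cases
    case 1 then show ?thesis using small[of v y] assms by simp
  next
    case 2 then show ?thesis using small[of u x] assms by simp
  next
    case 3
    have u: "u = 1 - v" using assms by simp
    show ?thesis
      unfolding u using 3 convex_onD[OF powr_convex[OF assms(1)], of v x y] assms by simp
  qed
qed

text \<open>The mean value theorem on the two halves of the interval gives derivatives at
  \<open>z1 < c < z2\<close>, and \<open>p * t powr (p - 1)\<close> is strictly increasing for
  \<open>p > 1\<close>. Only continuity is used at the endpoint 0.\<close>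

lemma powr_midpoint_strict:
  fixes x y :: real
  assumes p: "1 < p" and xy: "0 \<le> x" "0 \<le> y" "x \<noteq> y"
  shows "((x + y) / 2) powr p < (x powr p + y powr p) / 2"
proof -
  have *: "((x + y) / 2) powr p < (x powr p + y powr p) / 2" if xy: "0 \<le> x" "x < y" for x y
  proof -
    define c where "c = (x + y) / 2"
    have c: "x < c" "c < y" using xy by (auto simp: c_def)
    have D: "((\<lambda>t. t powr p) has_real_derivative p * t powr (p - 1)) (at t)" if "t > 0" for t
      using has_real_derivative_powr[OF that] .
    have cont: "continuous_on {a..b} (\<lambda>t. t powr p)" if "0 \<le> a" for a b :: real
      using p that by (intro continuous_on_powr' continuous_intros) auto
    have mvt: "\<exists>z. a < z \<and> z < b \<and> b powr p - a powr p = (b - a) * (p * z powr (p - 1))"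
      if ab: "0 \<le> a" "a < b" for a b
    proof -
      obtain l z where z: "a < z" "z < b" "((\<lambda>t. t powr p) has_real_derivative l) (at z)"
          "b powr p - a powr p = (b - a) * l"
        using MVT[OF ab(2) cont[OF ab(1)]] real_differentiable_def D ab by (meson order.strict_trans1)
      then have "l = p * z powr (p - 1)" using DERIV_unique[OF z(3) D] ab by simp
      then show ?thesis using z by blast
    qed
    obtain z1 where z1: "x < z1" "z1 < c" "c powr p - x powr p = (c - x) * (p * z1 powr (p - 1))"
      using mvt[OF xy(1) c(1)] by blast
    obtain z2 where z2: "c < z2" "z2 < y" "y powr p - c powr p = (y - c) * (p * z2 powr (p - 1))"
      using mvt[of c y] c xy by auto
    have "z1 powr (p - 1) < z2 powr (p - 1)"
      using z1 z2 xy p by (intro powr_less_mono2) auto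
    moreover have "y - c = c - x" by (simp add: c_def field_simps)
    ultimately have "c powr p - x powr p < y powr p - c powr p"
      using z1 z2 c p by simp
    then show ?thesis by (simp add: c_def)
  qed
  show ?thesis using *[of x y] *[of y x] xy by (cases "x < y") (auto simp: add.commute)
qed

text \<open>By homogeneity it suffices to treat \<open>s + t = 1\<close>, where compactness applies.\<close>

lemma powr_midpoint_gap:
  fixes p \<epsilon> :: real
  assumes p: "1 < p" and e: "0 < \<epsilon>"
  shows "\<exists>C\<ge>0. \<forall>s\<ge>0. \<forall>t\<ge>0. \<bar>s - t\<bar> powr p \<le>
    \<epsilon> * (s powr p + t powr p) + C * ((s powr p + t powr p) / 2 - ((s + t) / 2) powr p)"
proof -
  define \<Gamma> where "\<Gamma> = (\<lambda>s t. (s powr p + t powr p) / 2 - ((s + t) / 2) powr p)"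
  have \<Gamma>0: "0 \<le> \<Gamma> s t" if "0 \<le> s" "0 \<le> t" for s t
    using powr_midpoint_strict[OF p that] unfolding \<Gamma>_def by (cases "s = t") auto
  \<comment> \<open>\<open>K\<close> is the compact set where the \<epsilon>-term does not already
    exceed the left side. It misses \<open>t = 1/2\<close>, where the left side vanishes, so the gap
    has a positive minimum \<gamma> on \<open>K\<close>; as the left side is at most 1,
    \<open>C = 1 / \<gamma>\<close> works.\<close>
  define K where "K = {t\<in>{0..1::real}. \<epsilon> * (t powr p + (1 - t) powr p) \<le> \<bar>2 * t - 1\<bar> powr p}"
  have cont: "continuous_on {0..1} (\<lambda>t. \<epsilon> * (t powr p + (1 - t) powr p))"
    "continuous_on {0..1} (\<lambda>t. \<bar>2 * t - 1\<bar> powr p)" "continuous_on {0..1} (\<lambda>t. \<Gamma> t (1 - t))"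
    unfolding \<Gamma>_def using p by (auto intro!: continuous_intros continuous_on_powr')
  have "closed K" unfolding K_def by (intro continuous_on_closed_Collect_le cont) auto
  then have cK: "compact K"
    using compact_Int_closed[of "{0..1::real}" K] by (simp add: K_def Int_absorb1 subset_iff)
  have half: "\<exists>C\<ge>0. \<forall>t\<in>{0..1}. \<bar>2 * t - 1\<bar> powr p \<le> \<epsilon> * (t powr p + (1 - t) powr p) + C * \<Gamma> t (1 - t)"
  proof (cases "K = {}")
    case True
    then show ?thesis by (intro exI[of _ 0]) (force simp: K_def)
  next
    case False
    have "continuous_on K (\<lambda>t. \<Gamma> t (1 - t))"
      by (rule continuous_on_subset[OF cont(3)]) (auto simp: K_def)
    then obtain t0 where t0: "t0 \<in> K" "\<And>t. t \<in> K \<Longrightarrow> \<Gamma> t0 (1 - t0) \<le> \<Gamma> t (1 - t)"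
      using continuous_attains_inf[OF cK False] by meson
    define \<gamma> where "\<gamma> = \<Gamma> t0 (1 - t0)"
    have "t0 \<noteq> 1 - t0"
    proof
      assume "t0 = 1 - t0"
      then have h: "t0 = 1/2" by simp
      then have "\<epsilon> * ((1/2) powr p + (1/2) powr p) \<le> 0" using t0(1) p unfolding K_def h by simp
      moreover have "0 < \<epsilon> * ((1/2) powr p + (1/2) powr p)" using e by simp
      ultimately show False by simp
    qed
    then have \<gamma>: "\<gamma> > 0"
      using powr_midpoint_strict[OF p, of t0 "1 - t0"] t0(1) by (auto simp: K_def \<Gamma>_def \<gamma>_def)
    have "\<bar>2 * t - 1\<bar> powr p \<le> \<epsilon> * (t powr p + (1 - t) powr p) + (1/\<gamma>) * \<Gamma> t (1 - t)" if t: "t \<in> {0..1}" for t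
    proof (cases "t \<in> K")
      case True
      have "\<bar>2 * t - 1\<bar> powr p \<le> 1 powr p" using t p by (intro powr_mono2) auto
      moreover have "1 \<le> (1/\<gamma>) * \<Gamma> t (1 - t)" using t0(2)[OF True] \<gamma> by (simp add: \<gamma>_def)
      moreover have "0 \<le> \<epsilon> * (t powr p + (1 - t) powr p)" using e by simp
      ultimately show ?thesis by simp
    next
      case False
      have "0 \<le> (1/\<gamma>) * \<Gamma> t (1 - t)" using \<gamma> \<Gamma>0[of t "1-t"] t by simp
      then show ?thesis using False t by (simp add: K_def)
    qed
    then show ?thesis using \<gamma> by (intro exI[of _ "1/\<gamma>"]) auto
  qed
  then obtain C where C: "C \<ge> 0"
    "\<And>t. t \<in> {0..1} \<Longrightarrow> \<bar>2 * t - 1\<bar> powr p \<le> \<epsilon> * (t powr p + (1 - t) powr p) + C * \<Gamma> t (1 - t)" by blast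
  have "\<bar>s - t\<bar> powr p \<le> \<epsilon> * (s powr p + t powr p) + C * \<Gamma> s t" if st: "0 \<le> s" "0 \<le> t" for s t
  proof (cases "s + t = 0")
    case True
    then have "s = 0" "t = 0" using st by auto
    then show ?thesis by (simp add: \<Gamma>_def)
  next
    case False
    define r where "r = s + t"
    have r: "r > 0" using False st by (simp add: r_def)
    define a where "a = s / r"
    have a: "a \<in> {0..1}" and sa: "s = r * a" and ta: "t = r * (1 - a)"
      using r st by (auto simp: a_def r_def field_simps)
    have "s - t = r * (2 * a - 1)" by (simp add: sa ta algebra_simps)
    then have "\<bar>s - t\<bar> = r * \<bar>2 * a - 1\<bar>" using r by (simp add: abs_mult)
    then have 1: "\<bar>s - t\<bar> powr p = r powr p * \<bar>2 * a - 1\<bar> powr p" using r by (simp add: powr_mult)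
    have 2: "s powr p = r powr p * a powr p" "t powr p = r powr p * (1 - a) powr p"
      using r a by (auto simp: sa ta powr_mult)
    have "(s + t) / 2 = r * (1/2)" by (simp add: r_def)
    then have 3: "((s + t) / 2) powr p = r powr p * (1/2) powr p"
      using r by (metis less_eq_real_def powr_mult zero_le_divide_1_iff zero_le_numeral)
    have 4: "\<Gamma> s t = r powr p * \<Gamma> a (1 - a)"
      unfolding \<Gamma>_def 3 2 by (simp add: algebra_simps)
    have "r powr p * \<bar>2 * a - 1\<bar> powr p \<le> r powr p * (\<epsilon> * (a powr p + (1 - a) powr p) + C * \<Gamma> a (1 - a))"
      by (rule mult_left_mono[OF C(2)[OF a]]) simp
    then show ?thesis unfolding 1 2 4 by (simp add: algebra_simps)
  qed
  then show ?thesis using C(1) unfolding \<Gamma>_def by blast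
qed

text \<open>Allows Holder's inequality to be normalized by \<open>norm + e > 0\<close>, so that no
  vanishing norm is ever divided by.\<close>

lemma le_product_from_eps:
  fixes x a b :: real
  assumes "\<And>e. e > 0 \<Longrightarrow> x \<le> (a + e) * (b + e)"
  shows "x \<le> a * b"
proof (rule tendsto_lowerbound[of "\<lambda>e. (a + e) * (b + e)" _ "at_right 0"])
  have "((\<lambda>e. (a + e) * (b + e)) \<longlongrightarrow> (a + 0) * (b + 0)) (at_right 0)"
    by (intro tendsto_intros)
  then show "((\<lambda>e. (a + e) * (b + e)) \<longlongrightarrow> a * b) (at_right 0)" by simp
  show "\<forall>\<^sub>F e in at_right 0. x \<le> (a + e) * (b + e)"
    using assms eventually_at_right_less[of "0::real"] by (auto elim: eventually_mono)
qed simp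

lemma tendsto_zero_sandwich:
  fixes a b :: "nat \<Rightarrow> real"
  assumes "b \<longlonglongrightarrow> 0" "\<And>n. 0 \<le> a n" "\<And>n. a n \<le> b n"
  shows "a \<longlonglongrightarrow> 0"
  by (rule tendsto_sandwich[OF always_eventually always_eventually tendsto_const assms(1)]) (simp_all add: assms)

section \<open>Membership in \<open>Lp\<close>, and the inequalities of Minkowski and Holder\<close>

lemma conj_exp:
  assumes "1 < p"
  shows "1 < conj_exp p" "1 / p + 1 / conj_exp p = 1" "(conj_exp p - 1) * p = conj_exp p"
  using assms by (auto simp: conj_exp_def field_simps)

lemma Lp_measurable[measurable_dest]: "f \<in> Lp p M \<Longrightarrow> f \<in> borel_measurable M"
  by (simp add: Lp_def)

lemma Lp_powr_integrable: "f \<in> Lp p M \<Longrightarrow> integrable M (\<lambda>x. \<bar>f x\<bar> powr p)"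
  by (simp add: Lp_def)

lemma Lp_nonneg_Lp: "f \<in> Lp_nonneg p M \<Longrightarrow> f \<in> Lp p M"
  and Lp_nonneg_AE: "f \<in> Lp_nonneg p M \<Longrightarrow> AE x in M. 0 \<le> f x"
  by (auto simp: Lp_nonneg_def)

lemma Lp_bound:
  assumes "0 < p" "g \<in> Lp p M" and [measurable]: "f \<in> borel_measurable M" and "AE x in M. \<bar>f x\<bar> \<le> \<bar>g x\<bar>"
  shows "f \<in> Lp p M"
proof -
  have "integrable M (\<lambda>x. \<bar>f x\<bar> powr p)"
  proof (rule Bochner_Integration.integrable_bound[OF Lp_powr_integrable[OF assms(2)]])
    show "AE x in M. norm (\<bar>f x\<bar> powr p) \<le> norm (\<bar>g x\<bar> powr p)"
      using assms(4) by eventually_elim (use assms(1) in \<open>auto intro: powr_mono2\<close>)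
  qed simp
  then show ?thesis by (simp add: Lp_def)
qed

lemma Lp_scale:
  assumes "f \<in> Lp p M"
  shows "(\<lambda>x. c * f x) \<in> Lp p M"
  using assms by (auto simp: Lp_def abs_mult powr_mult)

lemma Lp_add:
  assumes p: "0 < p" and f: "f \<in> Lp p M" and g: "g \<in> Lp p M"
  shows "(\<lambda>x. f x + g x) \<in> Lp p M"
proof -
  have [measurable]: "f \<in> borel_measurable M" "g \<in> borel_measurable M" using f g by (auto simp: Lp_def)
  have bound: "\<bar>f x + g x\<bar> powr p \<le> 2 powr p * \<bar>f x\<bar> powr p + 2 powr p * \<bar>g x\<bar> powr p" for x
  proof -
    have "\<bar>f x + g x\<bar> powr p \<le> (2 * max \<bar>f x\<bar> \<bar>g x\<bar>) powr p"
      using p by (intro powr_mono2) auto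
    also have "\<dots> = 2 powr p * (max \<bar>f x\<bar> \<bar>g x\<bar>) powr p" by (simp add: powr_mult)
    also have "\<dots> \<le> 2 powr p * (\<bar>f x\<bar> powr p + \<bar>g x\<bar> powr p)"
      by (intro mult_left_mono) (auto simp: max_def)
    finally show ?thesis by (simp add: algebra_simps)
  qed
  have "integrable M (\<lambda>x. \<bar>f x + g x\<bar> powr p)"
    by (rule Bochner_Integration.integrable_bound[where f = "\<lambda>x. 2 powr p * \<bar>f x\<bar> powr p + 2 powr p * \<bar>g x\<bar> powr p"])
       (use f g bound in \<open>auto simp: Lp_def intro: order_trans\<close>)
  then show ?thesis by (simp add: Lp_def)
qed

lemma Lp_lincomb:
  assumes "0 < p" "f \<in> Lp p M" "g \<in> Lp p M"
  shows "(\<lambda>x. \<alpha> * f x + \<beta> * g x) \<in> Lp p M"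
  by (intro Lp_add Lp_scale assms)

lemma Lp_diff:
  assumes "0 < p" "f \<in> Lp p M" "g \<in> Lp p M"
  shows "(\<lambda>x. f x - g x) \<in> Lp p M"
  using Lp_lincomb[OF assms, of 1 "-1"] by simp

lemma Lp_abs: "f \<in> Lp p M \<Longrightarrow> (\<lambda>x. \<bar>f x\<bar>) \<in> Lp p M"
  by (auto simp: Lp_def)

lemma Lp_mult_bounded:
  assumes "0 < p" and f: "f \<in> Lp p M" and [measurable]: "h \<in> borel_measurable M" and h: "\<And>x. \<bar>h x\<bar> \<le> C"
  shows "(\<lambda>x. h x * f x) \<in> Lp p M"
proof (rule Lp_bound[OF assms(1) Lp_scale[OF f]])
  show "AE x in M. \<bar>h x * f x\<bar> \<le> \<bar>C * f x\<bar>"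
  proof (rule AE_I2)
    fix x
    have "\<bar>h x\<bar> \<le> \<bar>C\<bar>" using h[of x] by linarith
    then show "\<bar>h x * f x\<bar> \<le> \<bar>C * f x\<bar>" by (simp add: abs_mult mult_right_mono)
  qed
qed (use f in measurable)

lemma Lp_norm_nonneg: "0 \<le> Lp_norm p M f"
  by (simp add: Lp_norm_def)

lemma Lp_norm_powr:
  assumes "0 < p"
  shows "Lp_norm p M f powr p = (\<integral>x. \<bar>f x\<bar> powr p \<partial>M)"
  using assms by (simp add: Lp_norm_def powr_powr integral_nonneg_AE)

lemma Lp_norm_le_iff:
  assumes "0 < p" "0 \<le> a"
  shows "Lp_norm p M f \<le> a \<longleftrightarrow> (\<integral>x. \<bar>f x\<bar> powr p \<partial>M) \<le> a powr p"
  unfolding Lp_norm_powr[OF assms(1), symmetric] using assms Lp_norm_nonneg[of p M f]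
  by (meson linorder_not_le powr_less_mono2 powr_mono2 order_less_imp_le)

lemma Lp_norm_mono:
  assumes p: "0 < p" and g: "g \<in> Lp p M" and fm: "f \<in> borel_measurable M" and le: "AE x in M. \<bar>f x\<bar> \<le> \<bar>g x\<bar>"
  shows "Lp_norm p M f \<le> Lp_norm p M g"
proof -
  have f: "f \<in> Lp p M" by (rule Lp_bound[OF p g fm le])
  have "(\<integral>x. \<bar>f x\<bar> powr p \<partial>M) \<le> (\<integral>x. \<bar>g x\<bar> powr p \<partial>M)"
    by (rule integral_mono_AE[OF Lp_powr_integrable[OF f] Lp_powr_integrable[OF g]])
       (use le in \<open>eventually_elim, use p in \<open>auto intro: powr_mono2\<close>\<close>)
  then show ?thesis using p by (simp add: Lp_norm_le_iff Lp_norm_nonneg Lp_norm_powr)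
qed

lemma Lp_norm_scale:
  assumes "0 < p"
  shows "Lp_norm p M (\<lambda>x. c * f x) = \<bar>c\<bar> * Lp_norm p M f"
  using assms by (simp add: Lp_norm_def abs_mult powr_mult powr_powr integral_nonneg_AE)

lemma Lp_norm_zero: "Lp_norm p M (\<lambda>x. 0) = 0"
  by (simp add: Lp_norm_def)

lemma Lp_norm_abs: "Lp_norm p M (\<lambda>x. \<bar>f x\<bar>) = Lp_norm p M f"
  by (simp add: Lp_norm_def)

lemma Lp_norm_minus_commute: "Lp_norm p M (\<lambda>x. f x - g x) = Lp_norm p M (\<lambda>x. g x - f x)"
  by (simp add: Lp_norm_def abs_minus_commute)

text \<open>Convexity of the power is applied to \<open>|f| / a\<close> and \<open>|g| / b\<close>
  with weights \<open>a / s\<close> and \<open>b / s\<close>, where \<open>s = a + b\<close>. Adding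
  \<open>e / 2\<close> to each norm keeps \<open>a\<close> and \<open>b\<close> positive.\<close>

lemma Lp_norm_triangle:
  assumes p: "1 < p" and f: "f \<in> Lp p M" and g: "g \<in> Lp p M"
  shows "Lp_norm p M (\<lambda>x. f x + g x) \<le> Lp_norm p M f + Lp_norm p M g"
proof (rule field_le_epsilon)
  fix e :: real assume e: "e > 0"
  define a b where "a = Lp_norm p M f + e/2" and "b = Lp_norm p M g + e/2"
  have p0: "p > 0" using p by simp
  have a: "a > 0" and b: "b > 0" using e Lp_norm_nonneg[of p M f] Lp_norm_nonneg[of p M g] by (auto simp: a_def b_def)
  have Ia: "(\<integral>x. \<bar>f x\<bar> powr p \<partial>M) \<le> a powr p" and Ib: "(\<integral>x. \<bar>g x\<bar> powr p \<partial>M) \<le> b powr p"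
    using a b e p0 by (auto simp flip: Lp_norm_le_iff simp: a_def b_def)
  define s where "s = a + b"
  have s: "s > 0" using a b by (simp add: s_def)
  have ab: "a / s + b / s = 1" using s by (simp add: s_def flip: add_divide_distrib)
  have pt: "\<bar>f x + g x\<bar> powr p \<le> s powr p * (a / s / a powr p * \<bar>f x\<bar> powr p + b / s / b powr p * \<bar>g x\<bar> powr p)" for x
  proof -
    have "\<bar>f x + g x\<bar> powr p \<le> (s * (a / s * (\<bar>f x\<bar> / a) + b / s * (\<bar>g x\<bar> / b))) powr p"
      using a b s p0 abs_triangle_ineq[of "f x" "g x"]
      by (intro powr_mono2) (auto simp: distrib_left)
    also have "\<dots> = s powr p * (a / s * (\<bar>f x\<bar> / a) + b / s * (\<bar>g x\<bar> / b)) powr p"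
      using a b s by (intro powr_mult)
    also have "\<dots> \<le> s powr p * (a / s * (\<bar>f x\<bar> / a) powr p + b / s * (\<bar>g x\<bar> / b) powr p)"
      using a b s p ab by (intro mult_left_mono powr_convex_combination) auto
    finally show ?thesis using a b by (simp add: powr_divide mult.assoc)
  qed
  have fg: "(\<lambda>x. f x + g x) \<in> Lp p M" by (rule Lp_add[OF p0 f g])
  have "(\<integral>x. \<bar>f x + g x\<bar> powr p \<partial>M)
      \<le> (\<integral>x. s powr p * (a / s / a powr p * \<bar>f x\<bar> powr p + b / s / b powr p * \<bar>g x\<bar> powr p) \<partial>M)"
    using Lp_powr_integrable[OF f] Lp_powr_integrable[OF g] Lp_powr_integrable[OF fg]
    by (intro integral_mono pt) auto
  also have "\<dots> = s powr p * (a / s / a powr p * (\<integral>x. \<bar>f x\<bar> powr p \<partial>M) + b / s / b powr p * (\<integral>x. \<bar>g x\<bar> powr p \<partial>M))"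
    using Lp_powr_integrable[OF f] Lp_powr_integrable[OF g] by simp
  also have "\<dots> \<le> s powr p * (a / s / a powr p * a powr p + b / s / b powr p * b powr p)"
    using a b s by (intro mult_left_mono add_mono Ia Ib) auto
  also have "\<dots> = s powr p * ((a + b) / s)" using a b by (simp add: add_divide_distrib)
  also have "\<dots> = s powr p" using s by (simp add: s_def)
  finally have "Lp_norm p M (\<lambda>x. f x + g x) \<le> s"
    using s p0 by (simp add: Lp_norm_le_iff)
  then show "Lp_norm p M (\<lambda>x. f x + g x) \<le> Lp_norm p M f + Lp_norm p M g + e"
    by (simp add: s_def a_def b_def)
qed

text \<open>Young's inequality gives integrability at once. Applied to \<open>|f| / a\<close> and
  \<open>|g| / b\<close>, whose power integrals are at most 1, it gives the product bound because
  \<open>1 / p + 1 / q = 1\<close>.\<close>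

lemma Lp_holder:
  assumes p: "1 < p" and f: "f \<in> Lp p M" and g: "g \<in> Lp (conj_exp p) M"
  shows "integrable M (\<lambda>x. f x * g x)"
    and "(\<integral>x. \<bar>f x * g x\<bar> \<partial>M) \<le> Lp_norm p M f * Lp_norm (conj_exp p) M g"
proof -
  define q where "q = conj_exp p"
  have q: "1 < q" "1 / p + 1 / q = 1" using conj_exp[OF p] by (auto simp: q_def)
  have g: "g \<in> Lp q M" using g by (simp add: q_def)
  have [measurable]: "f \<in> borel_measurable M" "g \<in> borel_measurable M" using f g by (auto simp: Lp_def)
  note I = Lp_powr_integrable[OF f] Lp_powr_integrable[OF g]
  have young: "\<bar>f x * g x\<bar> \<le> \<bar>f x\<bar> powr p / p + \<bar>g x\<bar> powr q / q" for x
    unfolding abs_mult using p q by (intro Youngs_inequality) auto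
  show int: "integrable M (\<lambda>x. f x * g x)"
    by (rule Bochner_Integration.integrable_bound[where f = "\<lambda>x. \<bar>f x\<bar> powr p / p + \<bar>g x\<bar> powr q / q"])
       (use I young in \<open>auto intro!: AE_I2 intro: order_trans[OF _ abs_ge_self]\<close>)
  have "(\<integral>x. \<bar>f x * g x\<bar> \<partial>M) \<le> (Lp_norm p M f + e) * (Lp_norm q M g + e)" if e: "e > 0" for e
  proof -
    define a b where "a = Lp_norm p M f + e" and "b = Lp_norm q M g + e"
    have a: "a > 0" and b: "b > 0" using e Lp_norm_nonneg[of p M f] Lp_norm_nonneg[of q M g] by (auto simp: a_def b_def)
    have Ia: "(\<integral>x. \<bar>f x\<bar> powr p \<partial>M) \<le> a powr p" and Ib: "(\<integral>x. \<bar>g x\<bar> powr q \<partial>M) \<le> b powr q"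
      using a b e p q by (auto simp flip: Lp_norm_le_iff simp: a_def b_def)
    have pt: "\<bar>f x * g x\<bar> \<le> a * b * (\<bar>f x\<bar> powr p / a powr p / p + \<bar>g x\<bar> powr q / b powr q / q)" for x
    proof -
      have "\<bar>f x * g x\<bar> = a * b * ((\<bar>f x\<bar> / a) * (\<bar>g x\<bar> / b))" using a b by (simp add: abs_mult)
      also have "\<dots> \<le> a * b * ((\<bar>f x\<bar> / a) powr p / p + (\<bar>g x\<bar> / b) powr q / q)"
        using a b p q by (intro mult_left_mono Youngs_inequality) auto
      finally show ?thesis using a b by (simp add: powr_divide)
    qed
    have "(\<integral>x. \<bar>f x * g x\<bar> \<partial>M) \<le> (\<integral>x. a * b * (\<bar>f x\<bar> powr p / a powr p / p + \<bar>g x\<bar> powr q / b powr q / q) \<partial>M)"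
      using I int by (intro integral_mono pt) auto
    also have "\<dots> = a * b * ((\<integral>x. \<bar>f x\<bar> powr p \<partial>M) / a powr p / p + (\<integral>x. \<bar>g x\<bar> powr q \<partial>M) / b powr q / q)"
      using I by simp
    also have "\<dots> \<le> a * b * (a powr p / a powr p / p + b powr q / b powr q / q)"
      using a b p q by (intro mult_left_mono add_mono divide_right_mono Ia Ib) auto
    also have "\<dots> = a * b" using a b q by simp
    finally show ?thesis by (simp add: a_def b_def)
  qed
  then show "(\<integral>x. \<bar>f x * g x\<bar> \<partial>M) \<le> Lp_norm p M f * Lp_norm (conj_exp p) M g"
    unfolding q_def by (rule le_product_from_eps)
qed

lemma Lp_holder_le:
  assumes p: "1 < p" and f: "f \<in> Lp p M" and g: "g \<in> Lp (conj_exp p) M"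
  shows "\<bar>\<integral>x. f x * g x \<partial>M\<bar> \<le> Lp_norm p M f * Lp_norm (conj_exp p) M g"
  using integral_abs_bound[of M "\<lambda>x. f x * g x"] Lp_holder(2)[OF assms] by linarith

text \<open>The norm inequality runs against the pointwise one, so the nonnegative function
  \<open>|G| powr p - |g| powr p\<close> has integral 0. This later identifies the limit slope of an
  optimal sequence with the weak slope.\<close>

lemma Lp_norm_eq_imp_AE_eq:
  assumes p: "0 < p" and G: "G \<in> Lp p M" and gm: "g \<in> borel_measurable M"
    and le: "AE x in M. 0 \<le> g x \<and> g x \<le> G x" and norm: "Lp_norm p M G \<le> Lp_norm p M g"
  shows "AE x in M. G x = g x"
proof -
  have g: "g \<in> Lp p M" by (rule Lp_bound[OF p G gm]) (use le in auto)
  note I = Lp_powr_integrable[OF g] Lp_powr_integrable[OF G]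
  have ge: "AE x in M. 0 \<le> \<bar>G x\<bar> powr p - \<bar>g x\<bar> powr p"
    using le by eventually_elim (use p in \<open>auto intro: powr_mono2\<close>)
  have "(\<integral>x. \<bar>G x\<bar> powr p - \<bar>g x\<bar> powr p \<partial>M) \<le> 0"
    using norm I Lp_norm_nonneg[of p M g] p by (simp add: Lp_norm_le_iff Lp_norm_powr)
  moreover have "(\<integral>x. \<bar>G x\<bar> powr p - \<bar>g x\<bar> powr p \<partial>M) \<ge> 0" by (rule integral_nonneg_AE[OF ge])
  ultimately have "(\<integral>x. \<bar>G x\<bar> powr p - \<bar>g x\<bar> powr p \<partial>M) = 0" by simp
  then have "AE x in M. \<bar>G x\<bar> powr p - \<bar>g x\<bar> powr p = 0"
    using integral_nonneg_eq_0_iff_AE[OF _ ge] I by simp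
  then show ?thesis using le
  proof eventually_elim
    case (elim x)
    then show ?case
      using powr_less_mono2[of p "g x" "G x"] p by (cases "g x = G x") auto
  qed
qed

section \<open>Completeness, minimizing sequences and duality pairings in \<open>Lp\<close> over a
  finite measure\<close>

context finite_measure begin

lemma Lp_bounded:
  assumes [measurable]: "f \<in> borel_measurable M" and p: "0 < p" and b: "\<And>x. \<bar>f x\<bar> \<le> C"
  shows "f \<in> Lp p M"
proof -
  have "integrable M (\<lambda>x. \<bar>f x\<bar> powr p)"
    by (rule integrable_const_bound[where B = "C powr p"]) (use b p in \<open>auto intro!: powr_mono2 AE_I2\<close>)
  then show ?thesis by (simp add: Lp_def)
qed

lemma Lp_const: "0 < p \<Longrightarrow> (\<lambda>x. c) \<in> Lp p M"
  by (rule Lp_bounded[where C = "\<bar>c\<bar>"]) auto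

lemma Lp_integrable:
  assumes "1 < p" "f \<in> Lp p M"
  shows "integrable M f"
  using Lp_holder(1)[OF assms, of "\<lambda>x. 1"] conj_exp[OF assms(1)] by (simp add: Lp_const)


lemma Lp_integral_abs_le:
  assumes "1 < p" "f \<in> Lp p M"
  shows "(\<integral>x. \<bar>f x\<bar> \<partial>M) \<le> Lp_norm p M f * Lp_norm (conj_exp p) M (\<lambda>x. 1)"
  using Lp_holder(2)[OF assms, of "\<lambda>x. 1"] conj_exp[OF assms(1)] by (simp add: Lp_const)

lemma Lp_small_iff:
  assumes p: "0 < p"
  shows "(\<lambda>n. Lp_norm p M (s n)) \<longlonglongrightarrow> 0 \<longleftrightarrow> (\<lambda>n. \<integral>x. \<bar>s n x\<bar> powr p \<partial>M) \<longlonglongrightarrow> 0"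
proof
  assume "(\<lambda>n. Lp_norm p M (s n)) \<longlonglongrightarrow> 0"
  then have "(\<lambda>n. Lp_norm p M (s n) powr p) \<longlonglongrightarrow> 0"
    using tendsto_powr'[of "\<lambda>n. Lp_norm p M (s n)" 0 sequentially "\<lambda>_. p" p] p Lp_norm_nonneg[of p M] by simp
  then show "(\<lambda>n. \<integral>x. \<bar>s n x\<bar> powr p \<partial>M) \<longlonglongrightarrow> 0" by (simp add: Lp_norm_powr p)
next
  assume "(\<lambda>n. \<integral>x. \<bar>s n x\<bar> powr p \<partial>M) \<longlonglongrightarrow> 0"
  then show "(\<lambda>n. Lp_norm p M (s n)) \<longlonglongrightarrow> 0"
    unfolding Lp_norm_def using p
    using tendsto_powr'[of "\<lambda>n. \<integral>x. \<bar>s n x\<bar> powr p \<partial>M" 0 sequentially "\<lambda>_. 1/p" "1/p"] by simp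
qed

text \<open>On a finite measure an \<open>L^p\<close> Cauchy sequence is Cauchy in
  \<open>L^1\<close>, hence converges almost everywhere along a subsequence. The subsequence is part
  of the conclusion because positivity of the limit is read off from it.\<close>

lemma Lp_complete:
  assumes p: "1 < p" and s: "\<And>n. s n \<in> Lp p M"
    and cauchy: "\<And>e. 0 < e \<Longrightarrow> \<exists>N. \<forall>i\<ge>N. \<forall>j\<ge>N. (\<integral>x. \<bar>s i x - s j x\<bar> powr p \<partial>M) \<le> e"
  obtains G where "G \<in> Lp p M" "(\<lambda>n. Lp_norm p M (\<lambda>x. s n x - G x)) \<longlonglongrightarrow> 0"
    "\<exists>r. strict_mono r \<and> (AE x in M. (\<lambda>i. s (r i) x) \<longlonglongrightarrow> G x)"
proof -
  have p0: "p > 0" using p by simp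
  have [measurable]: "s n \<in> borel_measurable M" for n using s by measurable
  have diff: "(\<lambda>x. s i x - s j x) \<in> Lp p M" for i j by (rule Lp_diff[OF p0 s s])
  \<comment> \<open>\<open>K\<close> compares the \<open>L^1\<close> norm with the
    \<open>L^p\<close> norm; the summand 1 keeps it positive even for the zero measure.\<close>
  define K where "K = Lp_norm (conj_exp p) M (\<lambda>x. 1) + 1"
  have K: "K > 0" using Lp_norm_nonneg[of "conj_exp p" M "\<lambda>x. 1"] by (simp add: K_def)
  have "\<exists>N. \<forall>i\<ge>N. \<forall>j\<ge>N. (LINT x|M. norm (s i x - s j x)) < e" if e: "e > 0" for e
  proof -
    define a where "a = e / (2 * K)"
    have a: "a > 0" using e K by (simp add: a_def)
    obtain N where N: "\<And>i j. i \<ge> N \<Longrightarrow> j \<ge> N \<Longrightarrow> (\<integral>x. \<bar>s i x - s j x\<bar> powr p \<partial>M) \<le> a powr p"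
      using cauchy[of "a powr p"] a by auto
    have "(LINT x|M. norm (s i x - s j x)) < e" if "i \<ge> N" "j \<ge> N" for i j
    proof -
      have "Lp_norm p M (\<lambda>x. s i x - s j x) \<le> a" using N[OF that] a p0 by (simp add: Lp_norm_le_iff)
      then have "(\<integral>x. \<bar>s i x - s j x\<bar> \<partial>M) \<le> a * K"
        using Lp_integral_abs_le[OF p diff, of i j] a
        by (smt (verit) K_def Lp_norm_nonneg mult_mono)
      also have "\<dots> = e / 2" using K by (simp add: a_def)
      finally show ?thesis using e by simp
    qed
    then show ?thesis by blast
  qed
  then obtain r where r: "strict_mono r" "AE x in M. Cauchy (\<lambda>i. s (r i) x)"
    using cauchy_L1_AE_cauchy_subseq[of M s] Lp_integrable[OF p s] by blast
  define G where "G = (\<lambda>x. lim (\<lambda>i. s (r i) x))"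
  have [measurable]: "G \<in> borel_measurable M" unfolding G_def by measurable
  have lim: "AE x in M. (\<lambda>i. s (r i) x) \<longlonglongrightarrow> G x"
    using r(2) by eventually_elim (simp add: G_def Cauchy_convergent_iff convergent_LIMSEQ_iff)
  \<comment> \<open>Fatou's lemma along the subsequence transfers the Cauchy estimate to the
    distance from \<open>G\<close>; \<open>r i \<ge> i\<close> keeps the subsequence beyond
    \<open>N\<close>.\<close>
  have bound: "(\<integral>\<^sup>+x. ennreal (\<bar>G x - s n x\<bar> powr p) \<partial>M) \<le> ennreal e"
    if N: "\<forall>i\<ge>N. \<forall>j\<ge>N. (\<integral>x. \<bar>s i x - s j x\<bar> powr p \<partial>M) \<le> e" and n: "n \<ge> N" for N n e
  proof -
    have "(\<integral>\<^sup>+x. ennreal (\<bar>G x - s n x\<bar> powr p) \<partial>M)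
        = (\<integral>\<^sup>+x. liminf (\<lambda>i. ennreal (\<bar>s (r i) x - s n x\<bar> powr p)) \<partial>M)"
    proof (rule nn_integral_cong_AE, use lim in eventually_elim)
      fix x assume "(\<lambda>i. s (r i) x) \<longlonglongrightarrow> G x"
      then have "(\<lambda>i. ennreal (\<bar>s (r i) x - s n x\<bar> powr p)) \<longlonglongrightarrow> ennreal (\<bar>G x - s n x\<bar> powr p)"
        using p0 by (intro tendsto_ennrealI tendsto_powr' tendsto_intros) auto
      then show "ennreal (\<bar>G x - s n x\<bar> powr p) = liminf (\<lambda>i. ennreal (\<bar>s (r i) x - s n x\<bar> powr p))"
        using lim_imp_Liminf[OF _ ] by (metis trivial_limit_sequentially)
    qed
    also have "\<dots> \<le> liminf (\<lambda>i. \<integral>\<^sup>+x. ennreal (\<bar>s (r i) x - s n x\<bar> powr p) \<partial>M)"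
      by (rule nn_integral_liminf) measurable
    also have "\<dots> \<le> ennreal e"
    proof (rule Liminf_le)
      show "\<forall>\<^sub>F i in sequentially. (\<integral>\<^sup>+x. ennreal (\<bar>s (r i) x - s n x\<bar> powr p) \<partial>M) \<le> ennreal e"
        using eventually_ge_at_top[of N]
      proof eventually_elim
        case (elim i)
        then have "r i \<ge> N" using seq_suble[OF r(1), of i] by linarith
        then show ?case
          using N n Lp_powr_integrable[OF diff[of "r i" n]]
          by (subst nn_integral_eq_integral) (auto intro: ennreal_leI)
      qed
    qed simp
    finally show ?thesis .
  qed
  obtain N1 where N1: "\<forall>i\<ge>N1. \<forall>j\<ge>N1. (\<integral>x. \<bar>s i x - s j x\<bar> powr p \<partial>M) \<le> 1"
    using cauchy[of 1] by auto
  have GsLp: "(\<lambda>x. G x - s N1 x) \<in> Lp p M"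
    using le_less_trans[OF bound[OF N1, of N1] ennreal_less_top] by (simp add: Lp_def integrable_iff_bounded)
  have GLp: "G \<in> Lp p M" using Lp_add[OF p0 GsLp s[of N1]] by simp
  have "(\<lambda>n. \<integral>x. \<bar>s n x - G x\<bar> powr p \<partial>M) \<longlonglongrightarrow> 0"
  proof (rule LIMSEQ_I)
    fix e :: real assume e: "e > 0"
    obtain N where N: "\<forall>i\<ge>N. \<forall>j\<ge>N. (\<integral>x. \<bar>s i x - s j x\<bar> powr p \<partial>M) \<le> e / 2"
      using cauchy[of "e / 2"] e by auto
    have "(\<integral>x. \<bar>s n x - G x\<bar> powr p \<partial>M) \<le> e / 2" if "n \<ge> N" for n
    proof -
      have "ennreal (\<integral>x. \<bar>G x - s n x\<bar> powr p \<partial>M) \<le> ennreal (e / 2)"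
        using bound[OF N that] Lp_powr_integrable[OF Lp_diff[OF p0 GLp s[of n]]]
        by (subst (asm) nn_integral_eq_integral) auto
      then show ?thesis using e by (simp add: abs_minus_commute)
    qed
    then show "\<exists>N. \<forall>n\<ge>N. norm ((\<integral>x. \<bar>s n x - G x\<bar> powr p \<partial>M) - 0) < e"
      using e by (intro exI[of _ N]) (force simp: integral_nonneg_AE)
  qed
  then have "(\<lambda>n. Lp_norm p M (\<lambda>x. s n x - G x)) \<longlonglongrightarrow> 0" by (simp add: Lp_small_iff[OF p0])
  then show ?thesis using that GLp r(1) lim by blast
qed

text \<open>The midpoint gap takes the place of uniform convexity.\<close>

lemma Lp_minimizing_sequence_converges:
  assumes p: "1 < p" and s: "\<And>n. s n \<in> Lp p M" and s0: "\<And>n x. 0 \<le> s n x"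
    and ub: "\<And>e. 0 < e \<Longrightarrow> \<exists>N. \<forall>n\<ge>N. (\<integral>x. s n x powr p \<partial>M) \<le> I + e"
    and lb: "\<And>e. 0 < e \<Longrightarrow> \<exists>N. \<forall>i\<ge>N. \<forall>j\<ge>N. I - e \<le> (\<integral>x. ((s i x + s j x) / 2) powr p \<partial>M)"
  obtains G where "G \<in> Lp_nonneg p M" "(\<lambda>n. Lp_norm p M (\<lambda>x. s n x - G x)) \<longlonglongrightarrow> 0"
proof -
  have p0: "p > 0" using p by simp
  have int: "integrable M (\<lambda>x. s n x powr p)" for n using Lp_powr_integrable[OF s[of n]] s0 by simp
  have int2: "integrable M (\<lambda>x. ((s i x + s j x) / 2) powr p)" for i j
    using Lp_powr_integrable[OF Lp_lincomb[OF p0 s[of i] s[of j], of "1/2" "1/2"]] s0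
    by (simp add: add_divide_distrib[symmetric])
  have I0: "I \<ge> 0"
  proof (rule field_le_epsilon)
    fix e :: real assume "e > 0"
    then obtain N where "(\<integral>x. s N x powr p \<partial>M) \<le> I + e" using ub by blast
    moreover have "0 \<le> (\<integral>x. s N x powr p \<partial>M)" by (simp add: integral_nonneg_AE)
    ultimately show "0 \<le> I + e" by linarith
  qed
  have cauchy: "\<exists>N. \<forall>i\<ge>N. \<forall>j\<ge>N. (\<integral>x. \<bar>s i x - s j x\<bar> powr p \<partial>M) \<le> e" if e: "e > 0" for e
  proof -
    \<comment> \<open>The constants split \<open>e\<close> in halves:
      \<open>A + B \<le> 2 * (I + 1)\<close> makes the \<open>e1\<close> term at most
      \<open>e / 2\<close>, and \<open>e2\<close> is chosen so that
      \<open>C * (2 * e2) \<le> e / 2\<close>. The summands 1 in the denominators cover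
      \<open>I = 0\<close> and \<open>C = 0\<close>.\<close>
    define e1 where "e1 = e / (4 * (I + 1))"
    have e1: "e1 > 0" using e I0 by (simp add: e1_def)
    obtain C where C: "C \<ge> 0" "\<And>s t. s \<ge> 0 \<Longrightarrow> t \<ge> 0 \<Longrightarrow> \<bar>s - t\<bar> powr p \<le>
        e1 * (s powr p + t powr p) + C * ((s powr p + t powr p) / 2 - ((s + t) / 2) powr p)"
      using powr_midpoint_gap[OF p e1] by blast
    define e2 where "e2 = min 1 (e / (4 * (C + 1)))"
    have e2: "e2 > 0" "e2 \<le> 1" using e C by (auto simp: e2_def)
    obtain N where N: "\<And>n. n \<ge> N \<Longrightarrow> (\<integral>x. s n x powr p \<partial>M) \<le> I + e2" using ub[OF e2(1)] by blast
    obtain N' where N': "\<And>i j. i \<ge> N' \<Longrightarrow> j \<ge> N' \<Longrightarrow> I - e2 \<le> (\<integral>x. ((s i x + s j x) / 2) powr p \<partial>M)"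
      using lb[OF e2(1)] by blast
    have "(\<integral>x. \<bar>s i x - s j x\<bar> powr p \<partial>M) \<le> e" if ij: "i \<ge> max N N'" "j \<ge> max N N'" for i j
    proof -
      define A B D where "A = (\<integral>x. s i x powr p \<partial>M)" and "B = (\<integral>x. s j x powr p \<partial>M)"
        and "D = (\<integral>x. ((s i x + s j x) / 2) powr p \<partial>M)"
      have AB: "A \<le> I + e2" "B \<le> I + e2" "I - e2 \<le> D" using N N' ij by (auto simp: A_def B_def D_def)
      have "(\<integral>x. \<bar>s i x - s j x\<bar> powr p \<partial>M) \<le> (\<integral>x. e1 * (s i x powr p + s j x powr p)
          + C * ((s i x powr p + s j x powr p) / 2 - ((s i x + s j x) / 2) powr p) \<partial>M)"
        using Lp_powr_integrable[OF Lp_diff[OF p0 s[of i] s[of j]]] int int2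
        by (intro integral_mono C(2) s0) auto
      also have "\<dots> = e1 * (A + B) + C * ((A + B) / 2 - D)"
        using int int2 by (simp add: A_def B_def D_def)
      also have "\<dots> \<le> e1 * (2 * (I + 1)) + C * (2 * e2)"
      proof (intro add_mono mult_left_mono)
        show "A + B \<le> 2 * (I + 1)" using AB e2 by simp
        show "(A + B) / 2 - D \<le> 2 * e2" using AB by argo
      qed (use e1 C in auto)
      also have "e1 * (2 * (I + 1)) = e / 2" using I0 by (simp add: e1_def field_simps)
      also have "C * (2 * e2) \<le> e / 2"
      proof -
        have "C * e2 \<le> (C + 1) * (e / (4 * (C + 1)))"
          using C e e2 by (intro mult_mono) (auto simp: e2_def)
        also have "\<dots> = e / 4" using C by (simp add: field_simps)
        finally show ?thesis by simp
      qed
      finally show ?thesis by simp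
    qed
    then show ?thesis by blast
  qed
  obtain G where G: "G \<in> Lp p M" "(\<lambda>n. Lp_norm p M (\<lambda>x. s n x - G x)) \<longlonglongrightarrow> 0"
    and "\<exists>r. strict_mono r \<and> (AE x in M. (\<lambda>i. s (r i) x) \<longlonglongrightarrow> G x)"
    by (rule Lp_complete[OF p s cauchy])
  then obtain r where r: "AE x in M. (\<lambda>i. s (r i) x) \<longlonglongrightarrow> G x" by blast
  have "AE x in M. 0 \<le> G x"
    using r
  proof eventually_elim
    fix x assume "(\<lambda>i. s (r i) x) \<longlonglongrightarrow> G x"
    then show "0 \<le> G x" by (rule LIMSEQ_le_const) (simp add: s0)
  qed
  then show ?thesis using that G by (auto simp: Lp_nonneg_def)
qed

lemma Lp_tendsto_integral:
  assumes p: "1 < p" and s: "Lp_tendsto p M s f" and g: "g \<in> Lp (conj_exp p) M"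
  shows "(\<lambda>n. \<integral>x. s n x * g x \<partial>M) \<longlonglongrightarrow> (\<integral>x. f x * g x \<partial>M)"
proof -
  have sn: "s n \<in> Lp p M" and f: "f \<in> Lp p M" and lim: "(\<lambda>n. Lp_norm p M (\<lambda>x. s n x - f x)) \<longlonglongrightarrow> 0" for n
    using s by (auto simp: Lp_tendsto_def)
  have p0: "p > 0" using p by simp
  have "(\<lambda>n. (\<integral>x. s n x * g x \<partial>M) - (\<integral>x. f x * g x \<partial>M)) \<longlonglongrightarrow> 0"
  proof (rule Lim_null_comparison[OF _ tendsto_mult_left_zero[OF lim]])
    show "\<forall>\<^sub>F n in sequentially. norm ((\<integral>x. s n x * g x \<partial>M) - (\<integral>x. f x * g x \<partial>M))
        \<le> Lp_norm p M (\<lambda>x. s n x - f x) * Lp_norm (conj_exp p) M g"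
    proof (rule always_eventually, rule allI)
      fix n
      have "(\<integral>x. s n x * g x \<partial>M) - (\<integral>x. f x * g x \<partial>M) = (\<integral>x. (s n x - f x) * g x \<partial>M)"
        using Lp_holder(1)[OF p sn g] Lp_holder(1)[OF p f g] by (simp add: left_diff_distrib)
      then show "norm ((\<integral>x. s n x * g x \<partial>M) - (\<integral>x. f x * g x \<partial>M))
          \<le> Lp_norm p M (\<lambda>x. s n x - f x) * Lp_norm (conj_exp p) M g"
        using Lp_holder_le[OF p Lp_diff[OF p0 sn f] g] by simp
    qed
  qed
  then show ?thesis by (simp add: LIM_zero_iff)
qed

lemma Lp_functional_integral:
  assumes p: "1 < p" and g: "g \<in> Lp (conj_exp p) M"
  shows "Lp_functional p M (\<lambda>f. \<integral>x. f x * g x \<partial>M)"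
  unfolding Lp_functional_def
proof (intro conjI ballI allI exI[of _ "Lp_norm (conj_exp p) M g"])
  fix f h \<alpha> \<beta> assume "f \<in> Lp p M" "h \<in> Lp p M"
  then show "(\<integral>x. (\<alpha> * f x + \<beta> * h x) * g x \<partial>M) = \<alpha> * (\<integral>x. f x * g x \<partial>M) + \<beta> * (\<integral>x. h x * g x \<partial>M)"
    using Lp_holder(1)[OF p _ g, of f] Lp_holder(1)[OF p _ g, of h] by (simp add: distrib_right mult.assoc)
next
  fix f assume "f \<in> Lp p M"
  then show "\<bar>\<integral>x. f x * g x \<partial>M\<bar> \<le> Lp_norm (conj_exp p) M g * Lp_norm p M f"
    using Lp_holder_le[OF p _ g, of f] by (simp add: mult.commute)
qed

lemma Lp_tendsto_imp_weak:
  assumes p: "0 < p" and s: "Lp_tendsto p M s f"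
  shows "Lp_weak_tendsto p M s f"
  unfolding Lp_weak_tendsto_def
proof (intro conjI allI impI)
  show sn: "s n \<in> Lp p M" for n using s by (simp add: Lp_tendsto_def)
  show f: "f \<in> Lp p M" using s by (simp add: Lp_tendsto_def)
  fix \<phi> assume \<phi>: "Lp_functional p M \<phi>"
  then obtain C where C: "\<And>f. f \<in> Lp p M \<Longrightarrow> \<bar>\<phi> f\<bar> \<le> C * Lp_norm p M f"
    unfolding Lp_functional_def by blast
  have "\<phi> (\<lambda>x. s n x - f x) = \<phi> (s n) - \<phi> f" for n
  proof -
    have "\<phi> (\<lambda>x. 1 * s n x + (-1) * f x) = 1 * \<phi> (s n) + (-1) * \<phi> f"
      using \<phi> sn f unfolding Lp_functional_def by blast
    then show ?thesis by simp
  qed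
  then have A: "norm (\<phi> (s n) - \<phi> f) \<le> C * Lp_norm p M (\<lambda>x. s n x - f x)" for n
    using C[OF Lp_diff[OF p sn f], of n] by simp
  have B: "(\<lambda>n. C * Lp_norm p M (\<lambda>x. s n x - f x)) \<longlonglongrightarrow> 0"
    using s by (intro tendsto_mult_right_zero) (simp add: Lp_tendsto_def)
  have "(\<lambda>n. \<phi> (s n) - \<phi> f) \<longlonglongrightarrow> 0"
    by (rule Lim_null_comparison[OF always_eventually B]) (use A in blast)
  then show "(\<lambda>n. \<phi> (s n)) \<longlonglongrightarrow> \<phi> f" by (simp add: LIM_zero_iff)
qed

end

section \<open>Densities of functionals on bounded functions\<close>

text \<open>Boundedness is required everywhere rather than almost everywhere, so that these
  functions can multiply jets pointwise.\<close>

definition bdd_meas :: "'a measure \<Rightarrow> ('a \<Rightarrow> real) set" where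
  "bdd_meas M = {f \<in> borel_measurable M. bounded (range f)}"

lemma bdd_measI: "f \<in> borel_measurable M \<Longrightarrow> (\<And>x. \<bar>f x\<bar> \<le> C) \<Longrightarrow> f \<in> bdd_meas M"
  by (auto simp: bdd_meas_def intro!: boundedI[where B = C])

lemma bdd_measE:
  assumes "f \<in> bdd_meas M"
  obtains C where "C > 0" "\<And>x. \<bar>f x\<bar> \<le> C"
  using assms unfolding bdd_meas_def by (auto elim!: bounded_pos[THEN iffD1, THEN exE])

lemma bdd_meas_measurable[measurable_dest]: "f \<in> bdd_meas M \<Longrightarrow> f \<in> borel_measurable M"
  by (simp add: bdd_meas_def)

lemma bdd_meas_const: "(\<lambda>x. c) \<in> bdd_meas M"
  by (rule bdd_measI[where C = "\<bar>c\<bar>"]) auto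

lemma bdd_meas_indicator: "A \<in> sets M \<Longrightarrow> indicator A \<in> bdd_meas M"
  by (rule bdd_measI[where C = 1]) (auto simp: indicator_def)

lemma bdd_meas_mult:
  assumes "f \<in> bdd_meas M" "g \<in> bdd_meas M"
  shows "(\<lambda>x. f x * g x) \<in> bdd_meas M"
proof -
  obtain C D where C: "C > 0" "\<And>x. \<bar>f x\<bar> \<le> C" and D: "D > 0" "\<And>x. \<bar>g x\<bar> \<le> D"
    using assms by (metis bdd_measE)
  show ?thesis
    by (rule bdd_measI[where C = "C * D"]) (use assms C D in \<open>auto simp: abs_mult bdd_meas_def intro!: mult_mono\<close>)
qed

lemma bdd_meas_add:
  assumes "f \<in> bdd_meas M" "g \<in> bdd_meas M"
  shows "(\<lambda>x. f x + g x) \<in> bdd_meas M"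
proof -
  obtain C D where C: "C > 0" "\<And>x. \<bar>f x\<bar> \<le> C" and D: "D > 0" "\<And>x. \<bar>g x\<bar> \<le> D"
    using assms by (metis bdd_measE)
  show ?thesis
    by (rule bdd_measI[where C = "C + D"])
      (use assms C D in \<open>auto simp: bdd_meas_def intro!: order_trans[OF abs_triangle_ineq] add_mono\<close>)
qed

lemma bdd_meas_scale: "f \<in> bdd_meas M \<Longrightarrow> (\<lambda>x. c * f x) \<in> bdd_meas M"
  by (intro bdd_meas_mult bdd_meas_const)

lemma bdd_meas_lincomb:
  "f \<in> bdd_meas M \<Longrightarrow> g \<in> bdd_meas M \<Longrightarrow> (\<lambda>x. \<alpha> * f x + \<beta> * g x) \<in> bdd_meas M"
  by (intro bdd_meas_add bdd_meas_scale)

lemma bdd_meas_diff: "f \<in> bdd_meas M \<Longrightarrow> g \<in> bdd_meas M \<Longrightarrow> (\<lambda>x. f x - g x) \<in> bdd_meas M"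
  using bdd_meas_lincomb[of f M g 1 "-1"] by simp

lemma bdd_meas_abs: "f \<in> bdd_meas M \<Longrightarrow> (\<lambda>x. \<bar>f x\<bar>) \<in> bdd_meas M"
  by (auto simp: bdd_meas_def bounded_iff)

lemma bdd_meas_integrable:
  assumes "f \<in> bdd_meas M" "integrable M g"
  shows "integrable M (\<lambda>x. f x * g x)"
proof -
  obtain C where C: "C > 0" "\<And>x. \<bar>f x\<bar> \<le> C" using assms by (metis bdd_measE)
  show ?thesis
    by (rule Bochner_Integration.integrable_bound[where f = "\<lambda>x. C * g x"])
      (use assms C in \<open>auto simp: abs_mult bdd_meas_def intro!: AE_I2 mult_right_mono borel_measurable_times\<close>)
qed

lemma (in finite_measure) bdd_meas_Lp: "f \<in> bdd_meas M \<Longrightarrow> 0 < p \<Longrightarrow> f \<in> Lp p M"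
  by (metis Lp_bounded bdd_measE bdd_meas_measurable)

lemma AE_le_zero_of_integral:
  fixes u :: "'a \<Rightarrow> real"
  assumes u: "integrable M u" and le: "\<And>A. A \<in> sets M \<Longrightarrow> (\<integral>x. indicator A x * u x \<partial>M) \<le> 0"
  shows "AE x in M. u x \<le> 0"
proof -
  define A where "A = {x \<in> space M. 0 < u x}"
  have [measurable]: "u \<in> borel_measurable M" using u by auto
  have A: "A \<in> sets M" by (simp add: A_def)
  have int: "integrable M (\<lambda>x. indicator A x * u x)"
    by (rule bdd_meas_integrable[OF bdd_meas_indicator[OF A] u])
  have nn: "AE x in M. 0 \<le> indicator A x * u x" by (auto simp: A_def indicator_def)
  have "(\<integral>x. indicator A x * u x \<partial>M) = 0"
    using le[OF A] integral_nonneg_AE[OF nn] by simp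
  then have "AE x in M. indicator A x * u x = 0"
    using integral_nonneg_eq_0_iff_AE[OF int nn] by simp
  then show ?thesis using AE_space by eventually_elim (auto simp: A_def indicator_def split: if_splits)
qed

text \<open>The layer sum \<open>e \<Sum>\<^sub>j indicator {f \<ge> e (j + 1)}\<close> equals \<open>e \<lfloor>f / e\<rfloor>\<close>.\<close>

lemma bdd_meas_layer_sum:
  fixes f :: "'a \<Rightarrow> real" and e :: real
  assumes U: "space M = UNIV" and f: "f \<in> bdd_meas M" "\<And>x. 0 \<le> f x" and e: "0 < e"
  obtains J A where "\<And>j::nat. A j \<in> sets M" "\<And>x. (\<Sum>j<J. e * indicator (A j) x) \<le> f x"
    "\<And>x. f x \<le> (\<Sum>j<J. e * indicator (A j) x) + e"
proof -
  obtain C where C: "C > 0" "\<And>x. \<bar>f x\<bar> \<le> C" using f by (metis bdd_measE)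
  define J where "J = nat \<lceil>C / e\<rceil>"
  define A where "A = (\<lambda>j::nat. {x. e * real (Suc j) \<le> f x})"
  have A: "A j \<in> sets M" for j
  proof -
    have "{x \<in> space M. e * real (Suc j) \<le> f x} \<in> sets M" using f(1) by measurable
    then show ?thesis by (simp add: A_def U)
  qed
  have sf: "(\<Sum>j<J. e * indicator (A j) x) \<le> f x" "f x \<le> (\<Sum>j<J. e * indicator (A j) x) + e" for x
  proof -
    define n where "n = nat \<lfloor>f x / e\<rfloor>"
    have fe: "0 \<le> f x / e" using f(2) e by simp
    have iff: "e * real j \<le> f x \<longleftrightarrow> j \<le> n" for j
    proof -
      have "e * real j \<le> f x \<longleftrightarrow> real j \<le> f x / e" using e by (simp add: field_simps)
      also have "\<dots> \<longleftrightarrow> j \<le> n" using fe by (simp add: n_def le_nat_floor le_nat_iff le_floor_iff)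
      finally show ?thesis .
    qed
    have "f x / e \<le> C / e" using C(2)[of x] e by (intro divide_right_mono) auto
    then have nJ: "n \<le> J" unfolding n_def J_def
      by (meson floor_le_ceiling floor_mono nat_mono order_trans)
    \<comment> \<open>Layer \<open>j\<close> carries the threshold \<open>e * (j + 1)\<close>, so it
      is active at \<open>x\<close> exactly for \<open>j < n\<close>; by \<open>n \<le> J\<close>
      the sum up to \<open>J\<close> loses no active layer.\<close>
    have "(\<Sum>j<J. e * indicator (A j) x) = (\<Sum>j<J. if j < n then e else 0)"
      by (intro sum.cong) (auto simp: A_def iff indicator_def Suc_le_eq simp del: of_nat_Suc)
    also have "\<dots> = (\<Sum>j<n. e)"
      using nJ by (intro sum.mono_neutral_cong_right) auto
    finally have sn: "(\<Sum>j<J. e * indicator (A j) x) = e * n" by (simp add: mult.commute)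
    have "real n \<le> f x / e" "f x / e \<le> real n + 1" unfolding n_def using fe by linarith+
    then show "(\<Sum>j<J. e * indicator (A j) x) \<le> f x" "f x \<le> (\<Sum>j<J. e * indicator (A j) x) + e"
      using e unfolding sn by (auto simp: field_simps)
  qed
  show ?thesis by (rule that[OF A sf])
qed

context finite_measure begin

text \<open>On indicators \<Lambda> is a finite measure by continuity at the empty set, absolutely
  continuous by \<open>null\<close>, so Radon-Nikodym provides \<beta>; layer sums carry the formula
  to bounded functions. Additivity is asked only on nonnegative functions, since the supremum
  functional to which this is applied is additive only there.\<close>

lemma positive_functional_density:
  assumes U: "space M = UNIV"
    and add: "\<And>f g. f \<in> bdd_meas M \<Longrightarrow> g \<in> bdd_meas M \<Longrightarrow> (\<And>x. 0 \<le> f x) \<Longrightarrow> (\<And>x. 0 \<le> g x) \<Longrightarrow>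
        \<Lambda> (\<lambda>x. f x + g x) = \<Lambda> f + \<Lambda> g"
    and scale: "\<And>f c. f \<in> bdd_meas M \<Longrightarrow> (\<And>x. 0 \<le> f x) \<Longrightarrow> 0 < c \<Longrightarrow> \<Lambda> (\<lambda>x. c * f x) = c * \<Lambda> f"
    and nonneg: "\<And>f. f \<in> bdd_meas M \<Longrightarrow> (\<And>x. 0 \<le> f x) \<Longrightarrow> 0 \<le> \<Lambda> f"
    and cont: "\<And>A. range A \<subseteq> sets M \<Longrightarrow> decseq A \<Longrightarrow> (\<Inter>i. A i) = {} \<Longrightarrow>
        (\<lambda>i::nat. \<Lambda> (indicator (A i))) \<longlonglongrightarrow> 0"
    and null: "\<And>A. A \<in> null_sets M \<Longrightarrow> \<Lambda> (indicator A) = 0"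
  obtains \<beta> where "integrable M \<beta>" "\<And>x. 0 \<le> \<beta> x"
    "\<And>f. f \<in> bdd_meas M \<Longrightarrow> (\<And>x. 0 \<le> f x) \<Longrightarrow> \<Lambda> f = (\<integral>x. f x * \<beta> x \<partial>M)"
proof -
  have zero: "\<Lambda> (\<lambda>x. 0) = 0"
    using scale[OF bdd_meas_const[of 0], of 2] by simp
  define \<Psi> where "\<Psi> = (\<lambda>A. \<Lambda> (indicator A))"
  have \<Psi>0: "0 \<le> \<Psi> A" if "A \<in> sets M" for A
    unfolding \<Psi>_def using that by (intro nonneg bdd_meas_indicator) auto
  have \<Psi>add: "\<Psi> (A \<union> B) = \<Psi> A + \<Psi> B" if "A \<in> sets M" "B \<in> sets M" "A \<inter> B = {}" for A B
  proof -
    have "(indicator (A \<union> B) :: 'a \<Rightarrow> real) = (\<lambda>x. indicator A x + indicator B x)"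
      using that by (auto simp: indicator_def fun_eq_iff)
    then show ?thesis unfolding \<Psi>_def using that by (simp add: add bdd_meas_indicator)
  qed
  define N where "N = measure_of (space M) (sets M) (\<lambda>A. ennreal (\<Psi> A))"
  have ie: "indicator {} = (\<lambda>x::'a. 0::real)" by (simp add: fun_eq_iff)
  have "positive (sets M) (\<lambda>A. ennreal (\<Psi> A))"
    using zero by (simp add: positive_def \<Psi>_def ie)
  moreover have "countably_additive (sets M) (\<lambda>A. ennreal (\<Psi> A))"
  proof (rule sets.empty_continuous_imp_countably_additive)
    show "positive (sets M) (\<lambda>A. ennreal (\<Psi> A))" by fact
    show "additive (sets M) (\<lambda>A. ennreal (\<Psi> A))"
      using \<Psi>add \<Psi>0 by (simp add: additive_def)
    show "\<forall>A\<in>sets M. ennreal (\<Psi> A) \<noteq> \<infinity>" by simp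
    show "(\<lambda>i. ennreal (\<Psi> (A i))) \<longlonglongrightarrow> 0" if "range A \<subseteq> sets M" "decseq A" "(\<Inter>i. A i) = {}" for A
      using tendsto_ennrealI[OF cont[OF that]] by (simp add: \<Psi>_def)
  qed
  ultimately have emN: "emeasure N A = ennreal (\<Psi> A)" if "A \<in> sets M" for A
    using that unfolding N_def by (intro emeasure_measure_of_sigma sets.sigma_algebra_axioms)
  have setsN: "sets N = sets M" by (simp add: N_def sets.sets_measure_of_eq)
  have "absolutely_continuous M N"
    unfolding absolutely_continuous_def using null setsN
    by (auto simp: null_sets_def emN \<Psi>_def)
  then obtain g where g: "g \<in> borel_measurable M" "density M g = N"
    using Radon_Nikodym[OF _ setsN] by blast
  have [measurable]: "g \<in> borel_measurable M" by (rule g)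
  have emg: "(\<integral>\<^sup>+x. g x * indicator A x \<partial>M) = ennreal (\<Psi> A)" if "A \<in> sets M" for A
    using emeasure_density[OF g(1) that] emN[OF that] g(2) by simp
  have "(\<integral>\<^sup>+x. g x \<partial>M) < \<infinity>" using emg[OF sets.top] by (simp add: U)
  then have gfin: "AE x in M. g x \<noteq> \<infinity>"
    by (intro nn_integral_PInf_AE) auto
  define \<beta> where "\<beta> = (\<lambda>x. enn2real (g x))"
  have [measurable]: "\<beta> \<in> borel_measurable M" unfolding \<beta>_def by simp
  have \<beta>0: "0 \<le> \<beta> x" for x by (simp add: \<beta>_def)
  have \<beta>g: "AE x in M. ennreal (\<beta> x) = g x"
    using gfin by eventually_elim (simp add: \<beta>_def less_top)
  have "(\<integral>\<^sup>+x. ennreal (\<beta> x) \<partial>M) = (\<integral>\<^sup>+x. g x \<partial>M)"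
    by (rule nn_integral_cong_AE[OF \<beta>g])
  then have int: "integrable M \<beta>"
    using \<open>(\<integral>\<^sup>+x. g x \<partial>M) < \<infinity>\<close> \<beta>0 by (simp add: integrable_iff_bounded)
  have ind: "\<Lambda> (indicator A) = (\<integral>x. indicator A x * \<beta> x \<partial>M)" if A: "A \<in> sets M" for A
  proof -
    have i: "integrable M (\<lambda>x. indicator A x * \<beta> x)"
      by (rule bdd_meas_integrable[OF bdd_meas_indicator[OF A] int])
    have "ennreal (\<integral>x. indicator A x * \<beta> x \<partial>M) = (\<integral>\<^sup>+x. ennreal (indicator A x * \<beta> x) \<partial>M)"
      using \<beta>0 by (intro nn_integral_eq_integral[symmetric] i) auto
    also have "\<dots> = (\<integral>\<^sup>+x. g x * indicator A x \<partial>M)"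
      by (rule nn_integral_cong_AE, use \<beta>g in eventually_elim) (auto simp: indicator_def)
    also have "\<dots> = ennreal (\<Lambda> (indicator A))" using emg[OF A] by (simp add: \<Psi>_def)
    finally show ?thesis using \<Psi>0[OF A] \<beta>0 by (simp add: \<Psi>_def ennreal_inj integral_nonneg_AE)
  qed
  have mono: "\<Lambda> f \<le> \<Lambda> g" if "f \<in> bdd_meas M" "g \<in> bdd_meas M" "\<And>x. 0 \<le> f x" "\<And>x. f x \<le> g x" for f g
    using add[OF that(1) bdd_meas_diff[OF that(2,1)]] nonneg[OF bdd_meas_diff[OF that(2,1)]] that by simp
  have eq: "\<Lambda> f = (\<integral>x. f x * \<beta> x \<partial>M)" if f: "f \<in> bdd_meas M" "\<And>x. 0 \<le> f x" for f
  proof -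
    \<comment> \<open>Both sides agree on the layer sum \<open>s J\<close>. The remainder lies
      between 0 and \<open>e\<close>, so by monotonicity each side errs by at most \<open>e\<close>
      times its value at the constant 1.\<close>
    have "\<bar>\<Lambda> f - (\<integral>x. f x * \<beta> x \<partial>M)\<bar> \<le> (\<Lambda> (\<lambda>x. 1) + (\<integral>x. \<beta> x \<partial>M)) * e" if e: "e > 0" for e
    proof -
      obtain J A where A: "\<And>j::nat. A j \<in> sets M" and lower: "\<And>x. (\<Sum>j<J. e * indicator (A j) x) \<le> f x"
        and upper: "\<And>x. f x \<le> (\<Sum>j<J. e * indicator (A j) x) + e"
        by (rule bdd_meas_layer_sum[OF U f e]) blast
      define s where "s = (\<lambda>K x. \<Sum>j<K. e * indicator (A j) x :: real)"
      have s00: "s 0 = (\<lambda>x. 0)" by (simp add: s_def)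
      have sb: "s K \<in> bdd_meas M" and s0: "0 \<le> s K x" and s\<Lambda>: "\<Lambda> (s K) = (\<integral>x. s K x * \<beta> x \<partial>M)" for K x
      proof (induction K)
        case 0
        show "s 0 \<in> bdd_meas M" "\<Lambda> (s 0) = (\<integral>x. s 0 x * \<beta> x \<partial>M)"
          by (simp_all add: s00 zero bdd_meas_const)
        show "0 \<le> s 0 x" by (simp add: s00)
      next
        case (Suc K)
        have sS: "s (Suc K) = (\<lambda>x. s K x + e * indicator (A K) x)"
          by (simp only: s_def sum.lessThan_Suc)
        have s0: "0 \<le> s K x" for x using e by (auto simp: s_def intro!: sum_nonneg)
        have iA: "indicator (A K) \<in> bdd_meas M" by (rule bdd_meas_indicator[OF A])
        note b = bdd_meas_scale[OF iA, of e]
        show "s (Suc K) \<in> bdd_meas M" unfolding sS by (rule bdd_meas_add[OF Suc(1) b])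
        show "0 \<le> s (Suc K) x" using e s0 by (simp add: sS)
        have "\<Lambda> (s (Suc K)) = \<Lambda> (s K) + \<Lambda> (\<lambda>x. e * indicator (A K) x)"
          unfolding sS by (rule add) (use Suc b s0 e in auto)
        also have "\<Lambda> (\<lambda>x. e * indicator (A K) x) = e * \<Lambda> (indicator (A K))"
          by (rule scale[OF iA _ e]) auto
        also have "\<Lambda> (s K) + e * \<Lambda> (indicator (A K))
            = (\<integral>x. s K x * \<beta> x \<partial>M) + e * (\<integral>x. indicator (A K) x * \<beta> x \<partial>M)"
          using Suc(3) ind[OF A] by simp
        also have "\<dots> = (\<integral>x. s (Suc K) x * \<beta> x \<partial>M)"
          using bdd_meas_integrable[OF Suc(1) int] bdd_meas_integrable[OF iA int]
          by (simp add: sS distrib_right mult.assoc)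
        finally show "\<Lambda> (s (Suc K)) = (\<integral>x. s (Suc K) x * \<beta> x \<partial>M)" .
      qed
      have sf: "s J x \<le> f x" "f x \<le> s J x + e" for x
        using lower[of x] upper[of x] by (auto simp: s_def)
      have d: "(\<lambda>x. f x - s J x) \<in> bdd_meas M" by (rule bdd_meas_diff[OF f(1) sb])
      have d0: "0 \<le> f x - s J x" "f x - s J x \<le> e" for x using sf[of x] by auto
      have "\<Lambda> (\<lambda>x. s J x + (f x - s J x)) = \<Lambda> (s J) + \<Lambda> (\<lambda>x. f x - s J x)"
        by (rule add[OF sb d]) (use s0 d0 in auto)
      then have 1: "\<Lambda> f = (\<integral>x. s J x * \<beta> x \<partial>M) + \<Lambda> (\<lambda>x. f x - s J x)" using s\<Lambda> by simp
      have "(\<integral>x. (s J x + (f x - s J x)) * \<beta> x \<partial>M) = (\<integral>x. s J x * \<beta> x \<partial>M) + (\<integral>x. (f x - s J x) * \<beta> x \<partial>M)"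
        unfolding distrib_right
        by (rule Bochner_Integration.integral_add[OF bdd_meas_integrable[OF sb int] bdd_meas_integrable[OF d int]])
      then have 2: "(\<integral>x. f x * \<beta> x \<partial>M) = (\<integral>x. s J x * \<beta> x \<partial>M) + (\<integral>x. (f x - s J x) * \<beta> x \<partial>M)" by simp
      have 3: "0 \<le> \<Lambda> (\<lambda>x. f x - s J x)" by (rule nonneg[OF d d0(1)])
      have "\<Lambda> (\<lambda>x. f x - s J x) \<le> \<Lambda> (\<lambda>x. e * 1)"
        by (rule mono[OF d bdd_meas_const]) (use d0 in auto)
      also have "\<dots> = e * \<Lambda> (\<lambda>x. 1)" using scale[OF bdd_meas_const[of 1], of e] e by simp
      finally have 4: "\<Lambda> (\<lambda>x. f x - s J x) \<le> e * \<Lambda> (\<lambda>x. 1)" .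
      have 5: "0 \<le> (\<integral>x. (f x - s J x) * \<beta> x \<partial>M)" using d0 \<beta>0 by (intro integral_nonneg_AE) auto
      have "(\<integral>x. (f x - s J x) * \<beta> x \<partial>M) \<le> (\<integral>x. e * \<beta> x \<partial>M)"
        using d0 \<beta>0 bdd_meas_integrable[OF d int] int by (intro integral_mono mult_right_mono) auto
      then have 6: "(\<integral>x. (f x - s J x) * \<beta> x \<partial>M) \<le> e * (\<integral>x. \<beta> x \<partial>M)" by simp
      have 7: "0 \<le> e * \<Lambda> (\<lambda>x. 1)" using nonneg[OF bdd_meas_const[of 1]] e by simp
      have 8: "0 \<le> e * (\<integral>x. \<beta> x \<partial>M)" using \<beta>0 e by (simp add: integral_nonneg_AE)
      have "(\<Lambda> (\<lambda>x. 1) + (\<integral>x. \<beta> x \<partial>M)) * e = e * \<Lambda> (\<lambda>x. 1) + e * (\<integral>x. \<beta> x \<partial>M)"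
        by (simp add: algebra_simps)
      then show ?thesis using 1 2 3 4 5 6 7 8 by linarith
    qed
    note bound = this
    define c where "c = \<Lambda> (\<lambda>x. 1) + (\<integral>x. \<beta> x \<partial>M)"
    have c: "c \<ge> 0" using nonneg[OF bdd_meas_const[of 1]] \<beta>0 by (simp add: c_def integral_nonneg_AE)
    have "\<bar>\<Lambda> f - (\<integral>x. f x * \<beta> x \<partial>M)\<bar> \<le> 0"
    proof (rule field_le_epsilon)
      fix e :: real assume e: "e > 0"
      have "\<bar>\<Lambda> f - (\<integral>x. f x * \<beta> x \<partial>M)\<bar> \<le> c * (e / (c + 1))"
        using bound[of "e / (c + 1)"] e c by (simp add: c_def)
      also have "\<dots> \<le> e" using c e by (simp add: field_simps)
      finally show "\<bar>\<Lambda> f - (\<integral>x. f x * \<beta> x \<partial>M)\<bar> \<le> 0 + e" by simp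
    qed
    then show ?thesis by simp
  qed
  show ?thesis by (rule that[OF int \<beta>0 eq])
qed

text \<open>Adding integration against \<rho> makes \<Lambda> positive, with values at most twice
  the \<rho>-integral; this also supplies continuity at the empty set and vanishing on null sets.
  Subtracting \<rho> from the density gives \<open>l\<close>, and testing with indicators gives the
  pointwise bound.\<close>

lemma dominated_functional_density:
  assumes U: "space M = UNIV"
    and lin: "\<And>f g \<alpha> \<beta>. f \<in> bdd_meas M \<Longrightarrow> g \<in> bdd_meas M \<Longrightarrow>
        \<Lambda> (\<lambda>x. \<alpha> * f x + \<beta> * g x) = \<alpha> * \<Lambda> f + \<beta> * \<Lambda> g"
    and \<rho>: "integrable M \<rho>" and dom: "\<And>f. f \<in> bdd_meas M \<Longrightarrow> \<bar>\<Lambda> f\<bar> \<le> (\<integral>x. \<bar>f x\<bar> * \<rho> x \<partial>M)"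
  obtains l where "integrable M l" "AE x in M. \<bar>l x\<bar> \<le> \<rho> x"
    "\<And>f. f \<in> bdd_meas M \<Longrightarrow> \<Lambda> f = (\<integral>x. f x * l x \<partial>M)"
proof -
  define \<Lambda>' where "\<Lambda>' = (\<lambda>f. \<Lambda> f + (\<integral>x. f x * \<rho> x \<partial>M))"
  note I = bdd_meas_integrable[OF _ \<rho>]
  have le: "\<Lambda>' f \<le> 2 * (\<integral>x. f x * \<rho> x \<partial>M)" "0 \<le> \<Lambda>' f" if "f \<in> bdd_meas M" "\<And>x. 0 \<le> f x" for f
    using dom[OF that(1)] that(2) by (auto simp: \<Lambda>'_def)
  obtain l where l: "integrable M l"
    "\<And>f. f \<in> bdd_meas M \<Longrightarrow> (\<And>x. 0 \<le> f x) \<Longrightarrow> \<Lambda>' f = (\<integral>x. f x * l x \<partial>M)"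
  proof (rule positive_functional_density[OF U, of \<Lambda>'])
    show "\<Lambda>' (\<lambda>x. f x + g x) = \<Lambda>' f + \<Lambda>' g" if "f \<in> bdd_meas M" "g \<in> bdd_meas M" for f g
      using lin[OF that, of 1 1] I[OF that(1)] I[OF that(2)] by (simp add: \<Lambda>'_def distrib_right)
    show "\<Lambda>' (\<lambda>x. c * f x) = c * \<Lambda>' f" if "f \<in> bdd_meas M" for f c
      using lin[OF that that, of c 0] I[OF that] by (simp add: \<Lambda>'_def distrib_left mult.assoc)
    show "0 \<le> \<Lambda>' f" if "f \<in> bdd_meas M" "\<And>x. 0 \<le> f x" for f using le(2)[OF that] .
    show "(\<lambda>i. \<Lambda>' (indicator (A i))) \<longlonglongrightarrow> 0"
      if A: "range A \<subseteq> sets M" "decseq A" "(\<Inter>i. A i) = {}" for A :: "nat \<Rightarrow> 'a set"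
    proof (rule tendsto_sandwich)
      have Ai: "indicator (A i) \<in> bdd_meas M" for i using A by (intro bdd_meas_indicator) auto
      show "\<forall>\<^sub>F i in sequentially. 0 \<le> \<Lambda>' (indicator (A i))" using le(2)[OF Ai] by simp
      show "\<forall>\<^sub>F i in sequentially. \<Lambda>' (indicator (A i)) \<le> 2 * (\<integral>x. indicator (A i) x * \<rho> x \<partial>M)"
        using le(1)[OF Ai] by simp
      have "(\<lambda>i. \<integral>x. indicator (A i) x * \<rho> x \<partial>M) \<longlonglongrightarrow> (\<integral>x. 0 \<partial>M)"
      proof (rule integral_dominated_convergence[where w = "\<lambda>x. \<bar>\<rho> x\<bar>"])
        show "AE x in M. (\<lambda>i. indicator (A i) x * \<rho> x) \<longlonglongrightarrow> 0"
        proof (rule AE_I2)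
          fix x
          obtain i where "x \<notin> A i" using A(3) by blast
          then have "\<forall>\<^sub>F j in sequentially. indicator (A j) x * \<rho> x = 0"
            using A(2) by (intro eventually_sequentiallyI[of i]) (auto simp: decseq_def indicator_def)
          then show "(\<lambda>i. indicator (A i) x * \<rho> x) \<longlonglongrightarrow> 0" by (simp add: tendsto_eventually)
        qed
        show "(\<lambda>x. indicator (A i) x * \<rho> x) \<in> borel_measurable M" for i using I[OF Ai[of i]] by auto
      qed (use \<rho> in \<open>auto simp: indicator_def\<close>)
      then show "(\<lambda>i. 2 * (\<integral>x. indicator (A i) x * \<rho> x \<partial>M)) \<longlonglongrightarrow> 0"
        by (intro tendsto_mult_right_zero) simp
    qed simp
    show "\<Lambda>' (indicator A) = 0" if "A \<in> null_sets M" for A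
    proof -
      have A: "indicator A \<in> bdd_meas M" using that by (intro bdd_meas_indicator) auto
      have "AE x in M. indicator A x * \<rho> x = 0"
        using AE_not_in[OF that] by eventually_elim (auto simp: indicator_def)
      then have "(\<integral>x. indicator A x * \<rho> x \<partial>M) = 0"
        by (rule integral_eq_zero_AE)
      then show ?thesis using le[OF A] by simp
    qed
  qed (use that in auto)
  define k where "k = (\<lambda>x. l x - \<rho> x)"
  have k: "integrable M k" using l(1) \<rho> by (simp add: k_def)
  have pos: "\<Lambda> f = (\<integral>x. f x * k x \<partial>M)" if "f \<in> bdd_meas M" "\<And>x. 0 \<le> f x" for f
    using l(2)[OF that] I[OF that(1)] bdd_meas_integrable[OF that(1) l(1)]
    by (simp add: \<Lambda>'_def k_def right_diff_distrib)
  have eq: "\<Lambda> f = (\<integral>x. f x * k x \<partial>M)" if f: "f \<in> bdd_meas M" for f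
  proof -
    have fa: "(\<lambda>x. \<bar>f x\<bar>) \<in> bdd_meas M" by (rule bdd_meas_abs[OF f])
    have fb: "(\<lambda>x. \<bar>f x\<bar> - f x) \<in> bdd_meas M" by (rule bdd_meas_diff[OF fa f])
    have "\<Lambda> (\<lambda>x. 1 * \<bar>f x\<bar> + (-1) * (\<bar>f x\<bar> - f x)) = 1 * \<Lambda> (\<lambda>x. \<bar>f x\<bar>) + (-1) * \<Lambda> (\<lambda>x. \<bar>f x\<bar> - f x)"
      by (rule lin[OF fa fb])
    also have "\<dots> = (\<integral>x. \<bar>f x\<bar> * k x \<partial>M) - (\<integral>x. (\<bar>f x\<bar> - f x) * k x \<partial>M)"
      using pos[OF fa] pos[OF fb] by simp
    also have "\<dots> = (\<integral>x. \<bar>f x\<bar> * k x - (\<bar>f x\<bar> - f x) * k x \<partial>M)"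
      by (rule Bochner_Integration.integral_diff[symmetric])
         (rule bdd_meas_integrable[OF fa k] bdd_meas_integrable[OF fb k])+
    finally show ?thesis by (simp add: left_diff_distrib)
  qed
  have ab: "\<bar>\<integral>x. indicator A x * k x \<partial>M\<bar> \<le> (\<integral>x. indicator A x * \<rho> x \<partial>M)" if "A \<in> sets M" for A
    using dom[OF bdd_meas_indicator[OF that]] eq[OF bdd_meas_indicator[OF that]] by simp
  have "AE x in M. k x - \<rho> x \<le> 0"
  proof (rule AE_le_zero_of_integral)
    show "(\<integral>x. indicator A x * (k x - \<rho> x) \<partial>M) \<le> 0" if "A \<in> sets M" for A
      using ab[OF that] I[OF bdd_meas_indicator[OF that]] bdd_meas_integrable[OF bdd_meas_indicator[OF that] k]
      by (simp add: right_diff_distrib)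
  qed (use k \<rho> in auto)
  moreover have "AE x in M. - k x - \<rho> x \<le> 0"
  proof (rule AE_le_zero_of_integral)
    show "(\<integral>x. indicator A x * (- k x - \<rho> x) \<partial>M) \<le> 0" if "A \<in> sets M" for A
      using ab[OF that] I[OF bdd_meas_indicator[OF that]] bdd_meas_integrable[OF bdd_meas_indicator[OF that] k]
      by (simp add: right_diff_distrib)
  qed (use k \<rho> in auto)
  ultimately have "AE x in M. \<bar>k x\<bar> \<le> \<rho> x" by eventually_elim auto
  then show ?thesis using that k eq by blast
qed

end

section \<open>Essential infima of lattice-ordered families\<close>

text \<open>A decreasing sequence in \<open>S\<close> whose integrals tend to their infimum
  \<open>I\<close> has the essential infimum as its limit \<open>G\<close>: for \<open>g\<close> in
  \<open>S\<close> the functions \<open>min (g x) (s n x)\<close> stay in \<open>S\<close>, so the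
  integral of \<open>min (g x) (G x)\<close> is at least \<open>I\<close>, which is the integral of
  \<open>G\<close>. The sequence is returned so that closed pointwise inequalities pass to
  \<open>G\<close>.\<close>

lemma is_ess_inf_lattice:
  fixes S :: "('a \<Rightarrow> real) set"
  assumes ne: "S \<noteq> {}" and int: "\<And>g. g \<in> S \<Longrightarrow> integrable M g"
    and nn: "\<And>g. g \<in> S \<Longrightarrow> AE x in M. 0 \<le> g x"
    and min: "\<And>g h. g \<in> S \<Longrightarrow> h \<in> S \<Longrightarrow> (\<lambda>x. min (g x) (h x)) \<in> S"
  obtains G s where "is_ess_inf M S G" "\<And>n::nat. s n \<in> S" "AE x in M. (\<lambda>n. s n x) \<longlonglongrightarrow> G x"
proof -
  define I where "I = (INF g\<in>S. \<integral>x. g x \<partial>M)"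
  have bdd: "bdd_below ((\<lambda>g. \<integral>x. g x \<partial>M) ` S)"
    using nn by (intro bdd_belowI[of _ 0]) (auto intro: integral_nonneg_AE)
  have Ile: "I \<le> (\<integral>x. g x \<partial>M)" if "g \<in> S" for g
    unfolding I_def by (rule cINF_lower[OF bdd that])
  have "\<exists>g\<in>S. (\<integral>x. g x \<partial>M) < I + 1 / real (Suc n)" for n
    using cINF_less_iff[OF ne bdd, of "I + 1 / real (Suc n)"] by (simp add: I_def)
  then obtain t where t: "\<And>n. t n \<in> S" "\<And>n. (\<integral>x. t n x \<partial>M) < I + 1 / real (Suc n)" by metis
  \<comment> \<open>Running minima of the minimizing sequence: they remain in \<open>S\<close>, lie
    below \<open>t n\<close>, and converge pointwise by monotonicity.\<close>
  define s where "s = rec_nat (t 0) (\<lambda>n u x. min (u x) (t (Suc n) x))"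
  have s0: "s 0 = t 0" and sS: "s (Suc n) = (\<lambda>x. min (s n x) (t (Suc n) x))" for n by (simp_all add: s_def)
  have sS': "s n \<in> S" for n by (induction n) (simp_all add: s0 sS t min)
  have st: "s n x \<le> t n x" for n x by (cases n) (simp_all add: s0 sS)
  have dec: "decseq (\<lambda>n. s n x)" for x by (rule decseq_SucI) (simp add: sS)
  have [measurable]: "s n \<in> borel_measurable M" for n using int[OF sS'[of n]] by auto
  have snn: "AE x in M. \<forall>n. 0 \<le> s n x" using nn[OF sS'] by (simp add: AE_all_countable)
  define G where "G = (\<lambda>x. lim (\<lambda>n. s n x))"
  have [measurable]: "G \<in> borel_measurable M" unfolding G_def by measurable
  have lim: "AE x in M. (\<lambda>n. s n x) \<longlonglongrightarrow> G x"
    using snn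
  proof eventually_elim
    case (elim x)
    then obtain L where "(\<lambda>n. s n x) \<longlonglongrightarrow> L" using decseq_convergent[OF dec, of 0] by blast
    then show ?case by (simp add: G_def limI)
  qed
  have bd: "AE x in M. \<bar>s n x\<bar> \<le> s 0 x" for n
    using snn by eventually_elim (use dec in \<open>auto simp: decseq_def\<close>)
  have intG: "integrable M G" and limI: "(\<lambda>n. \<integral>x. s n x \<partial>M) \<longlonglongrightarrow> (\<integral>x. G x \<partial>M)"
    using integrable_dominated_convergence[of G M s "s 0"] integral_dominated_convergence[of G M s "s 0"]
      lim bd int[OF sS'] by auto
  have "(\<lambda>n. \<integral>x. s n x \<partial>M) \<longlonglongrightarrow> I"
  proof (rule tendsto_sandwich[OF _ _ tendsto_const])
    show "\<forall>\<^sub>F n in sequentially. I \<le> (\<integral>x. s n x \<partial>M)" using Ile[OF sS'] by simp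
    have "(\<integral>x. s n x \<partial>M) \<le> I + 1 / real (Suc n)" for n
      using integral_mono[OF int[OF sS'[of n]] int[OF t(1)[of n]] st] t(2)[of n] by simp
    then show "\<forall>\<^sub>F n in sequentially. (\<integral>x. s n x \<partial>M) \<le> I + 1 / real (Suc n)" by simp
    show "(\<lambda>n. I + 1 / real (Suc n)) \<longlonglongrightarrow> I"
      using tendsto_add[OF tendsto_const[of I] LIMSEQ_Suc[OF lim_1_over_n]] by simp
  qed
  then have GI: "(\<integral>x. G x \<partial>M) = I" using limI LIMSEQ_unique by blast
  have lower: "AE x in M. G x \<le> g x" if g: "g \<in> S" for g
  proof -
    have [measurable]: "g \<in> borel_measurable M" using int[OF g] by auto
    have "(\<lambda>n. \<integral>x. min (g x) (s n x) \<partial>M) \<longlonglongrightarrow> (\<integral>x. min (g x) (G x) \<partial>M)"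
    proof (rule integral_dominated_convergence[where w = "\<lambda>x. \<bar>g x\<bar> + s 0 x"])
      show "AE x in M. (\<lambda>n. min (g x) (s n x)) \<longlonglongrightarrow> min (g x) (G x)"
        using lim by eventually_elim (intro tendsto_intros)
      show "AE x in M. norm (min (g x) (s n x)) \<le> \<bar>g x\<bar> + s 0 x" for n
        using bd[of n] by eventually_elim auto
    qed (use int[OF g] int[OF sS'] in auto)
    then have "I \<le> (\<integral>x. min (g x) (G x) \<partial>M)"
      by (rule LIMSEQ_le_const) (use Ile[OF min[OF g sS']] in auto)
    then have le0: "(\<integral>x. G x - min (g x) (G x) \<partial>M) \<le> 0"
      using GI int[OF g] intG by simp
    have nn0: "AE x in M. 0 \<le> G x - min (g x) (G x)" by simp
    have "(\<integral>x. G x - min (g x) (G x) \<partial>M) = 0" using le0 integral_nonneg_AE[OF nn0] by simp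
    then have "AE x in M. G x - min (g x) (G x) = 0"
      using int[OF g] intG by (subst (asm) integral_nonneg_eq_0_iff_AE) auto
    then show ?thesis by eventually_elim (simp add: min_def split: if_splits)
  qed
  have greatest: "AE x in M. G' x \<le> G x" if "\<forall>g\<in>S. AE x in M. G' x \<le> g x" for G'
  proof -
    have "AE x in M. \<forall>n. G' x \<le> s n x" using that sS' by (simp add: AE_all_countable)
    then show ?thesis using lim by eventually_elim (rule LIMSEQ_le_const, auto)
  qed
  show ?thesis
    by (rule that[of G s]) (use lower greatest sS' lim in \<open>auto simp: is_ess_inf_def\<close>)
qed

lemma ess_inf_lattice:
  fixes S :: "('a \<Rightarrow> real) set"
  assumes "S \<noteq> {}" "\<And>g. g \<in> S \<Longrightarrow> integrable M g"
    "\<And>g. g \<in> S \<Longrightarrow> AE x in M. 0 \<le> g x"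
    "\<And>g h. g \<in> S \<Longrightarrow> h \<in> S \<Longrightarrow> (\<lambda>x. min (g x) (h x)) \<in> S"
  obtains s where "is_ess_inf M S (ess_inf M S)" "\<And>n::nat. s n \<in> S" "AE x in M. (\<lambda>n. s n x) \<longlonglongrightarrow> ess_inf M S x"
proof -
  obtain G s where G: "is_ess_inf M S G" and s: "\<And>n::nat. s n \<in> S" "AE x in M. (\<lambda>n. s n x) \<longlonglongrightarrow> G x"
    using is_ess_inf_lattice[OF assms] by blast
  have e: "is_ess_inf M S (ess_inf M S)" unfolding ess_inf_def by (rule someI[of _ G]) (rule G)
  have "AE x in M. G x \<le> ess_inf M S x" "AE x in M. ess_inf M S x \<le> G x"
    using e G by (auto simp: is_ess_inf_def)
  then have "AE x in M. (\<lambda>n. s n x) \<longlonglongrightarrow> ess_inf M S x"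
    using s(2) by eventually_elim simp
  then show ?thesis using that e s by blast
qed

section \<open>Calculus of the asymptotic slope\<close>

text \<open>Real-valued form of \<open>Lip d f A \<le> c\<close>. Pairs at infinite distance impose
  nothing, in accordance with \<open>c / \<infinity> = 0\<close>.\<close>

definition lip_bound :: "('a \<Rightarrow> 'a \<Rightarrow> ennreal) \<Rightarrow> ('a \<Rightarrow> real) \<Rightarrow> real \<Rightarrow> 'a set \<Rightarrow> bool" where
  "lip_bound d f c A \<longleftrightarrow> (\<forall>x\<in>A. \<forall>y\<in>A. d x y \<noteq> \<infinity> \<longrightarrow> \<bar>f x - f y\<bar> \<le> c * enn2real (d x y))"

lemma (in extended_distance) Lip_le_iff:
  assumes c: "0 \<le> c"
  shows "Lip d f A \<le> ennreal c \<longleftrightarrow> lip_bound d f c A"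
proof -
  have "ennreal \<bar>f x - f y\<bar> / d x y \<le> ennreal c \<longleftrightarrow> (d x y \<noteq> \<infinity> \<longrightarrow> \<bar>f x - f y\<bar> \<le> c * enn2real (d x y))"
    if "x \<noteq> y" for x y
  proof (cases "d x y = \<infinity>")
    case False
    define r where "r = enn2real (d x y)"
    have dr: "d x y = ennreal r" using False by (simp add: r_def less_top)
    have r: "r > 0" using dist_eq_0_iff[of x y] that dr by (metis enn2real_nonneg ennreal_0 less_eq_real_def r_def)
    show ?thesis using r c by (simp add: dr divide_ennreal pos_divide_le_eq)
  qed simp
  then have "Lip d f A \<le> ennreal c \<longleftrightarrow>
      (\<forall>x\<in>A. \<forall>y\<in>A. x \<noteq> y \<longrightarrow> d x y \<noteq> \<infinity> \<longrightarrow> \<bar>f x - f y\<bar> \<le> c * enn2real (d x y))"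
    unfolding Lip_def SUP_le_iff by (auto split: prod.splits)
  also have "\<dots> \<longleftrightarrow> lip_bound d f c A"
    unfolding lip_bound_def using c by (metis abs_zero diff_self enn2real_nonneg mult_nonneg_nonneg)
  finally show ?thesis .
qed

lemma lip_bound_mono: "lip_bound d f c A \<Longrightarrow> c \<le> c' \<Longrightarrow> B \<subseteq> A \<Longrightarrow> lip_bound d f c' B"
  unfolding lip_bound_def by (meson enn2real_nonneg mult_right_mono order_trans subsetD)

lemma lip_bound_lincomb:
  assumes "lip_bound d f c A" "lip_bound d g c' A"
  shows "lip_bound d (\<lambda>x. \<alpha> * f x + \<beta> * g x) (\<bar>\<alpha>\<bar> * c + \<bar>\<beta>\<bar> * c') A"
  unfolding lip_bound_def
proof (intro ballI impI)
  fix x y assume xy: "x \<in> A" "y \<in> A" "d x y \<noteq> \<infinity>"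
  define r where "r = enn2real (d x y)"
  have fg: "\<bar>f x - f y\<bar> \<le> c * r" "\<bar>g x - g y\<bar> \<le> c' * r" using assms xy by (auto simp: lip_bound_def r_def)
  have "\<bar>(\<alpha> * f x + \<beta> * g x) - (\<alpha> * f y + \<beta> * g y)\<bar> = \<bar>\<alpha> * (f x - f y) + \<beta> * (g x - g y)\<bar>"
    by (simp add: algebra_simps)
  also have "\<dots> \<le> \<bar>\<alpha>\<bar> * \<bar>f x - f y\<bar> + \<bar>\<beta>\<bar> * \<bar>g x - g y\<bar>"
    by (metis abs_mult abs_triangle_ineq)
  also have "\<dots> \<le> \<bar>\<alpha>\<bar> * (c * r) + \<bar>\<beta>\<bar> * (c' * r)" by (intro add_mono mult_left_mono fg) auto
  finally show "\<bar>(\<alpha> * f x + \<beta> * g x) - (\<alpha> * f y + \<beta> * g y)\<bar> \<le> (\<bar>\<alpha>\<bar> * c + \<bar>\<beta>\<bar> * c') * enn2real (d x y)"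
    by (simp add: algebra_simps r_def)
qed

lemma lip_bound_mult:
  assumes "lip_bound d f c A" "lip_bound d g c' A" "\<And>x. x \<in> A \<Longrightarrow> \<bar>f x\<bar> \<le> F" "\<And>x. x \<in> A \<Longrightarrow> \<bar>g x\<bar> \<le> G"
    and "0 \<le> F" "0 \<le> G"
  shows "lip_bound d (\<lambda>x. f x * g x) (F * c' + G * c) A"
  unfolding lip_bound_def
proof (intro ballI impI)
  fix x y assume xy: "x \<in> A" "y \<in> A" "d x y \<noteq> \<infinity>"
  define r where "r = enn2real (d x y)"
  have fg: "\<bar>f x - f y\<bar> \<le> c * r" "\<bar>g x - g y\<bar> \<le> c' * r" using assms xy by (auto simp: lip_bound_def r_def)
  have "\<bar>f x * g x - f y * g y\<bar> = \<bar>f x * (g x - g y) + g y * (f x - f y)\<bar>"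
    by (simp add: algebra_simps)
  also have "\<dots> \<le> \<bar>f x\<bar> * \<bar>g x - g y\<bar> + \<bar>g y\<bar> * \<bar>f x - f y\<bar>"
    by (metis abs_mult abs_triangle_ineq)
  also have "\<dots> \<le> F * (c' * r) + G * (c * r)" using assms xy fg by (intro add_mono mult_mono) auto
  finally show "\<bar>f x * g x - f y * g y\<bar> \<le> (F * c' + G * c) * enn2real (d x y)"
    by (simp add: algebra_simps r_def)
qed

context ext_metric_top_space begin

lemma Lipb_iff:
  "f \<in> Lipb d \<longleftrightarrow> bounded (range f) \<and> continuous_on UNIV f \<and> (\<exists>c\<ge>0. lip_bound d f c UNIV)"
proof -
  have "Lip d f UNIV < \<infinity> \<longleftrightarrow> (\<exists>c\<ge>0. Lip d f UNIV \<le> ennreal c)"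
    by (metis enn2real_nonneg ennreal_enn2real_if ennreal_less_top infinity_ennreal_def order.refl order_le_less_trans order_less_irrefl)
  then show ?thesis by (auto simp: Lipb_def Lip_le_iff)
qed

lemma LipbE:
  assumes "f \<in> Lipb d"
  obtains c C where "c \<ge> 0" "lip_bound d f c UNIV" "C \<ge> 0" "\<And>x. \<bar>f x\<bar> \<le> C"
proof -
  obtain c where c: "c \<ge> 0" "lip_bound d f c UNIV" "bounded (range f)" using assms by (auto simp: Lipb_iff)
  then obtain C where C: "\<And>x. \<bar>f x\<bar> \<le> C" by (auto simp: bounded_iff)
  have "C \<ge> 0" using C[of undefined] by (meson abs_ge_zero order_trans)
  then show ?thesis using that c C by blast
qed

lemma LipbI:
  assumes "\<And>x. \<bar>f x\<bar> \<le> C" "continuous_on UNIV f" "0 \<le> c" "lip_bound d f c UNIV"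
  shows "f \<in> Lipb d"
  using assms by (auto simp: Lipb_iff bounded_iff)

lemma Lipb_continuous: "f \<in> Lipb d \<Longrightarrow> continuous_on UNIV f"
  by (simp add: Lipb_def)

lemma Lipb_lincomb:
  assumes f: "f \<in> Lipb d" and g: "g \<in> Lipb d"
  shows "(\<lambda>x. \<alpha> * f x + \<beta> * g x) \<in> Lipb d"
proof -
  obtain a A b B where a: "a \<ge> 0" "lip_bound d f a UNIV" "A \<ge> 0" "\<And>x. \<bar>f x\<bar> \<le> A"
    and b: "b \<ge> 0" "lip_bound d g b UNIV" "B \<ge> 0" "\<And>x. \<bar>g x\<bar> \<le> B"
    using LipbE[OF f] LipbE[OF g] by metis
  show ?thesis
  proof (rule LipbI[OF _ _ _ lip_bound_lincomb[OF a(2) b(2)]])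
    show "\<bar>\<alpha> * f x + \<beta> * g x\<bar> \<le> \<bar>\<alpha>\<bar> * A + \<bar>\<beta>\<bar> * B" for x
      by (rule order_trans[OF abs_triangle_ineq]) (auto simp: abs_mult intro!: add_mono mult_left_mono a b)
    show "continuous_on UNIV (\<lambda>x. \<alpha> * f x + \<beta> * g x)"
      using f g by (intro continuous_intros Lipb_continuous)
  qed (use a b in auto)
qed

lemma Lipb_mult:
  assumes f: "f \<in> Lipb d" and g: "g \<in> Lipb d"
  shows "(\<lambda>x. f x * g x) \<in> Lipb d"
proof -
  obtain a A b B where a: "a \<ge> 0" "lip_bound d f a UNIV" "A \<ge> 0" "\<And>x. \<bar>f x\<bar> \<le> A"
    and b: "b \<ge> 0" "lip_bound d g b UNIV" "B \<ge> 0" "\<And>x. \<bar>g x\<bar> \<le> B"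
    using LipbE[OF f] LipbE[OF g] by metis
  show ?thesis
  proof (rule LipbI[OF _ _ _ lip_bound_mult[OF a(2) b(2), where F = A and G = B]])
    show "\<bar>f x * g x\<bar> \<le> A * B" for x
      using a b by (simp add: abs_mult mult_mono)
    show "continuous_on UNIV (\<lambda>x. f x * g x)"
      using f g by (intro continuous_intros Lipb_continuous)
  qed (use a b in auto)
qed

lemma Lipb_const: "(\<lambda>x. c) \<in> Lipb d"
  by (rule LipbI[where C = "\<bar>c\<bar>" and c = 0]) (auto simp: lip_bound_def)

lemma Lipb_scale: "f \<in> Lipb d \<Longrightarrow> (\<lambda>x. c * f x) \<in> Lipb d"
  by (intro Lipb_mult Lipb_const)

lemma Lipb_add: "f \<in> Lipb d \<Longrightarrow> g \<in> Lipb d \<Longrightarrow> (\<lambda>x. f x + g x) \<in> Lipb d"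
  using Lipb_lincomb[of f g 1 1] by simp

lemma Lipb_diff: "f \<in> Lipb d \<Longrightarrow> g \<in> Lipb d \<Longrightarrow> (\<lambda>x. f x - g x) \<in> Lipb d"
  using Lipb_lincomb[of f g 1 "-1"] by simp

lemma Lipb_clamp:
  assumes f: "f \<in> Lipb d"
  shows "(\<lambda>x. max 0 (min 1 (f x))) \<in> Lipb d"
proof -
  obtain a where a: "a \<ge> 0" "lip_bound d f a UNIV" using LipbE[OF f] by metis
  have "\<bar>max 0 (min 1 s) - max 0 (min 1 t)\<bar> \<le> \<bar>s - t\<bar>" for s t :: real by linarith
  then have "lip_bound d (\<lambda>x. max 0 (min 1 (f x))) a UNIV"
    using a(2) unfolding lip_bound_def by (meson order_trans)
  moreover have "continuous_on UNIV (\<lambda>x. max 0 (min 1 (f x)))"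
    using f by (intro continuous_intros Lipb_continuous)
  ultimately show ?thesis by (intro LipbI[OF _ _ a(1), where C = 1]) auto
qed

lemma lip_nonneg: "0 \<le> lip d f x"
  by (simp add: lip_def)

lemma lip_leI:
  assumes "open U" "x \<in> U" "0 \<le> c" "lip_bound d f c U"
  shows "lip d f x \<le> c"
proof -
  have "(INF U \<in> {U. open U \<and> x \<in> U}. Lip d f U) \<le> ennreal c"
    by (rule INF_lower2[of U]) (use assms in \<open>auto simp: Lip_le_iff\<close>)
  then show ?thesis unfolding lip_def using assms(3) by (simp add: enn2real_leI)
qed

text \<open>For \<open>f\<close> in \<open>Lipb d\<close> the infimum in \<open>lip\<close> is
  finite, so strict inequalities survive the passage between \<open>real\<close> and
  \<open>ennreal\<close> and yield one neighbourhood with a constant strictly below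
  \<open>c\<close>.\<close>

lemma lip_lessE:
  assumes f: "f \<in> Lipb d" and less: "lip d f x < c"
  obtains U c' where "open U" "x \<in> U" "lip_bound d f c' U" "0 \<le> c'" "c' < c"
proof -
  define I where "I = (INF U \<in> {U. open U \<and> x \<in> U}. Lip d f U)"
  have "I \<le> Lip d f UNIV" unfolding I_def by (rule INF_lower) auto
  then have fin: "I < \<infinity>" using f by (auto simp: Lipb_def intro: le_less_trans)
  have less: "lip d f x < c" by fact
  obtain c' where c': "lip d f x < c'" "c' < c" using dense[OF less] by blast
  have c'0: "c' > 0" using c'(1) lip_nonneg[of f x] by linarith
  have "I = ennreal (lip d f x)" using fin by (simp add: lip_def I_def[symmetric] less_top)
  then have "I < ennreal c'" using c'(1) c'0 by (simp add: ennreal_lessI)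
  then obtain U where "open U" "x \<in> U" "Lip d f U < ennreal c'"
    unfolding I_def INF_less_iff by blast
  then show ?thesis using that[of U c'] c' c'0 Lip_le_iff[of c' f U] by auto
qed

lemma lip_bounded:
  assumes "f \<in> Lipb d"
  obtains C where "C \<ge> 0" "\<And>x. lip d f x \<le> C"
proof -
  obtain a where a: "a \<ge> 0" "lip_bound d f a UNIV" using LipbE[OF assms] by metis
  then show ?thesis using that lip_leI[of UNIV] by blast
qed

lemma lip_lincomb:
  assumes f: "f \<in> Lipb d" and g: "g \<in> Lipb d"
  shows "lip d (\<lambda>y. \<alpha> * f y + \<beta> * g y) x \<le> \<bar>\<alpha>\<bar> * lip d f x + \<bar>\<beta>\<bar> * lip d g x"
proof (rule field_le_epsilon)
  fix e :: real assume e: "e > 0"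
  define k where "k = \<bar>\<alpha>\<bar> + \<bar>\<beta>\<bar> + 1"
  have k: "k > 0" by (simp add: k_def add_nonneg_pos)
  define \<delta> where "\<delta> = e / k"
  have \<delta>: "\<delta> > 0" using e k by (simp add: \<delta>_def)
  obtain U a where U: "open U" "x \<in> U" "lip_bound d f a U" "0 \<le> a" "a < lip d f x + \<delta>"
    using lip_lessE[OF f, of x "lip d f x + \<delta>"] \<delta> by auto
  obtain V b where V: "open V" "x \<in> V" "lip_bound d g b V" "0 \<le> b" "b < lip d g x + \<delta>"
    using lip_lessE[OF g, of x "lip d g x + \<delta>"] \<delta> by auto
  have "lip d (\<lambda>y. \<alpha> * f y + \<beta> * g y) x \<le> \<bar>\<alpha>\<bar> * a + \<bar>\<beta>\<bar> * b"
    by (rule lip_leI[of "U \<inter> V"])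
      (use U V in \<open>auto intro!: lip_bound_lincomb intro: lip_bound_mono[OF U(3)] lip_bound_mono[OF V(3)]\<close>)
  also have "\<dots> \<le> \<bar>\<alpha>\<bar> * (lip d f x + \<delta>) + \<bar>\<beta>\<bar> * (lip d g x + \<delta>)"
    using U V by (intro add_mono mult_left_mono) auto
  also have "\<dots> = \<bar>\<alpha>\<bar> * lip d f x + \<bar>\<beta>\<bar> * lip d g x + (\<bar>\<alpha>\<bar> + \<bar>\<beta>\<bar>) * \<delta>" by (simp add: algebra_simps)
  also have "(\<bar>\<alpha>\<bar> + \<bar>\<beta>\<bar>) * \<delta> \<le> k * \<delta>" using \<delta> by (intro mult_right_mono) (auto simp: k_def)
  also have "k * \<delta> = e" using k by (simp add: \<delta>_def)
  finally show "lip d (\<lambda>y. \<alpha> * f y + \<beta> * g y) x \<le> \<bar>\<alpha>\<bar> * lip d f x + \<bar>\<beta>\<bar> * lip d g x + e" by simp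
qed

lemma lip_const: "lip d (\<lambda>y. c) x = 0"
  using lip_leI[of UNIV x 0 "\<lambda>y. c"] lip_nonneg[of "\<lambda>y. c" x] by (simp add: lip_bound_def)

lemma lip_scale:
  assumes "f \<in> Lipb d"
  shows "lip d (\<lambda>y. c * f y) x = \<bar>c\<bar> * lip d f x"
proof (cases "c = 0")
  case False
  have 1: "lip d (\<lambda>y. c * f y) x \<le> \<bar>c\<bar> * lip d f x"
    using lip_lincomb[OF assms assms, of c 0] by simp
  have "lip d (\<lambda>y. (1/c) * (c * f y)) x \<le> \<bar>1/c\<bar> * lip d (\<lambda>y. c * f y) x"
    using lip_lincomb[OF Lipb_scale[OF assms] Lipb_scale[OF assms], of "1/c" c 0] by simp
  then have "\<bar>c\<bar> * lip d f x \<le> lip d (\<lambda>y. c * f y) x" using False by (simp add: field_simps)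
  then show ?thesis using 1 by simp
qed (simp add: lip_const)

lemma lip_add: "f \<in> Lipb d \<Longrightarrow> g \<in> Lipb d \<Longrightarrow> lip d (\<lambda>y. f y + g y) x \<le> lip d f x + lip d g x"
  using lip_lincomb[of f g 1 1] by simp

lemma lip_diff_commute:
  assumes "f \<in> Lipb d" "g \<in> Lipb d"
  shows "lip d (\<lambda>y. f y - g y) x = lip d (\<lambda>y. g y - f y) x"
  using lip_scale[OF Lipb_diff[OF assms], of "-1" x] by simp

lemma lip_abs_diff:
  assumes f: "f \<in> Lipb d" and g: "g \<in> Lipb d"
  shows "\<bar>lip d f x - lip d g x\<bar> \<le> lip d (\<lambda>y. f y - g y) x"
proof -
  have "lip d f x \<le> lip d (\<lambda>y. f y - g y) x + lip d g x"
    using lip_add[OF Lipb_diff[OF f g] g, of x] by simp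
  moreover have "lip d g x \<le> lip d (\<lambda>y. g y - f y) x + lip d f x"
    using lip_add[OF Lipb_diff[OF g f] f, of x] by simp
  ultimately show ?thesis using lip_diff_commute[OF f g, of x] by simp
qed

lemma lip_add_const: "f \<in> Lipb d \<Longrightarrow> lip d (\<lambda>y. f y + c) x = lip d f x"
  using lip_abs_diff[OF Lipb_add[OF _ Lipb_const[of c]], of f f x] by (simp add: lip_const)

text \<open>The pointwise Leibniz rule: \<open>f \<mapsto> [f]\<close> modulo the kernel of the seminorm \<open>lip d _ x\<close> is a derivation at \<open>x\<close>.\<close>

lemma lip_mult_vanishing:
  assumes u: "u \<in> Lipb d" and v: "v \<in> Lipb d"
  shows "lip d (\<lambda>y. (u y - u x) * (v y - v x)) x = 0"
proof (rule antisym[OF _ lip_nonneg], rule field_le_epsilon)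
  fix e :: real assume e: "e > 0"
  obtain a b where a: "a \<ge> 0" "lip_bound d u a UNIV" and b: "b \<ge> 0" "lip_bound d v b UNIV"
    using LipbE[OF u] LipbE[OF v] by metis
  define \<delta> where "\<delta> = e / (a + b + 1)"
  have \<delta>: "\<delta> > 0" using e a b by (simp add: \<delta>_def)
  \<comment> \<open>Near \<open>x\<close> both factors are smaller than \<delta>, so the Lipschitz
    product rule on \<open>U\<close> yields the constant \<open>\<delta> * b + \<delta> * a\<close>,
    which is below \<open>e\<close>.\<close>
  define U where "U = {y. \<bar>u y - u x\<bar> < \<delta>} \<inter> {y. \<bar>v y - v x\<bar> < \<delta>}"
  have oU: "open U" unfolding U_def
    using Lipb_continuous[OF u] Lipb_continuous[OF v] by (intro open_Int open_Collect_less continuous_intros)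
  have sh: "lip_bound d (\<lambda>y. w y - w x) c U" if "lip_bound d w c UNIV" for w c
    using that by (simp add: lip_bound_def)
  have "lip d (\<lambda>y. (u y - u x) * (v y - v x)) x \<le> \<delta> * b + \<delta> * a"
    by (rule lip_leI[OF oU _ _ lip_bound_mult[OF sh[OF a(2)] sh[OF b(2)]]])
       (use a b \<delta> in \<open>auto simp: U_def\<close>)
  also have "\<dots> = e * ((a + b) / (a + b + 1))" by (simp add: \<delta>_def add_divide_distrib algebra_simps)
  also have "\<dots> \<le> e * 1" using e a b by (intro mult_left_mono) auto
  finally show "lip d (\<lambda>y. (u y - u x) * (v y - v x)) x \<le> 0 + e" by simp
qed

text \<open>The slope is upper semicontinuous: a neighbourhood \<open>U\<close> that witnesses
  \<open>lip d f x < c\<close> is a neighbourhood of each of its points and witnesses the same bound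
  there.\<close>

lemma lip_borel_measurable:
  assumes f: "f \<in> Lipb d"
  shows "lip d f \<in> borel_measurable borel"
proof (rule borel_measurableI_less)
  fix c
  have "open {x. lip d f x < c}"
  proof (subst open_subopen, intro ballI)
    fix x assume "x \<in> {x. lip d f x < c}"
    then obtain U c' where U: "open U" "x \<in> U" "lip_bound d f c' U" "0 \<le> c'" "c' < c"
      using lip_lessE[OF f, of x c] by auto
    then have "U \<subseteq> {x. lip d f x < c}" using lip_leI[OF U(1) _ U(4,3)] by fastforce
    then show "\<exists>T. open T \<and> x \<in> T \<and> T \<subseteq> {x. lip d f x < c}" using U by blast
  qed
  then show "{x \<in> space borel. lip d f x < c} \<in> sets borel" by simp
qed

end

section \<open>Density of Lipschitz functions\<close>

context ext_metric_top_space begin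

text \<open>If no function separated \<open>x\<close> from \<open>y\<close>, every term of the
  supremum defining \<open>d x y\<close> would vanish, contradicting
  \<open>d x y \<noteq> 0\<close>.\<close>

lemma Lipb_separates:
  assumes "x \<noteq> y"
  shows "\<exists>f\<in>Lipb d. f x \<noteq> f y"
proof (rule ccontr)
  assume "\<not> ?thesis"
  then have "d x y = (SUP f \<in> {f \<in> Lipb d. Lip d f UNIV \<le> 1}. 0)"
    unfolding dist_eq_SUP[of x y] by (intro SUP_cong) auto
  also have "\<dots> \<le> 0" by (rule SUP_least) simp
  finally show False using dist_eq_0_iff[of x y] assms by simp
qed

text \<open>Disjoint compact sets make the indicator of \<open>K\<close> continuous on their union.
  Stone-Weierstrass approximates it there by a Lipschitz function, and an affine map followed by
  clamping makes the values exact.\<close>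

lemma Lipb_urysohn:
  assumes K: "compact K" and C: "compact C" and KC: "K \<inter> C = {}"
  obtains h where "h \<in> Lipb d" "\<And>x. 0 \<le> h x \<and> h x \<le> 1" "\<And>x. x \<in> K \<Longrightarrow> h x = 1" "\<And>x. x \<in> C \<Longrightarrow> h x = 0"
proof -
  interpret function_ring_on "Lipb d" "K \<union> C"
  proof unfold_locales
    show "compact (K \<union> C)" using K C by (rule compact_Un)
    show "continuous_on (K \<union> C) f" if "f \<in> Lipb d" for f
      using Lipb_continuous[OF that] by (rule continuous_on_subset) simp
  qed (simp_all add: Lipb_add Lipb_mult Lipb_const Lipb_separates)
  have "continuous_on (K \<union> C) (indicator K :: 'a \<Rightarrow> real)"
  proof (rule continuous_on_closed_Un)
    show "closed K" "closed C" using K C by (auto intro: compact_imp_closed)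
    show "continuous_on K (indicator K :: 'a \<Rightarrow> real)"
      by (rule continuous_on_eq[OF continuous_on_const[of _ 1]]) simp
    show "continuous_on C (indicator K :: 'a \<Rightarrow> real)"
      by (rule continuous_on_eq[OF continuous_on_const[of _ 0]]) (use KC in \<open>auto simp: indicator_def\<close>)
  qed
  then obtain g where g: "g \<in> Lipb d" "\<And>x. x \<in> K \<union> C \<Longrightarrow> \<bar>indicator K x - g x\<bar> < 1/3"
    using Stone_Weierstrass_basic[of "indicator K" "1/3"] by auto
  \<comment> \<open>The approximant exceeds 2/3 on \<open>K\<close> and stays below 1/3 on
    \<open>C\<close>, so \<open>3 * g x - 1\<close> is above 1 on \<open>K\<close> and negative on
    \<open>C\<close>.\<close>
  define h where "h = (\<lambda>x. max 0 (min 1 (3 * g x + (-1) * 1)))"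
  show ?thesis
  proof (rule that[of h])
    show "h \<in> Lipb d" unfolding h_def by (intro Lipb_clamp Lipb_lincomb g Lipb_const)
    show "0 \<le> h x \<and> h x \<le> 1" for x by (simp add: h_def)
    show "h x = 1" if "x \<in> K" for x
    proof -
      have "\<bar>1 - g x\<bar> < 1/3" using g(2)[of x] that by simp
      then show ?thesis unfolding h_def by linarith
    qed
    show "h x = 0" if "x \<in> C" for x
    proof -
      have "x \<notin> K" using that KC by auto
      then have "\<bar>g x\<bar> < 1/3" using g(2)[of x] that by simp
      then show ?thesis unfolding h_def by linarith
    qed
  qed
qed

end

section \<open>Approximation of indicators by Lipschitz functions through compact sets\<close>

context ext_metric_top_measure_space begin

lemma space_UNIV: "space m = UNIV"
  using sets_eq_imp_space_eq[OF sets_eq_borel] by simp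

lemma continuous_measurable: "continuous_on UNIV f \<Longrightarrow> f \<in> borel_measurable m" for f :: "'a \<Rightarrow> real"
  using borel_measurable_continuous_onI measurable_cong_sets[OF sets_eq_borel refl] by blast

lemma Lipb_bdd_meas: "f \<in> Lipb d \<Longrightarrow> f \<in> bdd_meas m"
  by (simp add: bdd_meas_def Lipb_def continuous_measurable)

lemma Lipb_measurable[measurable_dest]: "f \<in> Lipb d \<Longrightarrow> f \<in> borel_measurable m"
  by (simp add: Lipb_def continuous_measurable)

lemma lip_measurable: "f \<in> Lipb d \<Longrightarrow> lip d f \<in> borel_measurable m"
  using lip_borel_measurable measurable_cong_sets[OF sets_eq_borel refl] by blast

lemma lip_bdd_meas:
  assumes "f \<in> Lipb d"
  shows "lip d f \<in> bdd_meas m"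
proof -
  obtain C where "\<And>x. lip d f x \<le> C" using lip_bounded[OF assms] by metis
  then show ?thesis by (intro bdd_measI[OF lip_measurable[OF assms], of C]) (simp add: lip_nonneg)
qed

lemma compact_exhaustion:
  assumes B: "B \<in> sets m"
  obtains K :: "nat \<Rightarrow> 'a set" where "\<And>n. compact (K n)" "\<And>n. K n \<subseteq> B" "incseq K"
    "AE x in m. x \<in> B \<longrightarrow> (\<exists>n. x \<in> K n)"
proof -
  have "\<exists>K. compact K \<and> K \<subseteq> B \<and> measure m B - 1 / real (Suc n) < measure m K" for n
  \<comment> \<open>Negative thresholds are treated apart because \<open>ennreal\<close> truncates
    them to 0; for them the empty set suffices.\<close>
  proof (cases "measure m B - 1 / real (Suc n) < 0")
    case True then show ?thesis by (intro exI[of _ "{}"]) simp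
  next
    case False
    have "0 < 1 / real (Suc n)" by simp
    then have "0 < measure m B" "measure m B - 1 / real (Suc n) < measure m B" using False by linarith+
    then have "ennreal (measure m B - 1 / real (Suc n)) < emeasure m B"
      by (simp only: emeasure_eq_measure ennreal_lessI)
    also have "emeasure m B = (SUP K \<in> {K. compact K \<and> K \<subseteq> B}. emeasure m K)"
      using B by (intro inner_regular) (simp add: sets_eq_borel)
    finally obtain K where K: "compact K" "K \<subseteq> B" "ennreal (measure m B - 1 / real (Suc n)) < emeasure m K"
      by (auto simp: less_SUP_iff)
    then show ?thesis using False by (intro exI[of _ K]) (simp add: emeasure_eq_measure ennreal_less_iff)
  qed
  then obtain K' where K': "\<And>n. compact (K' n)" "\<And>n. K' n \<subseteq> B"
      "\<And>n. measure m B - 1 / real (Suc n) < measure m (K' n)" by metis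
  have K's: "K' n \<in> sets m" for n using K'(1) by (simp add: sets_eq_borel borel_compact)
  define N where "N = B - (\<Union>n. K' n)"
  have Ns: "N \<in> sets m" using B K's by (auto simp: N_def)
  have "measure m N \<le> 0"
  proof (rule LIMSEQ_le_const[OF LIMSEQ_Suc[OF lim_1_over_n]], intro exI[of _ 0] allI impI)
    fix n
    have "measure m N \<le> measure m (B - K' n)"
      using B K's by (intro finite_measure_mono) (auto simp: N_def)
    also have "\<dots> = measure m B - measure m (K' n)" using K' K's B by (intro finite_measure_Diff) auto
    finally show "measure m N \<le> 1 / real (Suc n)" using K'(3)[of n] by simp
  qed
  then have "emeasure m N = 0" by (simp add: emeasure_eq_measure measure_le_0_iff)
  then have N: "N \<in> null_sets m" using Ns by auto
  show ?thesis
  proof (rule that[of "\<lambda>n. \<Union>j\<le>n. K' j"])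
    show "compact (\<Union>j\<le>n. K' j)" for n by (intro compact_UN K') auto
    show "(\<Union>j\<le>n. K' j) \<subseteq> B" for n using K' by auto
    show "incseq (\<lambda>n. \<Union>j\<le>n. K' j)" by (intro incseq_SucI UN_mono) auto
    show "AE x in m. x \<in> B \<longrightarrow> (\<exists>n. x \<in> (\<Union>j\<le>n. K' j))"
      using AE_not_in[OF N] by eventually_elim (auto simp: N_def)
  qed
qed

text \<open>\<open>A\<close> and its complement are exhausted by compact sets \<open>K n\<close> and
  \<open>C n\<close>. The Urysohn function of the \<open>n\<close>-th pair is eventually constant,
  with the right value, at almost every point.\<close>

lemma Lipb_approximates_indicator:
  assumes A: "A \<in> sets m"
  obtains h :: "nat \<Rightarrow> 'a \<Rightarrow> real" where "\<And>n. h n \<in> Lipb d" "\<And>n x. 0 \<le> h n x \<and> h n x \<le> 1"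
    "AE x in m. (\<lambda>n. h n x) \<longlonglongrightarrow> indicator A x"
proof -
  have A': "- A \<in> sets m" using sets.compl_sets[OF A] by (simp add: space_UNIV Compl_eq_Diff_UNIV)
  obtain K where K: "\<And>n. compact (K n)" "\<And>n. K n \<subseteq> A" "incseq K" "AE x in m. x \<in> A \<longrightarrow> (\<exists>n::nat. x \<in> K n)"
    by (rule compact_exhaustion[OF A]) blast
  obtain C where C: "\<And>n. compact (C n)" "\<And>n. C n \<subseteq> - A" "incseq C" "AE x in m. x \<in> - A \<longrightarrow> (\<exists>n::nat. x \<in> C n)"
    by (rule compact_exhaustion[OF A']) blast
  have "\<exists>h. h \<in> Lipb d \<and> (\<forall>x. 0 \<le> h x \<and> h x \<le> 1) \<and> (\<forall>x\<in>K n. h x = 1) \<and> (\<forall>x\<in>C n. h x = 0)" for n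
  proof -
    have "K n \<inter> C n = {}" using K(2) C(2) by blast
    then obtain h where "h \<in> Lipb d" "\<And>x. 0 \<le> h x \<and> h x \<le> 1" "\<And>x. x \<in> K n \<Longrightarrow> h x = 1" "\<And>x. x \<in> C n \<Longrightarrow> h x = 0"
      using Lipb_urysohn[OF K(1) C(1)] by blast
    then show ?thesis by blast
  qed
  then obtain h where h: "\<And>n. h n \<in> Lipb d" "\<And>n x. 0 \<le> h n x \<and> h n x \<le> 1"
    "\<And>n x. x \<in> K n \<Longrightarrow> h n x = 1" "\<And>n x. x \<in> C n \<Longrightarrow> h n x = 0" by metis
  show ?thesis
  proof (rule that[OF h(1,2)])
    show "AE x in m. (\<lambda>n. h n x) \<longlonglongrightarrow> indicator A x"
      using K(4) C(4)
    proof eventually_elim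
      case (elim x)
      show ?case
      proof (cases "x \<in> A")
        case True
        then obtain n where "x \<in> K n" using elim by blast
        then have "\<forall>\<^sub>F j in sequentially. h j x = 1"
          using K(3) h(3) unfolding incseq_def by (intro eventually_sequentiallyI[of n]) blast
        then show ?thesis using True by (simp add: tendsto_eventually)
      next
        case False
        then obtain n where "x \<in> C n" using elim by blast
        then have "\<forall>\<^sub>F j in sequentially. h j x = 0"
          using C(3) h(4) unfolding incseq_def by (intro eventually_sequentiallyI[of n]) blast
        then show ?thesis using False by (simp add: tendsto_eventually)
      qed
    qed
  qed
qed

lemma Lipb_test_tendsto:
  assumes "integrable m u" "\<And>n. h n \<in> Lipb d" "\<And>n x. 0 \<le> h n x \<and> h n x \<le> 1"
    "AE x in m. (\<lambda>n. h n x) \<longlonglongrightarrow> indicator A x" and "A \<in> sets m"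
  shows "(\<lambda>n. \<integral>x. h n x * u x \<partial>m) \<longlonglongrightarrow> (\<integral>x. indicator A x * u x \<partial>m)"
proof (rule integral_dominated_convergence[where w = "\<lambda>x. \<bar>u x\<bar>"])
  show "AE x in m. (\<lambda>n. h n x * u x) \<longlonglongrightarrow> indicator A x * u x"
    using assms(4) by eventually_elim (intro tendsto_intros)
  show "AE x in m. norm (h n x * u x) \<le> \<bar>u x\<bar>" for n
    using assms(3)[of n] by (intro AE_I2) (auto simp: abs_mult intro: mult_left_le_one_le)
  have [measurable]: "u \<in> borel_measurable m" using assms(1) by auto
  show "(\<lambda>x. indicator A x * u x) \<in> borel_measurable m" using assms(5) by measurable
  show "(\<lambda>x. h n x * u x) \<in> borel_measurable m" for n using Lipb_measurable[OF assms(2)[of n]] by measurable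
qed (use assms(1) in auto)

text \<open>Indicators are limits of Lipschitz functions with values in \<open>[0, 1]\<close>, so
  dominated convergence reduces the claim to testing with measurable sets.\<close>

lemma AE_le_zero_of_Lipb_test:
  assumes u: "integrable m u"
    and le: "\<And>h. h \<in> Lipb d \<Longrightarrow> (\<And>x. 0 \<le> h x \<and> h x \<le> 1) \<Longrightarrow> (\<integral>x. h x * u x \<partial>m) \<le> 0"
  shows "AE x in m. u x \<le> 0"
proof (rule AE_le_zero_of_integral[OF u])
  fix A assume A: "A \<in> sets m"
  obtain h :: "nat \<Rightarrow> 'a \<Rightarrow> real" where h: "\<And>n. h n \<in> Lipb d" "\<And>n x. 0 \<le> h n x \<and> h n x \<le> 1"
    "AE x in m. (\<lambda>n. h n x) \<longlonglongrightarrow> indicator A x" using Lipb_approximates_indicator[OF A] by blast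
  show "(\<integral>x. indicator A x * u x \<partial>m) \<le> 0"
    by (rule LIMSEQ_le_const2[OF Lipb_test_tendsto[OF u h A]]) (use le[OF h(1,2)] in blast)
qed

lemma AE_eq_zero_of_Lipb_test:
  assumes u: "integrable m u" and eq: "\<And>h. h \<in> Lipb d \<Longrightarrow> (\<integral>x. h x * u x \<partial>m) = 0"
  shows "AE x in m. u x = 0"
proof -
  have "AE x in m. u x \<le> 0" by (rule AE_le_zero_of_Lipb_test[OF u]) (simp add: eq)
  moreover have "AE x in m. - u x \<le> 0" by (rule AE_le_zero_of_Lipb_test) (use u eq in auto)
  ultimately show ?thesis by eventually_elim auto
qed

end

section \<open>Limits of dominated functionals\<close>

context ext_metric_top_measure_space begin

text \<open>Convergence in \<open>L^1\<close> of the dominating densities makes the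
  \<open>T n\<close> asymptotically equicontinuous for the seminorm
  \<open>\<integral> |f| \<rho>'\<close>. Convergence therefore spreads from Lipschitz functions to
  indicators, to layer sums and to all bounded functions; the limit functional is dominated by
  \<rho>' and so has a density.\<close>

lemma dominated_functionals_limit:
  fixes T :: "nat \<Rightarrow> ('a \<Rightarrow> real) \<Rightarrow> real"
  assumes lin: "\<And>n f g \<alpha> \<beta>. f \<in> bdd_meas m \<Longrightarrow> g \<in> bdd_meas m \<Longrightarrow>
      T n (\<lambda>x. \<alpha> * f x + \<beta> * g x) = \<alpha> * T n f + \<beta> * T n g"
    and dom: "\<And>n f. f \<in> bdd_meas m \<Longrightarrow> \<bar>T n f\<bar> \<le> (\<integral>x. \<bar>f x\<bar> * \<rho> n x \<partial>m)"
    and \<rho>: "\<And>n. integrable m (\<rho> n)" and \<rho>': "integrable m \<rho>'"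
    and \<rho>lim: "(\<lambda>n. \<integral>x. \<bar>\<rho> n x - \<rho>' x\<bar> \<partial>m) \<longlonglongrightarrow> 0"
    and conv: "\<And>h. h \<in> Lipb d \<Longrightarrow> convergent (\<lambda>n. T n h)"
  obtains l where "integrable m l" "AE x in m. \<bar>l x\<bar> \<le> \<rho>' x"
    "\<And>f. f \<in> bdd_meas m \<Longrightarrow> (\<lambda>n. T n f) \<longlonglongrightarrow> (\<integral>x. f x * l x \<partial>m)"
proof -
  have bl: "(\<lambda>n. \<integral>x. \<bar>f x\<bar> * \<rho> n x \<partial>m) \<longlonglongrightarrow> (\<integral>x. \<bar>f x\<bar> * \<rho>' x \<partial>m)" if f: "f \<in> bdd_meas m" for f
  proof -
    obtain C where C: "C > 0" "\<And>x. \<bar>f x\<bar> \<le> C" using f by (metis bdd_measE)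
    note fa = bdd_meas_abs[OF f]
    have bnd: "norm ((\<integral>x. \<bar>f x\<bar> * \<rho> n x \<partial>m) - (\<integral>x. \<bar>f x\<bar> * \<rho>' x \<partial>m)) \<le> C * (\<integral>x. \<bar>\<rho> n x - \<rho>' x\<bar> \<partial>m)" for n
    proof -
      have i: "integrable m (\<lambda>x. \<bar>f x\<bar> * (\<rho> n x - \<rho>' x))"
        by (rule bdd_meas_integrable[OF fa]) (use \<rho> \<rho>' in auto)
      have "(\<integral>x. \<bar>f x\<bar> * \<rho> n x \<partial>m) - (\<integral>x. \<bar>f x\<bar> * \<rho>' x \<partial>m) = (\<integral>x. \<bar>f x\<bar> * (\<rho> n x - \<rho>' x) \<partial>m)"
        using bdd_meas_integrable[OF fa \<rho>] bdd_meas_integrable[OF fa \<rho>'] by (simp add: right_diff_distrib)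
      also have "\<bar>\<dots>\<bar> \<le> (\<integral>x. \<bar>\<bar>f x\<bar> * (\<rho> n x - \<rho>' x)\<bar> \<partial>m)" by (rule integral_abs_bound)
      also have "\<dots> \<le> (\<integral>x. C * \<bar>\<rho> n x - \<rho>' x\<bar> \<partial>m)"
        using \<rho> \<rho>' integrable_abs[OF i] C by (intro integral_mono) (auto simp: abs_mult intro: mult_right_mono)
      finally show ?thesis by simp
    qed
    have "(\<lambda>n. (\<integral>x. \<bar>f x\<bar> * \<rho> n x \<partial>m) - (\<integral>x. \<bar>f x\<bar> * \<rho>' x \<partial>m)) \<longlonglongrightarrow> 0"
      by (rule Lim_null_comparison[OF always_eventually tendsto_mult_right_zero[OF \<rho>lim]]) (use bnd in blast)
    then show ?thesis by (simp add: LIM_zero_iff)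
  qed
  have diff: "T n (\<lambda>x. f x - g x) = T n f - T n g" if "f \<in> bdd_meas m" "g \<in> bdd_meas m" for n f g
    using lin[OF that, of n 1 "-1"] by simp
  \<comment> \<open>Three-term Cauchy estimate: by \<open>bl\<close> the domination integrals of
    \<open>f - g\<close> for \<open>\<rho> n\<close> converge to the one for \<rho>', so smallness
    for \<rho>' alone controls \<open>T n f - T n g\<close> for large \<open>n\<close>.\<close>
  have approx: "convergent (\<lambda>n. T n f)"
    if f: "f \<in> bdd_meas m" and ap: "\<And>e. e > 0 \<Longrightarrow> \<exists>g\<in>bdd_meas m. convergent (\<lambda>n. T n g) \<and> (\<integral>x. \<bar>f x - g x\<bar> * \<rho>' x \<partial>m) < e" for f
  proof -
    have "Cauchy (\<lambda>n. T n f)"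
    proof (rule metric_CauchyI)
      fix e :: real assume e: "e > 0"
      obtain g where g: "g \<in> bdd_meas m" "convergent (\<lambda>n. T n g)" "(\<integral>x. \<bar>f x - g x\<bar> * \<rho>' x \<partial>m) < e / 3"
        using ap[of "e / 3"] e by auto
      note fg = bdd_meas_diff[OF f g(1)]
      have "\<forall>\<^sub>F n in sequentially. (\<integral>x. \<bar>f x - g x\<bar> * \<rho> n x \<partial>m) < e / 3"
        using order_tendstoD(2)[OF bl[OF fg] g(3)] .
      then obtain N where N: "\<And>n. n \<ge> N \<Longrightarrow> (\<integral>x. \<bar>f x - g x\<bar> * \<rho> n x \<partial>m) < e / 3"
        unfolding eventually_sequentially by blast
      obtain N' where N': "\<And>i j. i \<ge> N' \<Longrightarrow> j \<ge> N' \<Longrightarrow> dist (T i g) (T j g) < e / 3"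
        using metric_CauchyD[OF convergent_Cauchy[OF g(2)], of "e / 3"] e by auto
      show "\<exists>M. \<forall>i\<ge>M. \<forall>j\<ge>M. dist (T i f) (T j f) < e"
      proof (intro exI[of _ "max N N'"] allI impI)
        fix i j assume ij: "max N N' \<le> i" "max N N' \<le> j"
        have "\<bar>T k f - T k g\<bar> < e / 3" if "k \<ge> N" for k
          using dom[OF fg, of k] N[OF that] diff[OF f g(1), of k] by linarith
        then have "\<bar>T i f - T i g\<bar> < e / 3" "\<bar>T j f - T j g\<bar> < e / 3" using ij by auto
        moreover have "\<bar>T i g - T j g\<bar> < e / 3" using N'[of i j] ij by (simp add: dist_real_def)
        ultimately show "dist (T i f) (T j f) < e" unfolding dist_real_def by linarith
      qed
    qed
    then show ?thesis by (simp add: Cauchy_convergent_iff)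
  qed
  have ind: "convergent (\<lambda>n. T n (indicator A))" if A: "A \<in> sets m" for A
  proof (rule approx[OF bdd_meas_indicator[OF A]])
    fix e :: real assume e: "e > 0"
    obtain h :: "nat \<Rightarrow> 'a \<Rightarrow> real" where h: "\<And>n. h n \<in> Lipb d" "\<And>n x. 0 \<le> h n x \<and> h n x \<le> 1"
      "AE x in m. (\<lambda>n. h n x) \<longlonglongrightarrow> indicator A x" using Lipb_approximates_indicator[OF A] by blast
    have "(\<lambda>n. \<integral>x. \<bar>indicator A x - h n x\<bar> * \<rho>' x \<partial>m) \<longlonglongrightarrow> (\<integral>x. 0 \<partial>m)"
    proof (rule integral_dominated_convergence[where w = "\<lambda>x. \<bar>\<rho>' x\<bar>"])
      show "AE x in m. (\<lambda>n. \<bar>indicator A x - h n x\<bar> * \<rho>' x) \<longlonglongrightarrow> 0"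
        using h(3)
      proof eventually_elim
        case (elim x)
        have "(\<lambda>n. \<bar>indicator A x - h n x\<bar> * \<rho>' x) \<longlonglongrightarrow> \<bar>indicator A x - indicator A x\<bar> * \<rho>' x"
          by (intro tendsto_intros elim)
        then show ?case by simp
      qed
      show "AE x in m. norm (\<bar>indicator A x - h n x\<bar> * \<rho>' x) \<le> \<bar>\<rho>' x\<bar>" for n
      proof (rule AE_I2)
        fix x
        have "\<bar>indicator A x - h n x\<bar> \<le> 1" using h(2)[of n x] by (auto simp: indicator_def)
        then show "norm (\<bar>indicator A x - h n x\<bar> * \<rho>' x) \<le> \<bar>\<rho>' x\<bar>"
          by (simp add: abs_mult mult_left_le_one_le)
      qed
      show "(\<lambda>x. \<bar>indicator A x - h n x\<bar> * \<rho>' x) \<in> borel_measurable m" for n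
        using A \<rho>' Lipb_measurable[OF h(1)[of n]] by measurable
    qed (use \<rho>' in auto)
    then have "\<forall>\<^sub>F n in sequentially. (\<integral>x. \<bar>indicator A x - h n x\<bar> * \<rho>' x \<partial>m) < e"
      using order_tendstoD(2)[of _ "0::real" sequentially e] e by simp
    then obtain n where "(\<integral>x. \<bar>indicator A x - h n x\<bar> * \<rho>' x \<partial>m) < e"
      unfolding eventually_sequentially by blast
    then show "\<exists>g\<in>bdd_meas m. convergent (\<lambda>n. T n g) \<and> (\<integral>x. \<bar>indicator A x - g x\<bar> * \<rho>' x \<partial>m) < e"
      using conv[OF h(1)] Lipb_bdd_meas[OF h(1)] by blast
  qed
  have lc: "convergent (\<lambda>n. T n (\<lambda>x. \<alpha> * f x + \<beta> * g x))"
    if "f \<in> bdd_meas m" "g \<in> bdd_meas m" "convergent (\<lambda>n. T n f)" "convergent (\<lambda>n. T n g)" for f g \<alpha> \<beta>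
    unfolding lin[OF that(1,2)] by (intro convergent_add convergent_mult convergent_const that)
  have pos: "convergent (\<lambda>n. T n f)" if f: "f \<in> bdd_meas m" "\<And>x. 0 \<le> f x" for f
  proof (rule approx[OF f(1)])
    fix e :: real assume e: "e > 0"
    define K where "K = (\<integral>x. \<bar>\<rho>' x\<bar> \<partial>m) + 1"
    have K: "K > 0" by (simp add: K_def integral_nonneg_AE add_nonneg_pos)
    define e' where "e' = e / (2 * K)"
    have e': "e' > 0" using e K by (simp add: e'_def)
    obtain J A where A: "\<And>j::nat. A j \<in> sets m" and lower: "\<And>x. (\<Sum>j<J. e' * indicator (A j) x) \<le> f x"
      and upper: "\<And>x. f x \<le> (\<Sum>j<J. e' * indicator (A j) x) + e'"
      by (rule bdd_meas_layer_sum[OF space_UNIV f e']) blast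
    define s where "s = (\<lambda>K x. \<Sum>j<K. e' * indicator (A j) x :: real)"
    have s: "s K \<in> bdd_meas m \<and> convergent (\<lambda>n. T n (s K))" for K
    proof (induction K)
      case 0
      have "s 0 = (\<lambda>x. 0)" by (simp add: s_def)
      moreover have "convergent (\<lambda>n. T n (\<lambda>x. 0))" by (rule conv[OF Lipb_const])
      ultimately show ?case by (simp add: bdd_meas_const)
    next
      case (Suc K)
      have "s (Suc K) = (\<lambda>x. 1 * s K x + e' * indicator (A K) x)" by (simp only: s_def sum.lessThan_Suc mult_1)
      then show ?case
        using lc[OF _ bdd_meas_indicator[OF A] _ ind[OF A], of "s K" 1 e' K] bdd_meas_lincomb[OF _ bdd_meas_indicator[OF A], of "s K" 1 e' K] Suc
        by simp
    qed
    have fs: "\<bar>f x - s J x\<bar> \<le> e'" for x using lower[of x] upper[of x] by (simp add: s_def abs_le_iff)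
    have "(\<integral>x. \<bar>f x - s J x\<bar> * \<rho>' x \<partial>m) \<le> (\<integral>x. e' * \<bar>\<rho>' x\<bar> \<partial>m)"
    proof (rule integral_mono)
      show "integrable m (\<lambda>x. \<bar>f x - s J x\<bar> * \<rho>' x)"
        using s by (intro bdd_meas_integrable[OF bdd_meas_abs[OF bdd_meas_diff[OF f(1)]] \<rho>']) auto
      show "\<bar>f x - s J x\<bar> * \<rho>' x \<le> e' * \<bar>\<rho>' x\<bar>" for x
      proof -
        have "\<bar>f x - s J x\<bar> * \<rho>' x \<le> \<bar>f x - s J x\<bar> * \<bar>\<rho>' x\<bar>" by (intro mult_left_mono) auto
        also have "\<dots> \<le> e' * \<bar>\<rho>' x\<bar>" using fs by (intro mult_right_mono) auto
        finally show ?thesis .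
      qed
    qed (use \<rho>' in auto)
    also have "\<dots> \<le> e' * K" using e' by (simp add: K_def)
    also have "\<dots> = e / 2" using K by (simp add: e'_def)
    also have "\<dots> < e" using e by simp
    finally show "\<exists>g\<in>bdd_meas m. convergent (\<lambda>n. T n g) \<and> (\<integral>x. \<bar>f x - g x\<bar> * \<rho>' x \<partial>m) < e" using s by blast
  qed
  have cv: "convergent (\<lambda>n. T n f)" if f: "f \<in> bdd_meas m" for f
  proof -
    obtain C where C: "C > 0" "\<And>x. \<bar>f x\<bar> \<le> C" using f by (metis bdd_measE)
    have fC: "(\<lambda>x. f x + C) \<in> bdd_meas m" by (rule bdd_meas_add[OF f bdd_meas_const])
    have "0 \<le> f x + C" for x using C(2)[of x] by linarith
    \<comment> \<open>Shifting by the constant \<open>C\<close>, itself a Lipschitz function,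
      reduces to the nonnegative case.\<close>
    then have "convergent (\<lambda>n. T n (\<lambda>x. 1 * (f x + C) + (-1) * C))"
      by (intro lc fC bdd_meas_const pos[OF fC] conv Lipb_const)
    then show ?thesis by simp
  qed
  define \<Lambda> where "\<Lambda> = (\<lambda>f. lim (\<lambda>n. T n f))"
  have \<Lambda>: "(\<lambda>n. T n f) \<longlonglongrightarrow> \<Lambda> f" if "f \<in> bdd_meas m" for f
    unfolding \<Lambda>_def using cv[OF that] by (simp add: convergent_LIMSEQ_iff)
  obtain l where l: "integrable m l" "AE x in m. \<bar>l x\<bar> \<le> \<rho>' x"
    "\<And>f. f \<in> bdd_meas m \<Longrightarrow> \<Lambda> f = (\<integral>x. f x * l x \<partial>m)"
  proof (rule dominated_functional_density[OF space_UNIV _ \<rho>', of \<Lambda>])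
    show "\<Lambda> (\<lambda>x. \<alpha> * f x + \<beta> * g x) = \<alpha> * \<Lambda> f + \<beta> * \<Lambda> g"
      if "f \<in> bdd_meas m" "g \<in> bdd_meas m" for f g \<alpha> \<beta>
    proof -
      have "(\<lambda>n. T n (\<lambda>x. \<alpha> * f x + \<beta> * g x)) \<longlonglongrightarrow> \<alpha> * \<Lambda> f + \<beta> * \<Lambda> g"
        unfolding lin[OF that] by (intro tendsto_intros \<Lambda> that)
      then show ?thesis using LIMSEQ_unique[OF \<Lambda>[OF bdd_meas_lincomb[OF that]]] by blast
    qed
    show "\<bar>\<Lambda> f\<bar> \<le> (\<integral>x. \<bar>f x\<bar> * \<rho>' x \<partial>m)" if "f \<in> bdd_meas m" for f
      by (rule LIMSEQ_le[OF tendsto_rabs[OF \<Lambda>[OF that]] bl[OF that]]) (use dom[OF that] in blast)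
  qed blast
  show ?thesis by (rule that[OF l(1,2)]) (use \<Lambda> l(3) in auto)
qed

end

section \<open>Derivations with divergence\<close>

text \<open>As \<open>\<psi> \<ge> 0\<close>, the bounds are closed under minima, and a.e. limits
  preserve them, so the essential infimum is itself a bound. This serves \<open>|b|\<close>, with
  \<open>I\<close> the Lipschitz functions and \<psi> their slopes, as well as \<open>|Df|\<close>,
  with \<open>I\<close> the derivations and \<psi> their norms.\<close>

lemma ess_inf_of_bounds:
  fixes \<phi> \<psi> :: "'i \<Rightarrow> 'a \<Rightarrow> real"
  assumes "finite_measure M" and r: "1 < r" and \<psi>: "\<And>i. i \<in> I \<Longrightarrow> AE x in M. 0 \<le> \<psi> i x"
  defines "S \<equiv> {g \<in> Lp_nonneg r M. \<forall>i\<in>I. AE x in M. \<phi> i x \<le> g x * \<psi> i x}"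
  assumes ne: "S \<noteq> {}"
  shows "ess_inf M S \<in> S" and "\<And>g. g \<in> S \<Longrightarrow> AE x in M. ess_inf M S x \<le> g x"
proof -
  interpret finite_measure M by fact
  have r0: "r > 0" using r by simp
  have S: "g \<in> Lp r M" "AE x in M. 0 \<le> g x" "\<And>i. i \<in> I \<Longrightarrow> AE x in M. \<phi> i x \<le> g x * \<psi> i x" if "g \<in> S" for g
    using that by (auto simp: S_def Lp_nonneg_def)
  obtain s where e: "is_ess_inf M S (ess_inf M S)" and s: "\<And>n::nat. s n \<in> S" "AE x in M. (\<lambda>n. s n x) \<longlonglongrightarrow> ess_inf M S x"
  proof (rule ess_inf_lattice[OF ne])
    show "integrable M g" if "g \<in> S" for g by (rule Lp_integrable[OF r S(1)[OF that]])
    show "AE x in M. 0 \<le> g x" if "g \<in> S" for g by (rule S(2)[OF that])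
    show "(\<lambda>x. min (g x) (h x)) \<in> S" if g: "g \<in> S" and h: "h \<in> S" for g h
    proof -
      have [measurable]: "g \<in> borel_measurable M" "h \<in> borel_measurable M"
        using S(1)[OF g] S(1)[OF h] by (auto simp: Lp_def)
      have "(\<lambda>x. min (g x) (h x)) \<in> Lp r M"
        by (rule Lp_bound[OF r0 S(1)[OF g]]) (use S(2)[OF g] S(2)[OF h] in \<open>measurable, eventually_elim, auto\<close>)
      moreover have "AE x in M. 0 \<le> min (g x) (h x)"
        using S(2)[OF g] S(2)[OF h] by eventually_elim simp
      moreover have "AE x in M. \<phi> i x \<le> min (g x) (h x) * \<psi> i x" if "i \<in> I" for i
        using S(3)[OF g that] S(3)[OF h that] \<psi>[OF that] by eventually_elim (simp add: min_def)
      ultimately show ?thesis by (simp add: S_def Lp_nonneg_def)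
    qed
  qed blast
  have le: "AE x in M. ess_inf M S x \<le> g x" if "g \<in> S" for g
    using e that by (simp add: is_ess_inf_def)
  then show "\<And>g. g \<in> S \<Longrightarrow> AE x in M. ess_inf M S x \<le> g x" .
  have [measurable]: "ess_inf M S \<in> borel_measurable M" using e by (simp add: is_ess_inf_def)
  have "AE x in M. \<forall>n. 0 \<le> s n x" using S(2)[OF s(1)] by (simp add: AE_all_countable)
  then have nn: "AE x in M. 0 \<le> ess_inf M S x"
    using s(2) by eventually_elim (rule LIMSEQ_le_const, auto)
  have "ess_inf M S \<in> Lp r M"
    by (rule Lp_bound[OF r0 S(1)[OF s(1)[of 0]]]) (use nn le[OF s(1)[of 0]] in \<open>measurable, eventually_elim, auto\<close>)
  moreover have "AE x in M. \<phi> i x \<le> ess_inf M S x * \<psi> i x" if "i \<in> I" for i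
  proof -
    have "AE x in M. \<forall>n. \<phi> i x \<le> s n x * \<psi> i x" using S(3)[OF s(1) that] by (simp add: AE_all_countable)
    then show ?thesis using s(2)
    proof eventually_elim
      case (elim x)
      have "(\<lambda>n. s n x * \<psi> i x) \<longlonglongrightarrow> ess_inf M S x * \<psi> i x" by (intro tendsto_intros elim)
      then show ?case by (rule LIMSEQ_le_const) (use elim in auto)
    qed
  qed
  ultimately show "ess_inf M S \<in> S" using nn by (simp add: S_def Lp_nonneg_def)
qed

section \<open>Derivations with divergence for a fixed exponent\<close>

locale sobolev_setting = ext_metric_top_measure_space d m
  for d :: "'a::t2_space \<Rightarrow> 'a \<Rightarrow> ennreal" and m :: "'a measure" +
  fixes p :: real
  assumes p: "1 < p"
begin

abbreviation q where "q \<equiv> conj_exp p"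

lemma p0: "0 < p" and q: "1 < q" and q0: "0 < q"
  using p conj_exp(1)[OF p] by auto

lemma deriv_norm_bound:
  assumes "b \<in> Der q d m"
  shows "deriv_norm q d m b \<in> deriv_bounds q d m b"
    and "g \<in> deriv_bounds q d m b \<Longrightarrow> AE x in m. deriv_norm q d m b x \<le> g x"
  using ess_inf_of_bounds[OF finite_measure_axioms q, of "Lipb d" "lip d" "\<lambda>f x. \<bar>b f x\<bar>"] assms
  by (auto simp: Der_def deriv_norm_def deriv_bounds_def lip_nonneg)

lemma divergence_unique:
  assumes D: "is_divergence d m b D" and D': "is_divergence d m b D'"
  shows "AE x in m. D x = D' x"
proof -
  have i: "integrable m D" "integrable m D'" using D D' by (auto simp: is_divergence_def)
  have "AE x in m. D x - D' x = 0"
  proof (rule AE_eq_zero_of_Lipb_test)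
    fix h assume h: "h \<in> Lipb d"
    have "(\<integral>x. h x * D x \<partial>m) = (\<integral>x. h x * D' x \<partial>m)" using D D' h unfolding is_divergence_def by (metis neg_equal_iff_equal)
    then show "(\<integral>x. h x * (D x - D' x) \<partial>m) = 0"
      using bdd_meas_integrable[OF Lipb_bdd_meas[OF h] i(1)] bdd_meas_integrable[OF Lipb_bdd_meas[OF h] i(2)]
      by (simp add: right_diff_distrib)
  qed (use i in auto)
  then show ?thesis by eventually_elim simp
qed

lemma is_divergence_divergence:
  "has_divergence d m b \<Longrightarrow> is_divergence d m b (divergence d m b)"
  unfolding has_divergence_def divergence_def by (blast intro: someI_ex[of "is_divergence d m b"])

lemma divergence_AE_eq:
  assumes "has_divergence d m b" "is_divergence d m b D"
  shows "AE x in m. divergence d m b x = D x"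
  using divergence_unique[OF is_divergence_divergence[OF assms(1)] assms(2)] .

text \<open>Divergences agree almost everywhere, so integrability of one divergence \<open>D\<close>
  passes to the chosen representative \<open>divergence d m b\<close>.\<close>

lemma Der_divI:
  assumes "lipschitz_derivation d m b" "\<beta> \<in> deriv_bounds q d m b"
    and int: "\<And>f. f \<in> Lipb d \<Longrightarrow> integrable m (b f)"
    and D: "is_divergence d m b D" "D \<in> Lp q m"
  shows "b \<in> Der_div q d m"
proof -
  have h: "has_divergence d m b" using int D by (auto simp: has_divergence_def)
  have "divergence d m b \<in> Lp q m"
  proof (rule Lp_bound[OF q0 D(2)])
    show "divergence d m b \<in> borel_measurable m"
      using is_divergence_divergence[OF h] by (auto simp: is_divergence_def)
    show "AE x in m. \<bar>divergence d m b x\<bar> \<le> \<bar>D x\<bar>"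
      using divergence_AE_eq[OF h D(1)] by eventually_elim simp
  qed
  then show ?thesis using h assms by (auto simp: Der_div_def Der_def)
qed

lemma Der_divD:
  assumes b: "b \<in> Der_div q d m"
  shows "lipschitz_derivation d m b" "\<And>f. f \<in> Lipb d \<Longrightarrow> integrable m (b f)"
    "\<And>f. f \<in> Lipb d \<Longrightarrow> (\<integral>x. b f x \<partial>m) = - (\<integral>x. f x * divergence d m b x \<partial>m)"
    "divergence d m b \<in> Lp q m" "is_divergence d m b (divergence d m b)"
    "deriv_norm q d m b \<in> Lp q m" "AE x in m. 0 \<le> deriv_norm q d m b x"
    "\<And>f. f \<in> Lipb d \<Longrightarrow> AE x in m. \<bar>b f x\<bar> \<le> deriv_norm q d m b x * lip d f x"
    "\<And>g. g \<in> deriv_bounds q d m b \<Longrightarrow> AE x in m. deriv_norm q d m b x \<le> g x"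
proof -
  have h: "has_divergence d m b" and bD: "b \<in> Der q d m" using b by (auto simp: Der_div_def)
  note D = is_divergence_divergence[OF h]
  show "lipschitz_derivation d m b" using bD by (simp add: Der_def)
  show "integrable m (b f)" if "f \<in> Lipb d" for f using h that by (simp add: has_divergence_def)
  show "(\<integral>x. b f x \<partial>m) = - (\<integral>x. f x * divergence d m b x \<partial>m)" if "f \<in> Lipb d" for f
    using D that by (simp add: is_divergence_def)
  show "divergence d m b \<in> Lp q m" using b by (simp add: Der_div_def)
  show "is_divergence d m b (divergence d m b)" by fact
  have n: "deriv_norm q d m b \<in> deriv_bounds q d m b" by (rule deriv_norm_bound[OF bD])
  show "deriv_norm q d m b \<in> Lp q m" "AE x in m. 0 \<le> deriv_norm q d m b x"
    "\<And>f. f \<in> Lipb d \<Longrightarrow> AE x in m. \<bar>b f x\<bar> \<le> deriv_norm q d m b x * lip d f x"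
    using n by (auto simp: deriv_bounds_def Lp_nonneg_def)
  show "\<And>g. g \<in> deriv_bounds q d m b \<Longrightarrow> AE x in m. deriv_norm q d m b x \<le> g x"
    by (rule deriv_norm_bound(2)[OF bD])
qed

lemma Der_div_apply_Lp:
  assumes b: "b \<in> Der_div q d m" and f: "f \<in> Lipb d"
  shows "b f \<in> Lp q m"
proof -
  obtain C where C: "C \<ge> 0" "\<And>x. lip d f x \<le> C" by (rule lip_bounded[OF f]) blast
  show ?thesis
  proof (rule Lp_bound[OF q0 Lp_scale[OF Der_divD(6)[OF b], of C]])
    show "b f \<in> borel_measurable m" using Der_divD(2)[OF b f] by auto
    show "AE x in m. \<bar>b f x\<bar> \<le> \<bar>C * deriv_norm q d m b x\<bar>"
      using Der_divD(8)[OF b f] Der_divD(7)[OF b]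
    proof eventually_elim
      case (elim x)
      have "deriv_norm q d m b x * lip d f x \<le> deriv_norm q d m b x * C"
        by (rule mult_left_mono[OF C(2) elim(2)])
      then show ?case using elim C by (simp add: mult.commute)
    qed
  qed
qed

text \<open>Integrating the Leibniz rule for \<open>b (h f)\<close> moves the derivation from
  \<open>f\<close> to \<open>h\<close>. The right side pairs \<open>f\<close> with an
  \<open>L^q\<close> function and is thus continuous under \<open>L^p\<close> convergence of
  \<open>f\<close>, which the left side does not show.\<close>

lemma Der_div_leibniz_integral:
  assumes b: "b \<in> Der_div q d m" and f: "f \<in> Lipb d" and h: "h \<in> Lipb d"
  shows "(\<integral>x. h x * b f x \<partial>m) = - (\<integral>x. f x * (h x * divergence d m b x + b h x) \<partial>m)"
proof -
  note D = Der_divD[OF b]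
  have iD: "integrable m (divergence d m b)" using D(5) by (simp add: is_divergence_def)
  note hf = Lipb_mult[OF h f]
  note I = bdd_meas_integrable[OF Lipb_bdd_meas[OF h] D(2)[OF f]] bdd_meas_integrable[OF Lipb_bdd_meas[OF f] D(2)[OF h]]
    bdd_meas_integrable[OF Lipb_bdd_meas[OF hf] iD]
  have "AE x in m. b (\<lambda>y. h y * f y) x = h x * b f x + f x * b h x"
    using D(1) f h by (simp add: lipschitz_derivation_def)
  then have "(\<integral>x. b (\<lambda>y. h y * f y) x \<partial>m) = (\<integral>x. h x * b f x + f x * b h x \<partial>m)"
    using D(2)[OF hf] I by (intro integral_cong_AE) auto
  then have "(\<integral>x. h x * b f x \<partial>m) + (\<integral>x. f x * b h x \<partial>m) = - (\<integral>x. (h x * f x) * divergence d m b x \<partial>m)"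
    using D(3)[OF hf] I by simp
  moreover have "(\<integral>x. f x * (h x * divergence d m b x + b h x) \<partial>m)
      = (\<integral>x. (h x * f x) * divergence d m b x \<partial>m) + (\<integral>x. f x * b h x \<partial>m)"
    using I by (simp add: algebra_simps)
  ultimately show ?thesis by simp
qed

text \<open>The integrated Leibniz rule, read as an identity in \<open>f\<close>, exhibits the
  divergence of \<open>h b\<close>. It lies in \<open>L^q\<close> because \<open>h\<close> and
  \<open>lip d h\<close> are bounded.\<close>

lemma Der_div_mult:
  assumes b: "b \<in> Der_div q d m" and h: "h \<in> Lipb d"
  defines "hb \<equiv> (\<lambda>g y. h y * b g y)"
  shows "hb \<in> Der_div q d m"
    and "AE x in m. divergence d m hb x = h x * divergence d m b x + b h x"
proof -
  note D = Der_divD[OF b]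
  have iD: "integrable m (divergence d m b)" using D(5) by (simp add: is_divergence_def)
  obtain c C where C: "C \<ge> 0" "\<And>x. \<bar>h x\<bar> \<le> C" by (rule LipbE[OF h]) blast
  have [measurable]: "h \<in> borel_measurable m" by (rule Lipb_measurable[OF h])
  have der: "lipschitz_derivation d m hb"
    unfolding lipschitz_derivation_def
  proof (intro conjI ballI allI)
    fix f assume f: "f \<in> Lipb d"
    show "hb f \<in> borel_measurable m" unfolding hb_def using D(2)[OF f] by measurable
    fix g assume g: "g \<in> Lipb d"
    show "AE x in m. hb (\<lambda>y. f y * g y) x = f x * hb g x + g x * hb f x"
    proof -
      have "AE x in m. b (\<lambda>y. f y * g y) x = f x * b g x + g x * b f x"
        using D(1) f g by (simp add: lipschitz_derivation_def)
      then show ?thesis by eventually_elim (simp add: hb_def algebra_simps)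
    qed
    fix \<alpha> \<beta>
    have "AE x in m. b (\<lambda>y. \<alpha> * f y + \<beta> * g y) x = \<alpha> * b f x + \<beta> * b g x"
      using D(1) f g by (simp add: lipschitz_derivation_def)
    then show "AE x in m. hb (\<lambda>y. \<alpha> * f y + \<beta> * g y) x = \<alpha> * hb f x + \<beta> * hb g x"
      by eventually_elim (simp add: hb_def algebra_simps)
  qed
  have bnd: "(\<lambda>x. C * deriv_norm q d m b x) \<in> deriv_bounds q d m hb"
    unfolding deriv_bounds_def Lp_nonneg_def
  proof (intro CollectI conjI ballI)
    show "(\<lambda>x. C * deriv_norm q d m b x) \<in> Lp q m" by (rule Lp_scale[OF D(6)])
    show "AE x in m. 0 \<le> C * deriv_norm q d m b x" using D(7) by eventually_elim (simp add: C)
    fix f assume f: "f \<in> Lipb d"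
    show "AE x in m. \<bar>hb f x\<bar> \<le> C * deriv_norm q d m b x * lip d f x"
      using D(8)[OF f] by eventually_elim (simp add: hb_def abs_mult mult.assoc mult_mono C)
  qed
  have int: "integrable m (hb f)" if "f \<in> Lipb d" for f
    unfolding hb_def by (rule bdd_meas_integrable[OF Lipb_bdd_meas[OF h] D(2)[OF that]])
  have div: "is_divergence d m hb (\<lambda>x. h x * divergence d m b x + b h x)"
    unfolding is_divergence_def hb_def
    using Der_div_leibniz_integral[OF b _ h] bdd_meas_integrable[OF Lipb_bdd_meas[OF h] iD] D(2)[OF h] by simp
  have divLq: "(\<lambda>x. h x * divergence d m b x + b h x) \<in> Lp q m"
    by (rule Lp_add[OF q0 Lp_mult_bounded[OF q0 D(4) _ C(2)] Der_div_apply_Lp[OF b h]]) simp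
  show hb: "hb \<in> Der_div q d m" by (rule Der_divI[OF der bnd int div divLq])
  show "AE x in m. divergence d m hb x = h x * divergence d m b x + b h x"
    using hb div by (intro divergence_AE_eq) (auto simp: Der_div_def)
qed

lemma Lp_tendsto_D:
  assumes "Lp_tendsto r m s f"
  shows "s n \<in> Lp r m" "f \<in> Lp r m" "(\<lambda>n. Lp_norm r m (\<lambda>x. s n x - f x)) \<longlonglongrightarrow> 0"
  using assms by (auto simp: Lp_tendsto_def)

lemma Lipb_Lp: "f \<in> Lipb d \<Longrightarrow> f \<in> Lp p m"
  by (rule bdd_meas_Lp[OF Lipb_bdd_meas p0])

lemma lip_Lp: "f \<in> Lipb d \<Longrightarrow> lip d f \<in> Lp p m"
  by (rule bdd_meas_Lp[OF lip_bdd_meas p0])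

lemma Der_div_tested_convergence:
  assumes b: "b \<in> Der_div q d m" and h: "h \<in> Lipb d" and u: "\<And>n. u n \<in> Lipb d" and uf: "Lp_tendsto p m u f"
  shows "(\<lambda>n. \<integral>x. h x * b (u n) x \<partial>m) \<longlonglongrightarrow> - (\<integral>x. f x * (h x * divergence d m b x + b h x) \<partial>m)"
proof -
  obtain c C where C: "C \<ge> 0" "\<And>x. \<bar>h x\<bar> \<le> C" by (rule LipbE[OF h]) blast
  have "(\<lambda>x. h x * divergence d m b x + b h x) \<in> Lp q m"
    by (rule Lp_add[OF q0 Lp_mult_bounded[OF q0 Der_divD(4)[OF b] Lipb_measurable[OF h] C(2)] Der_div_apply_Lp[OF b h]])
  then show ?thesis
    unfolding Der_div_leibniz_integral[OF b u h] by (intro tendsto_minus Lp_tendsto_integral[OF p uf])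
qed

section \<open>Relaxed slopes give weak differentials\<close>

text \<open>The differential \<open>L b\<close> is the weak \<open>L\<^sup>1\<close> limit of \<open>b (u n)\<close>.\<close>

lemma weak_diff_exists:
  assumes u: "\<And>n. u n \<in> Lipb d" and uf: "Lp_tendsto p m u f"
    and uG: "Lp_tendsto p m (\<lambda>n. lip d (u n)) G" and G0: "AE x in m. 0 \<le> G x"
  shows "\<exists>L. is_weak_diff p d m f L"
proof -
  \<comment> \<open>\<open>P b l\<close> states that \<open>l\<close> is the weak limit of
    \<open>b (u n)\<close> against bounded functions. This fixes \<open>l\<close> a.e., so linearity
    and homogeneity of the chosen \<open>L\<close> reduce to exhibiting the expected limits.\<close>
  define P where "P = (\<lambda>b l. integrable m l \<and>
      (\<forall>\<phi>\<in>bdd_meas m. (\<lambda>n. \<integral>x. \<phi> x * b (u n) x \<partial>m) \<longlonglongrightarrow> (\<integral>x. \<phi> x * l x \<partial>m)))"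
  define L where "L = (\<lambda>b. SOME l. P b l)"
  have G: "G \<in> Lp p m" using Lp_tendsto_D(2)[OF uG] .
  have uniq: "AE x in m. l x = l' x" if "P b l" "P b l'" for b l l'
  proof -
    have i: "integrable m l" "integrable m l'" using that by (auto simp: P_def)
    have "AE x in m. l x - l' x = 0"
    proof (rule AE_eq_zero_of_Lipb_test)
      fix h assume h: "h \<in> Lipb d"
      note hb = Lipb_bdd_meas[OF h]
      have "(\<integral>x. h x * l x \<partial>m) = (\<integral>x. h x * l' x \<partial>m)"
        using that hb unfolding P_def by (meson LIMSEQ_unique)
      then show "(\<integral>x. h x * (l x - l' x) \<partial>m) = 0"
        using bdd_meas_integrable[OF hb i(1)] bdd_meas_integrable[OF hb i(2)] by (simp add: right_diff_distrib)
    qed (use i in auto)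
    then show ?thesis by eventually_elim simp
  qed
  have ex: "\<exists>l. P b l \<and> (AE x in m. \<bar>l x\<bar> \<le> G x * deriv_norm q d m b x)" if b: "b \<in> Der_div q d m" for b
  proof -
    note D = Der_divD[OF b]
    define T where "T = (\<lambda>n \<phi>. \<integral>x. \<phi> x * b (u n) x \<partial>m)"
    define \<rho> where "\<rho> = (\<lambda>n x. lip d (u n) x * deriv_norm q d m b x)"
    have \<rho>: "integrable m (\<rho> n)" for n unfolding \<rho>_def by (rule Lp_holder(1)[OF p lip_Lp[OF u] D(6)])
    have \<rho>': "integrable m (\<lambda>x. G x * deriv_norm q d m b x)" by (rule Lp_holder(1)[OF p G D(6)])
    obtain l where l: "integrable m l" "AE x in m. \<bar>l x\<bar> \<le> G x * deriv_norm q d m b x"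
      "\<And>\<phi>. \<phi> \<in> bdd_meas m \<Longrightarrow> (\<lambda>n. T n \<phi>) \<longlonglongrightarrow> (\<integral>x. \<phi> x * l x \<partial>m)"
    proof (rule dominated_functionals_limit[where T = T and \<rho> = \<rho>, OF _ _ \<rho> \<rho>'])
      fix n \<phi> assume \<phi>: "\<phi> \<in> bdd_meas m"
      note i = bdd_meas_integrable[OF \<phi> D(2)[OF u]]
      show "\<bar>T n \<phi>\<bar> \<le> (\<integral>x. \<bar>\<phi> x\<bar> * \<rho> n x \<partial>m)"
      proof -
        have "\<bar>T n \<phi>\<bar> \<le> (\<integral>x. \<bar>\<phi> x * b (u n) x\<bar> \<partial>m)" unfolding T_def by (rule integral_abs_bound)
        also have "\<dots> \<le> (\<integral>x. \<bar>\<phi> x\<bar> * \<rho> n x \<partial>m)"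
        proof (rule integral_mono_AE)
          show "AE x in m. \<bar>\<phi> x * b (u n) x\<bar> \<le> \<bar>\<phi> x\<bar> * \<rho> n x"
            using D(8)[OF u[of n]] by eventually_elim (simp add: abs_mult \<rho>_def mult_left_mono mult.commute)
          show "integrable m (\<lambda>x. \<bar>\<phi> x\<bar> * \<rho> n x)" by (rule bdd_meas_integrable[OF bdd_meas_abs[OF \<phi>] \<rho>])
        qed (use i in auto)
        finally show ?thesis .
      qed
      fix \<psi> \<alpha> \<beta> assume \<psi>: "\<psi> \<in> bdd_meas m"
      show "T n (\<lambda>x. \<alpha> * \<phi> x + \<beta> * \<psi> x) = \<alpha> * T n \<phi> + \<beta> * T n \<psi>"
        using i[of n] bdd_meas_integrable[OF \<psi> D(2)[OF u[of n]]] by (simp add: T_def distrib_right mult.assoc)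
    next
      show "(\<lambda>n. \<integral>x. \<bar>\<rho> n x - G x * deriv_norm q d m b x\<bar> \<partial>m) \<longlonglongrightarrow> 0"
      proof (rule tendsto_sandwich[OF always_eventually always_eventually tendsto_const])
        show "\<forall>n. 0 \<le> (\<integral>x. \<bar>\<rho> n x - G x * deriv_norm q d m b x\<bar> \<partial>m)" by (simp add: integral_nonneg_AE)
        show "\<forall>n. (\<integral>x. \<bar>\<rho> n x - G x * deriv_norm q d m b x\<bar> \<partial>m)
            \<le> Lp_norm p m (\<lambda>x. lip d (u n) x - G x) * Lp_norm q m (deriv_norm q d m b)"
          using Lp_holder(2)[OF p Lp_diff[OF p0 lip_Lp[OF u] G] D(6)] by (simp add: \<rho>_def left_diff_distrib)
        show "(\<lambda>n. Lp_norm p m (\<lambda>x. lip d (u n) x - G x) * Lp_norm q m (deriv_norm q d m b)) \<longlonglongrightarrow> 0"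
          by (rule tendsto_mult_left_zero[OF Lp_tendsto_D(3)[OF uG]])
      qed
      show "convergent (\<lambda>n. T n h)" if "h \<in> Lipb d" for h
        unfolding T_def using Der_div_tested_convergence[OF b that u uf] by (rule convergentI)
    qed blast
    then show ?thesis unfolding P_def T_def by blast
  qed
  have PL: "P b (L b)" if "b \<in> Der_div q d m" for b
    unfolding L_def using ex[OF that] by (blast intro: someI_ex[of "P b"])
  have LG: "AE x in m. \<bar>L b x\<bar> \<le> G x * deriv_norm q d m b x" if b: "b \<in> Der_div q d m" for b
  proof -
    obtain l where l: "P b l" "AE x in m. \<bar>l x\<bar> \<le> G x * deriv_norm q d m b x" using ex[OF b] by blast
    show ?thesis using uniq[OF PL[OF b] l(1)] l(2) by eventually_elim simp
  qed
  \<comment> \<open>Any witness of \<open>P b\<close> determines the choice \<open>L b\<close>. For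
    sums and multiples of derivations the corresponding combination of limits is such a
    witness.\<close>
  have eqL: "AE x in m. L b x = l x" if "P b l" for b l
    using uniq[OF _ that] someI[of "P b", OF that] by (simp add: L_def)
  have "is_weak_diff p d m f L"
    unfolding is_weak_diff_def
  proof (intro conjI ballI allI)
    fix b assume b: "b \<in> Der_div q d m"
    note D = Der_divD[OF b] and PLb = PL[OF b]
    show iL: "integrable m (L b)" using PLb by (simp add: P_def)
    have "(\<lambda>n. \<integral>x. b (u n) x \<partial>m) \<longlonglongrightarrow> (\<integral>x. L b x \<partial>m)"
      using bspec[OF conjunct2[OF PLb[unfolded P_def]] bdd_meas_const[of 1]] by simp
    moreover have "(\<lambda>n. \<integral>x. b (u n) x \<partial>m) \<longlonglongrightarrow> - (\<integral>x. f x * divergence d m b x \<partial>m)"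
      unfolding D(3)[OF u] by (intro tendsto_minus Lp_tendsto_integral[OF p uf D(4)])
    ultimately show "(\<integral>x. L b x \<partial>m) = - (\<integral>x. f x * divergence d m b x \<partial>m)"
      using LIMSEQ_unique by fastforce
    show "AE x in m. L (\<lambda>g y. \<alpha> * b g y + \<beta> * b' g y) x = \<alpha> * L b x + \<beta> * L b' x"
      if b': "b' \<in> Der_div q d m" for b' \<alpha> \<beta>
    proof (rule eqL)
      note D' = Der_divD[OF b'] and PLb' = PL[OF b']
      show "P (\<lambda>g y. \<alpha> * b g y + \<beta> * b' g y) (\<lambda>x. \<alpha> * L b x + \<beta> * L b' x)"
        unfolding P_def
      proof (intro conjI ballI)
        have iL': "integrable m (L b')" using PLb' by (simp add: P_def)
        show "integrable m (\<lambda>x. \<alpha> * L b x + \<beta> * L b' x)" using iL iL' by simp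
        fix \<phi> assume \<phi>: "\<phi> \<in> bdd_meas m"
        have e1: "(\<integral>x. \<phi> x * (\<alpha> * b (u n) x + \<beta> * b' (u n) x) \<partial>m)
            = \<alpha> * (\<integral>x. \<phi> x * b (u n) x \<partial>m) + \<beta> * (\<integral>x. \<phi> x * b' (u n) x \<partial>m)" for n
          using bdd_meas_integrable[OF \<phi> D(2)[OF u[of n]]] bdd_meas_integrable[OF \<phi> D'(2)[OF u[of n]]]
          by (simp add: distrib_left mult.left_commute[of _ \<alpha>] mult.left_commute[of _ \<beta>])
        have e2: "(\<integral>x. \<phi> x * (\<alpha> * L b x + \<beta> * L b' x) \<partial>m)
            = \<alpha> * (\<integral>x. \<phi> x * L b x \<partial>m) + \<beta> * (\<integral>x. \<phi> x * L b' x \<partial>m)"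
          using bdd_meas_integrable[OF \<phi> iL] bdd_meas_integrable[OF \<phi> iL']
          by (simp add: distrib_left mult.left_commute[of _ \<alpha>] mult.left_commute[of _ \<beta>])
        show "(\<lambda>n. \<integral>x. \<phi> x * (\<alpha> * b (u n) x + \<beta> * b' (u n) x) \<partial>m) \<longlonglongrightarrow> (\<integral>x. \<phi> x * (\<alpha> * L b x + \<beta> * L b' x) \<partial>m)"
          unfolding e1 e2 using PLb PLb' \<phi> by (intro tendsto_intros) (auto simp: P_def)
      qed
    qed
    show "AE x in m. L (\<lambda>g y. h y * b g y) x = h x * L b x" if h: "h \<in> Lipb d" for h
    proof (rule eqL)
      note hb = Lipb_bdd_meas[OF h]
      show "P (\<lambda>g y. h y * b g y) (\<lambda>x. h x * L b x)"
        unfolding P_def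
      proof (intro conjI ballI)
        show "integrable m (\<lambda>x. h x * L b x)" by (rule bdd_meas_integrable[OF hb iL])
        fix \<phi> assume \<phi>: "\<phi> \<in> bdd_meas m"
        have "(\<lambda>n. \<integral>x. (\<phi> x * h x) * b (u n) x \<partial>m) \<longlonglongrightarrow> (\<integral>x. (\<phi> x * h x) * L b x \<partial>m)"
          by (rule bspec[OF conjunct2[OF PLb[unfolded P_def]] bdd_meas_mult[OF \<phi> hb]])
        then show "(\<lambda>n. \<integral>x. \<phi> x * (h x * b (u n) x) \<partial>m) \<longlonglongrightarrow> (\<integral>x. \<phi> x * (h x * L b x) \<partial>m)"
          by (simp add: mult.assoc)
      qed
    qed
  next
    have "G \<in> slope_bounds p d m L"
      using G G0 LG by (simp add: slope_bounds_def Lp_nonneg_def)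
    then show "slope_bounds p d m L \<noteq> {}" by blast
  qed
  then show ?thesis by blast
qed

text \<open>Weak convergence of \<open>lip d (u n)\<close>, tested against \<open>h |b|\<close> in
  \<open>L^q\<close>, passes to the limit in
  \<open>|\<integral> h b (u n)| \<le> \<integral> h |b| lip (u n)\<close>. Varying \<open>h\<close>
  in \<open>[0, 1]\<close> turns the limiting inequality into a pointwise one.\<close>

lemma relaxed_slope_bounds_weak_diff:
  assumes L: "is_weak_diff p d m f L" and G: "relaxed_slope p d m f G"
  obtains G' where "G' \<in> slope_bounds p d m L" "AE x in m. G' x \<le> G x"
proof -
  obtain u G' where G': "G' \<in> Lp_nonneg p m" and u: "\<And>n. u n \<in> Lipb d" and uf: "Lp_tendsto p m u f"
    and w: "Lp_weak_tendsto p m (\<lambda>n. lip d (u n)) G'" and le: "AE x in m. G' x \<le> G x"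
    using G by (auto simp: relaxed_slope_def)
  have "AE x in m. \<bar>L b x\<bar> \<le> G' x * deriv_norm q d m b x" if b: "b \<in> Der_div q d m" for b
  proof -
    note D = Der_divD[OF b]
    have iL: "integrable m (L b)" using L b by (simp add: is_weak_diff_def)
    define \<rho> where "\<rho> = (\<lambda>x. G' x * deriv_norm q d m b x)"
    have i\<rho>: "integrable m \<rho>" unfolding \<rho>_def by (rule Lp_holder(1)[OF p Lp_nonneg_Lp[OF G'] D(6)])
    have bound: "\<bar>\<integral>x. h x * L b x \<partial>m\<bar> \<le> (\<integral>x. h x * \<rho> x \<partial>m)" if h: "h \<in> Lipb d" "\<And>x. 0 \<le> h x \<and> h x \<le> 1" for h
    proof -
      note hb = Lipb_bdd_meas[OF h(1)] and DM = Der_div_mult[OF b h(1)]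
      note DM1 = Der_divD[OF DM(1)]
      have f: "f \<in> Lp p m" by (rule Lp_tendsto_D(2)[OF uf])
      \<comment> \<open>By homogeneity \<open>h L b\<close> is \<open>L (h b)\<close>, whose
        integral is given by the divergence of \<open>h b\<close>. This is the same expression to
        which the integrals of \<open>h b (u n)\<close> converge.\<close>
      have "(\<integral>x. h x * L b x \<partial>m) = (\<integral>x. L (\<lambda>g y. h y * b g y) x \<partial>m)"
      proof (rule integral_cong_AE)
        show "AE x in m. h x * L b x = L (\<lambda>g y. h y * b g y) x"
        proof -
          have "AE x in m. L (\<lambda>g y. h y * b g y) x = h x * L b x" using L h(1) b by (simp add: is_weak_diff_def)
          then show ?thesis by eventually_elim simp
        qed
        show "(\<lambda>x. h x * L b x) \<in> borel_measurable m" using bdd_meas_integrable[OF hb iL] by auto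
        show "L (\<lambda>g y. h y * b g y) \<in> borel_measurable m" using L DM(1) by (auto simp: is_weak_diff_def)
      qed
      also have "\<dots> = - (\<integral>x. f x * divergence d m (\<lambda>g y. h y * b g y) x \<partial>m)"
        using L DM(1) by (simp add: is_weak_diff_def)
      also have "(\<integral>x. f x * divergence d m (\<lambda>g y. h y * b g y) x \<partial>m)
          = (\<integral>x. f x * (h x * divergence d m b x + b h x) \<partial>m)"
      proof (rule integral_cong_AE)
        show "AE x in m. f x * divergence d m (\<lambda>g y. h y * b g y) x = f x * (h x * divergence d m b x + b h x)"
          using DM(2) by eventually_elim simp
        have [measurable]: "f \<in> borel_measurable m" "h \<in> borel_measurable m" "divergence d m b \<in> borel_measurable m"
          "divergence d m (\<lambda>g y. h y * b g y) \<in> borel_measurable m" "b h \<in> borel_measurable m"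
          using f Lipb_measurable[OF h(1)] D(4) DM1(4) D(2)[OF h(1)] by (auto simp: Lp_def)
        show "(\<lambda>x. f x * divergence d m (\<lambda>g y. h y * b g y) x) \<in> borel_measurable m" by measurable
        show "(\<lambda>x. f x * (h x * divergence d m b x + b h x)) \<in> borel_measurable m" by measurable
      qed
      finally have eq: "(\<integral>x. h x * L b x \<partial>m) = - (\<integral>x. f x * (h x * divergence d m b x + b h x) \<partial>m)" .
      have lim: "(\<lambda>n. \<bar>\<integral>x. h x * b (u n) x \<partial>m\<bar>) \<longlonglongrightarrow> \<bar>\<integral>x. h x * L b x \<partial>m\<bar>"
        unfolding eq by (intro tendsto_rabs Der_div_tested_convergence[OF b h(1) u uf])
      have kq: "(\<lambda>x. h x * deriv_norm q d m b x) \<in> Lp q m"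
        by (rule Lp_mult_bounded[OF q0 D(6) Lipb_measurable[OF h(1)], of 1]) (use h(2) in auto)
      have "(\<lambda>n. \<integral>x. lip d (u n) x * (h x * deriv_norm q d m b x) \<partial>m)
          \<longlonglongrightarrow> (\<integral>x. G' x * (h x * deriv_norm q d m b x) \<partial>m)"
        using w Lp_functional_integral[OF p kq] unfolding Lp_weak_tendsto_def by blast
      then have lim2: "(\<lambda>n. \<integral>x. lip d (u n) x * (h x * deriv_norm q d m b x) \<partial>m) \<longlonglongrightarrow> (\<integral>x. h x * \<rho> x \<partial>m)"
        by (simp add: \<rho>_def mult.left_commute)
      have "\<bar>\<integral>x. h x * b (u n) x \<partial>m\<bar> \<le> (\<integral>x. lip d (u n) x * (h x * deriv_norm q d m b x) \<partial>m)" for n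
      proof -
        have "\<bar>\<integral>x. h x * b (u n) x \<partial>m\<bar> \<le> (\<integral>x. \<bar>h x * b (u n) x\<bar> \<partial>m)" by (rule integral_abs_bound)
        also have "\<dots> \<le> (\<integral>x. lip d (u n) x * (h x * deriv_norm q d m b x) \<partial>m)"
        proof (rule integral_mono_AE)
          show "integrable m (\<lambda>x. \<bar>h x * b (u n) x\<bar>)" using bdd_meas_integrable[OF hb D(2)[OF u[of n]]] by simp
          show "integrable m (\<lambda>x. lip d (u n) x * (h x * deriv_norm q d m b x))" by (rule Lp_holder(1)[OF p lip_Lp[OF u] kq])
          show "AE x in m. \<bar>h x * b (u n) x\<bar> \<le> lip d (u n) x * (h x * deriv_norm q d m b x)"
            using D(8)[OF u[of n]]
          proof eventually_elim
            case (elim x)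
            have "h x * \<bar>b (u n) x\<bar> \<le> h x * (deriv_norm q d m b x * lip d (u n) x)"
              using h(2)[of x] by (intro mult_left_mono elim) auto
            then show ?case using h(2)[of x] by (simp add: abs_mult ac_simps)
          qed
        qed
        finally show ?thesis .
      qed
      then show ?thesis using LIMSEQ_le[OF lim lim2] by blast
    qed
    have "AE x in m. L b x - \<rho> x \<le> 0"
    proof (rule AE_le_zero_of_Lipb_test)
      fix h assume h: "h \<in> Lipb d" "\<And>x. 0 \<le> h x \<and> h x \<le> 1"
      show "(\<integral>x. h x * (L b x - \<rho> x) \<partial>m) \<le> 0"
        using bound[OF h] bdd_meas_integrable[OF Lipb_bdd_meas[OF h(1)] iL] bdd_meas_integrable[OF Lipb_bdd_meas[OF h(1)] i\<rho>]
        by (simp add: right_diff_distrib)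
    qed (use iL i\<rho> in auto)
    moreover have "AE x in m. - L b x - \<rho> x \<le> 0"
    proof (rule AE_le_zero_of_Lipb_test)
      fix h assume h: "h \<in> Lipb d" "\<And>x. 0 \<le> h x \<and> h x \<le> 1"
      show "(\<integral>x. h x * (- L b x - \<rho> x) \<partial>m) \<le> 0"
        using bound[OF h] bdd_meas_integrable[OF Lipb_bdd_meas[OF h(1)] iL] bdd_meas_integrable[OF Lipb_bdd_meas[OF h(1)] i\<rho>]
        by (simp add: right_diff_distrib)
    qed (use iL i\<rho> in auto)
    ultimately show ?thesis unfolding \<rho>_def by eventually_elim auto
  qed
  then have "G' \<in> slope_bounds p d m L" using G' by (simp add: slope_bounds_def)
  then show ?thesis using that le by blast
qed

section \<open>Penalized minimization\<close>

text \<open>Value and slope are added pointwise, so that this is the norm function of the jet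
  \<open>f (fst i) - u (snd i)\<close>.\<close>

definition penalty :: "('a \<Rightarrow> real) \<Rightarrow> real \<Rightarrow> ('a \<Rightarrow> real) \<Rightarrow> 'a \<Rightarrow> real" where
  "penalty f l u = (\<lambda>x. l * \<bar>u x - f x\<bar> + lip d u x)"

lemma penalty_Lp: "f \<in> Lp p m \<Longrightarrow> u \<in> Lipb d \<Longrightarrow> penalty f l u \<in> Lp p m"
  unfolding penalty_def by (rule Lp_add[OF p0 Lp_scale[OF Lp_abs[OF Lp_diff[OF p0 Lipb_Lp]]] lip_Lp])

lemma penalty_nonneg: "0 \<le> l \<Longrightarrow> 0 \<le> penalty f l u x"
  by (simp add: penalty_def lip_nonneg)

lemma penalty_mono: "l \<le> l' \<Longrightarrow> penalty f l u x \<le> penalty f l' u x"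
  by (simp add: penalty_def mult_right_mono)

lemma penalty_midpoint:
  assumes u: "u \<in> Lipb d" and v: "v \<in> Lipb d" and l: "0 \<le> l"
  shows "penalty f l (\<lambda>x. 1/2 * u x + 1/2 * v x) x \<le> (penalty f l u x + penalty f l v x) / 2"
proof -
  have 1: "lip d (\<lambda>x. 1/2 * u x + 1/2 * v x) x \<le> (lip d u x + lip d v x) / 2"
    using lip_lincomb[OF u v, of "1/2" "1/2" x] by simp
  have "\<bar>1/2 * u x + 1/2 * v x - f x\<bar> \<le> (\<bar>u x - f x\<bar> + \<bar>v x - f x\<bar>) / 2"
    by (simp add: abs_if field_simps)
  then have 2: "l * \<bar>1/2 * u x + 1/2 * v x - f x\<bar> \<le> l * ((\<bar>u x - f x\<bar> + \<bar>v x - f x\<bar>) / 2)"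
    using l by (rule mult_left_mono)
  show ?thesis
    unfolding penalty_def using add_mono[OF 2 1] by (simp add: add_divide_distrib distrib_left)
qed

text \<open>
  Minimizers for a quadratically growing penalty form a minimizing sequence for every fixed penalty,
  while the penalty term with the linear weight \<open>n + 1\<close> tends to zero.
\<close>

lemma penalized_sequence_converges:
  assumes f: "f \<in> Lp p m"
    and R: "\<forall>l\<ge>0. \<forall>e>0. \<exists>u\<in>Lipb d. Lp_norm p m (penalty f l u) \<le> R + e"
  obtains u G where "\<forall>n. u n \<in> Lipb d" "Lp_tendsto p m u f" "G \<in> Lp_nonneg p m"
    "Lp_tendsto p m (\<lambda>n. lip d (u n)) G" "Lp_norm p m G \<le> R"
proof -
  \<comment> \<open>The minimal penalized norm \<delta> increases with the weight and is bounded by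
    \<open>R\<close>; its limit \<open>s\<close> is the value that makes the sequence below
    minimizing in the sense of \<open>Lp_minimizing_sequence_converges\<close>, with
    \<open>I = s powr p\<close>.\<close>
  define \<delta> where "\<delta> = (\<lambda>l. INF u\<in>Lipb d. Lp_norm p m (penalty f l u))"
  have ne: "Lipb d \<noteq> {}" using Lipb_const by blast
  have bdd: "bdd_below ((\<lambda>u. Lp_norm p m (penalty f l u)) ` Lipb d)" for l
    by (intro bdd_belowI[of _ 0]) (auto simp: Lp_norm_nonneg)
  have \<delta>_le: "\<delta> l \<le> Lp_norm p m (penalty f l u)" if "u \<in> Lipb d" for l u
    unfolding \<delta>_def by (rule cINF_lower[OF bdd that])
  have \<delta>0: "0 \<le> \<delta> l" for l unfolding \<delta>_def by (rule cINF_greatest[OF ne]) (rule Lp_norm_nonneg)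
  have \<delta>R: "\<delta> l \<le> R" if l: "0 \<le> l" for l
  proof (rule field_le_epsilon)
    fix e :: real assume "0 < e"
    then obtain u where "u \<in> Lipb d" "Lp_norm p m (penalty f l u) \<le> R + e" using R l by blast
    then show "\<delta> l \<le> R + e" using \<delta>_le[of u l] by linarith
  qed
  have \<delta>_mono: "\<delta> l \<le> \<delta> l'" if "0 \<le> l" "l \<le> l'" for l l'
  proof -
    have "\<delta> l \<le> Lp_norm p m (penalty f l' u)" if u: "u \<in> Lipb d" for u
    proof -
      have "Lp_norm p m (penalty f l u) \<le> Lp_norm p m (penalty f l' u)"
      proof (rule Lp_norm_mono[OF p0 penalty_Lp[OF f u]])
        show "penalty f l u \<in> borel_measurable m" by (rule Lp_measurable[OF penalty_Lp[OF f u]])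
        show "AE x in m. \<bar>penalty f l u x\<bar> \<le> \<bar>penalty f l' u x\<bar>"
          using penalty_nonneg[of l f u] penalty_mono[OF \<open>l \<le> l'\<close>, of f u] \<open>0 \<le> l\<close>
          by (intro AE_I2) (metis abs_of_nonneg order_trans)
      qed
      then show ?thesis using \<delta>_le[OF u, of l] by linarith
    qed
    then have "\<delta> l \<le> (INF u\<in>Lipb d. Lp_norm p m (penalty f l' u))" by (rule cINF_greatest[OF ne])
    then show ?thesis unfolding \<delta>_def .
  qed
  define s where "s = (SUP n::nat. \<delta> (real n))"
  have bdda: "bdd_above (range (\<lambda>n::nat. \<delta> (real n)))" using \<delta>R by (intro bdd_aboveI[of _ R]) auto
  have \<delta>s: "\<delta> (real n) \<le> s" for n unfolding s_def by (rule cSUP_upper[OF _ bdda]) simp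
  have sR: "s \<le> R" unfolding s_def by (rule cSUP_least) (use \<delta>R in auto)
  have s0: "0 \<le> s" using \<delta>0[of "real 0"] \<delta>s[of 0] by linarith
  have \<delta>lim: "(\<lambda>n. \<delta> (real n)) \<longlonglongrightarrow> s"
    unfolding s_def by (rule LIMSEQ_incseq_SUP[OF bdda]) (auto simp: incseq_def intro: \<delta>_mono)
  have "\<exists>u\<in>Lipb d. Lp_norm p m (penalty f (real ((Suc n)\<^sup>2)) u) < s + 1 / real (Suc n)" for n
  proof -
    have "\<delta> (real ((Suc n)\<^sup>2)) < s + 1 / real (Suc n)"
      by (rule le_less_trans[OF \<delta>s]) simp
    then show ?thesis unfolding \<delta>_def using cINF_less_iff[OF ne bdd] by blast
  qed
  then obtain u where u: "\<And>n. u n \<in> Lipb d"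
    "\<And>n. Lp_norm p m (penalty f (real ((Suc n)\<^sup>2)) (u n)) < s + 1 / real (Suc n)" by metis
  define a where "a = (\<lambda>n. penalty f (real (Suc n)) (u n))"
  have aLp: "a n \<in> Lp p m" for n unfolding a_def by (rule penalty_Lp[OF f u(1)])
  have a0: "0 \<le> a n x" for n x unfolding a_def by (rule penalty_nonneg) simp
  have an: "Lp_norm p m (a n) \<le> s + 1 / real (Suc n)" for n
  proof -
    have "Lp_norm p m (a n) \<le> Lp_norm p m (penalty f (real ((Suc n)\<^sup>2)) (u n))"
    proof (rule Lp_norm_mono[OF p0 penalty_Lp[OF f u(1)] Lp_measurable[OF aLp]], rule AE_I2)
      fix x
      have "a n x \<le> penalty f (real ((Suc n)\<^sup>2)) (u n) x"
        unfolding a_def by (rule penalty_mono) (simp add: power2_eq_square del: of_nat_Suc)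
      then show "\<bar>a n x\<bar> \<le> \<bar>penalty f (real ((Suc n)\<^sup>2)) (u n) x\<bar>" using a0[of n x] by simp
    qed
    then show ?thesis using u(2)[of n] by linarith
  qed
  have s1lim: "(\<lambda>n. s + 1 / real (Suc n)) \<longlonglongrightarrow> s"
    using tendsto_add[OF tendsto_const[of s] LIMSEQ_Suc[OF lim_1_over_n]] by simp
  have powlim: "(\<lambda>n. t n powr p) \<longlonglongrightarrow> s powr p" if "t \<longlonglongrightarrow> s" "\<And>n. 0 \<le> t n" for t :: "nat \<Rightarrow> real"
    using that p0 by (intro tendsto_powr') auto
  obtain G where G: "G \<in> Lp_nonneg p m" "(\<lambda>n. Lp_norm p m (\<lambda>x. a n x - G x)) \<longlonglongrightarrow> 0"
  proof (rule Lp_minimizing_sequence_converges[OF p, where s = a and I = "s powr p", OF aLp a0])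
    fix e :: real assume e: "0 < e"
    have "\<forall>\<^sub>F n in sequentially. (s + 1 / real (Suc n)) powr p < s powr p + e"
      using s0 e by (intro order_tendstoD(2)[OF powlim[OF s1lim]]) auto
    then obtain N where N: "\<And>n. n \<ge> N \<Longrightarrow> (s + 1 / real (Suc n)) powr p < s powr p + e"
      unfolding eventually_sequentially by blast
    have "(\<integral>x. a n x powr p \<partial>m) \<le> s powr p + e" if "n \<ge> N" for n
    proof -
      have "0 \<le> s + 1 / real (Suc n)" using s0 by simp
      then have "(\<integral>x. \<bar>a n x\<bar> powr p \<partial>m) \<le> (s + 1 / real (Suc n)) powr p"
        using an[of n] Lp_norm_le_iff[OF p0] by blast
      then show ?thesis using N[OF that] a0 by simp
    qed
    then show "\<exists>N. \<forall>n\<ge>N. (\<integral>x. a n x powr p \<partial>m) \<le> s powr p + e" by blast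
    have "\<forall>\<^sub>F n in sequentially. s powr p - e < \<delta> (real n) powr p"
      using e by (intro order_tendstoD(1)[OF powlim[OF \<delta>lim \<delta>0]]) auto
    then obtain N' where N': "s powr p - e < \<delta> (real N') powr p"
      unfolding eventually_sequentially by blast
    have "s powr p - e \<le> (\<integral>x. ((a i x + a j x) / 2) powr p \<partial>m)" if ij: "i \<ge> N'" "j \<ge> N'" for i j
    proof -
      \<comment> \<open>The midpoint of the functions competes for the fixed weight
        \<open>N'\<close>. Monotonicity in the weight and convexity put its penalty below the
        midpoint \<open>c\<close> of \<open>a i\<close> and \<open>a j\<close>, so \<open>c\<close>
        inherits the lower bound of \<open>\<delta> (real N')\<close>.\<close>
      define v where "v = (\<lambda>x. 1/2 * u i x + 1/2 * u j x)"
      define c where "c = (\<lambda>x. (a i x + a j x) / 2)"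
      have v: "v \<in> Lipb d" unfolding v_def by (rule Lipb_lincomb[OF u(1) u(1)])
      have c: "c \<in> Lp p m" using Lp_lincomb[OF p0 aLp[of i] aLp[of j], of "1/2" "1/2"]
        by (simp add: c_def add_divide_distrib)
      have c0: "0 \<le> c x" for x using a0 by (simp add: c_def)
      have "\<delta> (real N') \<le> Lp_norm p m (penalty f (real N') v)" by (rule \<delta>_le[OF v])
      also have "\<dots> \<le> Lp_norm p m c"
      proof (rule Lp_norm_mono[OF p0 c Lp_measurable[OF penalty_Lp[OF f v]]], rule AE_I2)
        fix x
        have "penalty f (real N') v x \<le> (penalty f (real N') (u i) x + penalty f (real N') (u j) x) / 2"
          unfolding v_def by (rule penalty_midpoint[OF u(1) u(1)]) simp
        also have "\<dots> \<le> c x"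
          using ij penalty_mono[of "real N'" "real (Suc i)" f "u i" x] penalty_mono[of "real N'" "real (Suc j)" f "u j" x]
          by (simp add: c_def a_def del: of_nat_Suc)
        finally show "\<bar>penalty f (real N') v x\<bar> \<le> \<bar>c x\<bar>" using c0[of x] penalty_nonneg[of "real N'" f v x] by simp
      qed
      finally have "\<delta> (real N') powr p \<le> Lp_norm p m c powr p" using \<delta>0 p0 by (intro powr_mono2) auto
      also have "\<dots> = (\<integral>x. c x powr p \<partial>m)" using c0 by (simp add: Lp_norm_powr[OF p0])
      finally show ?thesis using N' by (simp add: c_def)
    qed
    then show "\<exists>N. \<forall>i\<ge>N. \<forall>j\<ge>N. s powr p - e \<le> (\<integral>x. ((a i x + a j x) / 2) powr p \<partial>m)" by blast
  qed blast
  note GLp = Lp_nonneg_Lp[OF G(1)]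
  \<comment> \<open>The quadratic weight bounds \<open>(n + 1)^2\<close> times the distance to
    \<open>f\<close> by \<open>s + 1\<close>; cancelling one factor leaves the rate
    \<open>1 / (n + 1)\<close>.\<close>
  have uf: "real (Suc n) * Lp_norm p m (\<lambda>x. u n x - f x) \<le> (s + 1) * (1 / real (Suc n))" for n
  proof -
    have "real ((Suc n)\<^sup>2) * Lp_norm p m (\<lambda>x. u n x - f x) = Lp_norm p m (\<lambda>x. real ((Suc n)\<^sup>2) * (u n x - f x))"
      by (simp add: Lp_norm_scale[OF p0] del: of_nat_Suc)
    also have "\<dots> \<le> Lp_norm p m (penalty f (real ((Suc n)\<^sup>2)) (u n))"
    proof (rule Lp_norm_mono[OF p0 penalty_Lp[OF f u(1)]])
      show "(\<lambda>x. real ((Suc n)\<^sup>2) * (u n x - f x)) \<in> borel_measurable m"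
        by (rule Lp_measurable[OF Lp_scale[OF Lp_diff[OF p0 Lipb_Lp[OF u(1)] f]]])
    qed (auto simp: penalty_def abs_mult lip_nonneg intro!: AE_I2)
    also have "\<dots> \<le> s + 1"
    proof -
      have "1 / real (Suc n) \<le> 1" by simp
      then show ?thesis using u(2)[of n] by linarith
    qed
    finally have "real (Suc n) * (real (Suc n) * Lp_norm p m (\<lambda>x. u n x - f x)) \<le> s + 1"
      by (simp only: power2_eq_square of_nat_mult mult.assoc)
    then show ?thesis by (simp add: field_simps del: of_nat_Suc)
  qed
  have lim0: "(\<lambda>n. (s + 1) * (1 / real (Suc n))) \<longlonglongrightarrow> 0"
    by (rule tendsto_mult_right_zero[OF LIMSEQ_Suc[OF lim_1_over_n]])
  have ufn: "Lp_norm p m (\<lambda>x. u n x - f x) \<le> real (Suc n) * Lp_norm p m (\<lambda>x. u n x - f x)" for n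
    using Lp_norm_nonneg[of p m "\<lambda>x. u n x - f x"] by (simp add: distrib_right)
  have "(\<lambda>n. Lp_norm p m (\<lambda>x. u n x - f x)) \<longlonglongrightarrow> 0"
    by (rule tendsto_sandwich[OF always_eventually always_eventually tendsto_const lim0])
      (use order_trans[OF ufn uf] in \<open>auto simp: Lp_norm_nonneg simp del: of_nat_Suc\<close>)
  then have T1: "Lp_tendsto p m u f" using f Lipb_Lp[OF u(1)] by (simp add: Lp_tendsto_def)
  have lipG: "Lp_norm p m (\<lambda>x. lip d (u n) x - G x)
      \<le> (s + 1) * (1 / real (Suc n)) + Lp_norm p m (\<lambda>x. a n x - G x)" for n
  proof -
    \<comment> \<open>\<open>lip d (u n)\<close> and \<open>a n\<close> differ exactly by the linear
      penalty term, whose norm was just shown to vanish, so the slopes share the limit of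
      \<open>a n\<close>.\<close>
    have d1: "(\<lambda>x. lip d (u n) x - a n x) \<in> Lp p m" by (rule Lp_diff[OF p0 lip_Lp[OF u(1)] aLp])
    have "Lp_norm p m (\<lambda>x. (lip d (u n) x - a n x) + (a n x - G x))
        \<le> Lp_norm p m (\<lambda>x. lip d (u n) x - a n x) + Lp_norm p m (\<lambda>x. a n x - G x)"
      by (rule Lp_norm_triangle[OF p d1 Lp_diff[OF p0 aLp GLp]])
    moreover have "Lp_norm p m (\<lambda>x. lip d (u n) x - a n x) = real (Suc n) * Lp_norm p m (\<lambda>x. u n x - f x)"
    proof -
      have "Lp_norm p m (\<lambda>x. lip d (u n) x - a n x) = Lp_norm p m (\<lambda>x. real (Suc n) * (u n x - f x))"
        unfolding Lp_norm_def by (simp add: a_def penalty_def abs_mult del: of_nat_Suc)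
      then show ?thesis by (simp add: Lp_norm_scale[OF p0] del: of_nat_Suc)
    qed
    ultimately show ?thesis using uf[of n] by simp
  qed
  have "(\<lambda>n. Lp_norm p m (\<lambda>x. lip d (u n) x - G x)) \<longlonglongrightarrow> 0"
  proof (rule tendsto_sandwich[OF always_eventually always_eventually tendsto_const])
    show "(\<lambda>n. (s + 1) * (1 / real (Suc n)) + Lp_norm p m (\<lambda>x. a n x - G x)) \<longlonglongrightarrow> 0"
      using tendsto_add[OF lim0 G(2)] by simp
  qed (use lipG in \<open>auto simp: Lp_norm_nonneg simp del: of_nat_Suc\<close>)
  then have T2: "Lp_tendsto p m (\<lambda>n. lip d (u n)) G" using GLp lip_Lp[OF u(1)] by (simp add: Lp_tendsto_def)
  have "Lp_norm p m G \<le> s"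
  proof (rule LIMSEQ_le_const)
    show "(\<lambda>n. Lp_norm p m (\<lambda>x. a n x - G x) + (s + 1 / real (Suc n))) \<longlonglongrightarrow> s"
      using tendsto_add[OF G(2) s1lim] by simp
    have "Lp_norm p m G \<le> Lp_norm p m (\<lambda>x. a n x - G x) + (s + 1 / real (Suc n))" for n
    proof -
      have "Lp_norm p m (\<lambda>x. (G x - a n x) + a n x) \<le> Lp_norm p m (\<lambda>x. G x - a n x) + Lp_norm p m (a n)"
        by (rule Lp_norm_triangle[OF p Lp_diff[OF p0 GLp aLp] aLp])
      then show ?thesis using an[of n] Lp_norm_minus_commute[of p m G "a n"] by simp
    qed
    then show "\<exists>N. \<forall>n\<ge>N. Lp_norm p m G \<le> Lp_norm p m (\<lambda>x. a n x - G x) + (s + 1 / real (Suc n))" by blast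
  qed
  then show ?thesis using that[OF _ T1 G(1) T2] u(1) sR by simp
qed

lemma nn_integral_lip_powr:
  assumes "u \<in> Lipb d"
  shows "(\<integral>\<^sup>+x. ennreal (lip d u x powr p) \<partial>m) = ennreal (Lp_norm p m (lip d u) powr p)"
  using Lp_powr_integrable[OF lip_Lp[OF assms]]
  by (simp add: Lp_norm_powr[OF p0] lip_nonneg nn_integral_eq_integral)

text \<open>Along a sequence of finite energy the slopes are bounded infinitely often by an
  \<open>R\<close> that does not depend on the weight, while for each fixed weight the penalty term
  becomes smaller than \<open>e\<close>.\<close>

lemma cheeger_energy_finite_imp_penalty:
  assumes f: "f \<in> H1p p d m"
  obtains R where "\<forall>l\<ge>0. \<forall>e>0. \<exists>u\<in>Lipb d. Lp_norm p m (penalty f l u) \<le> R + e"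
proof -
  have fLp: "f \<in> Lp p m" using f by (simp add: H1p_def)
  obtain s where s: "\<And>n. s n \<in> Lipb d" "Lp_tendsto p m s f"
    and fin: "liminf (\<lambda>n. ennreal (1 / p) * (\<integral>\<^sup>+x. ennreal (lip d (s n) x powr p) \<partial>m)) < \<infinity>"
    using f unfolding H1p_def cheeger_energy_def by (auto simp: INF_less_iff)
  define F where "F = (\<lambda>n. ennreal (1 / p) * (\<integral>\<^sup>+x. ennreal (lip d (s n) x powr p) \<partial>m))"
  have F: "F n = ennreal (1 / p * Lp_norm p m (lip d (s n)) powr p)" for n
    unfolding F_def nn_integral_lip_powr[OF s(1)] using p0 by (intro ennreal_mult[symmetric]) auto
  define c where "c = enn2real (liminf F) + 1"
  have "liminf F = ennreal (enn2real (liminf F))" using fin by (simp add: F_def less_top)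
  also have "\<dots> < ennreal c" by (rule ennreal_lessI) (simp_all add: c_def add_nonneg_pos)
  finally have c: "liminf F < ennreal c" "0 \<le> c" by (simp_all add: c_def)
  define R where "R = (p * c) powr (1 / p)"
  \<comment> \<open>A bound on the lower limit yields only frequently small energies. One common
    index suffices, because \<open>l * norm (s n - f) < e\<close> holds eventually.\<close>
  have freq: "\<exists>\<^sub>F n in sequentially. F n < ennreal c"
    by (rule ccontr) (use c Liminf_bounded[where F = sequentially and C = "ennreal c" and X = F] in \<open>auto simp: not_frequently not_less\<close>)
  have FR: "Lp_norm p m (lip d (s n)) \<le> R" if "F n < ennreal c" for n
  proof -
    have "1 / p * Lp_norm p m (lip d (s n)) powr p < c" using that c(2) p0 by (simp add: F ennreal_less_iff)
    then have "Lp_norm p m (lip d (s n)) powr p \<le> p * c" using p0 by (simp add: field_simps)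
    then have "(Lp_norm p m (lip d (s n)) powr p) powr (1 / p) \<le> (p * c) powr (1 / p)"
      using p0 by (intro powr_mono2) auto
    then show ?thesis using p0 by (simp add: R_def powr_powr Lp_norm_nonneg)
  qed
  have "\<exists>u\<in>Lipb d. Lp_norm p m (penalty f l u) \<le> R + e" if l: "0 \<le> l" and e: "0 < e" for l e
  proof -
    have "(\<lambda>n. l * Lp_norm p m (\<lambda>x. s n x - f x)) \<longlonglongrightarrow> 0"
      by (rule tendsto_mult_right_zero[OF Lp_tendsto_D(3)[OF s(2)]])
    then have "\<forall>\<^sub>F n in sequentially. l * Lp_norm p m (\<lambda>x. s n x - f x) < e" using e by (rule order_tendstoD(2))
    then obtain n where n: "F n < ennreal c" "l * Lp_norm p m (\<lambda>x. s n x - f x) < e"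
      using frequently_eventually_frequently[OF freq] frequently_ex by blast
    have d1: "(\<lambda>x. l * \<bar>s n x - f x\<bar>) \<in> Lp p m" by (rule Lp_scale[OF Lp_abs[OF Lp_diff[OF p0 Lipb_Lp[OF s(1)] fLp]]])
    have "Lp_norm p m (penalty f l (s n)) \<le> Lp_norm p m (\<lambda>x. l * \<bar>s n x - f x\<bar>) + Lp_norm p m (lip d (s n))"
      unfolding penalty_def by (rule Lp_norm_triangle[OF p d1 lip_Lp[OF s(1)]])
    also have "Lp_norm p m (\<lambda>x. l * \<bar>s n x - f x\<bar>) = l * Lp_norm p m (\<lambda>x. s n x - f x)"
      using l by (simp add: Lp_norm_scale[OF p0] Lp_norm_abs)
    finally show ?thesis using n FR[OF n(1)] s(1) by (intro bexI[of _ "s n"]) auto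
  qed
  then show ?thesis using that by blast
qed

lemma strong_sequence_imp_H1p:
  assumes u: "\<And>n. u n \<in> Lipb d" and uf: "Lp_tendsto p m u f" and G: "Lp_tendsto p m (\<lambda>n. lip d (u n)) G"
  shows "f \<in> H1p p d m"
proof -
  have bnd: "\<And>n. Lp_norm p m (lip d (u n)) \<le> Lp_norm p m (\<lambda>x. lip d (u n) x - G x) + Lp_norm p m G"
  proof -
    fix n
    have "Lp_norm p m (\<lambda>x. (lip d (u n) x - G x) + G x) \<le> Lp_norm p m (\<lambda>x. lip d (u n) x - G x) + Lp_norm p m G"
      by (rule Lp_norm_triangle[OF p Lp_diff[OF p0 lip_Lp[OF u] Lp_tendsto_D(2)[OF G]] Lp_tendsto_D(2)[OF G]])
    then show "Lp_norm p m (lip d (u n)) \<le> Lp_norm p m (\<lambda>x. lip d (u n) x - G x) + Lp_norm p m G" by simp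
  qed
  have "convergent (\<lambda>n. Lp_norm p m (\<lambda>x. lip d (u n) x - G x))"
    using Lp_tendsto_D(3)[OF G] by (rule convergentI)
  then have "Bseq (\<lambda>n. Lp_norm p m (\<lambda>x. lip d (u n) x - G x))" by (rule convergent_imp_Bseq)
  then obtain B where B: "\<And>n. Lp_norm p m (\<lambda>x. lip d (u n) x - G x) \<le> B"
    unfolding Bseq_def by (auto simp: abs_le_iff)
  define K where "K = (B + Lp_norm p m G) powr p"
  have K: "Lp_norm p m (lip d (u n)) powr p \<le> K" for n
  proof -
    have "Lp_norm p m (lip d (u n)) \<le> B + Lp_norm p m G" using bnd[of n] B[of n] by linarith
    then show ?thesis unfolding K_def using p0 by (intro powr_mono2) (auto simp: Lp_norm_nonneg)
  qed
  have "cheeger_energy p d m f \<le> liminf (\<lambda>n. ennreal (1 / p) * (\<integral>\<^sup>+x. ennreal (lip d (u n) x powr p) \<partial>m))"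
    unfolding cheeger_energy_def by (rule INF_lower) (use u uf in auto)
  also have "\<dots> \<le> ennreal (1 / p) * ennreal K"
    by (rule Liminf_le)
       (auto simp: nn_integral_lip_powr[OF u] intro!: always_eventually mult_left_mono ennreal_leI K)
  also have "\<dots> < \<infinity>" by (simp add: ennreal_mult_less_top)
  finally show ?thesis using Lp_tendsto_D(2)[OF uf] by (simp add: H1p_def)
qed

lemma strong_sequence_imp_relaxed_slope:
  assumes u: "\<And>n. u n \<in> Lipb d" and uf: "Lp_tendsto p m u f" and G: "Lp_tendsto p m (\<lambda>n. lip d (u n)) G"
    and G0: "G \<in> Lp_nonneg p m" and g: "g \<in> Lp_nonneg p m" "AE x in m. G x \<le> g x"
  shows "relaxed_slope p d m f g"
  using u uf G0 g Lp_tendsto_imp_weak[OF p0 G] unfolding relaxed_slope_def by blast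

section \<open>First-order jets\<close>

text \<open>
  A jet assigns to every point \<open>x\<close> a germ \<open>y \<mapsto> J (x, y)\<close>; it encodes the value \<open>J (x, x)\<close> together with
  the differential \<open>d (J (x, \<cdot>))\<close> at \<open>x\<close>, so that \<open>h (x) (u (y) - u (x))\<close> stands for \<open>h du\<close>.
\<close>

definition jet :: "('a \<times> 'a \<Rightarrow> real) \<Rightarrow> bool" where
  "jet J \<longleftrightarrow> (\<forall>x. (\<lambda>y. J (x, y)) \<in> Lipb d) \<and> (\<lambda>x. J (x, x)) \<in> borel_measurable m \<and>
     (\<exists>\<sigma>. (\<forall>k::nat. simple_function m (\<sigma> k) \<and> (\<forall>x. \<sigma> k x \<in> Lipb d)) \<and>
       (\<forall>x. (\<lambda>k. lip d (\<lambda>y. J (x, y) - \<sigma> k x y) x) \<longlonglongrightarrow> 0))"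

definition jet_norm :: "real \<Rightarrow> ('a \<times> 'a \<Rightarrow> real) \<Rightarrow> 'a \<Rightarrow> real" where
  "jet_norm l J = (\<lambda>x. l * \<bar>J (x, x)\<bar> + lip d (\<lambda>y. J (x, y)) x)"

definition jets :: "real \<Rightarrow> ('a \<times> 'a \<Rightarrow> real) set" where
  "jets l = {J. jet J \<and> jet_norm l J \<in> Lp p m}"

lemma jet_Lipb: "jet J \<Longrightarrow> (\<lambda>y. J (x, y)) \<in> Lipb d"
  by (simp add: jet_def)

lemma jetE:
  assumes "jet J"
  obtains \<sigma> where "\<And>k::nat. simple_function m (\<sigma> k)" "\<And>k x. \<sigma> k x \<in> Lipb d"
    "\<And>x. (\<lambda>k. lip d (\<lambda>y. J (x, y) - \<sigma> k x y) x) \<longlonglongrightarrow> 0"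
proof -
  obtain \<sigma> where "\<forall>k::nat. simple_function m (\<sigma> k) \<and> (\<forall>x. \<sigma> k x \<in> Lipb d)"
    "\<forall>x. (\<lambda>k. lip d (\<lambda>y. J (x, y) - \<sigma> k x y) x) \<longlonglongrightarrow> 0"
    using assms unfolding jet_def by (elim conjE exE) rule
  then show ?thesis using that[of \<sigma>] by simp
qed

text \<open>The zero germ approximates every germ of slope zero. This covers jets constant in the
  second variable and products of two differentials.\<close>

lemma jet_zero_slope:
  assumes "\<And>x. (\<lambda>y. J (x, y)) \<in> Lipb d" "(\<lambda>x. J (x, x)) \<in> borel_measurable m"
    "\<And>x. lip d (\<lambda>y. J (x, y)) x = 0"
  shows "jet J"
  unfolding jet_def
  by (intro conjI allI assms exI[of _ "\<lambda>_ _ _. 0"]) (simp_all add: assms Lipb_const)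

lemma jet_of_function:
  assumes "u \<in> Lipb d"
  shows "jet (\<lambda>i. u (snd i))"
  unfolding jet_def
  by (intro conjI allI exI[of _ "\<lambda>_ _. u"]) (simp_all add: assms Lipb_measurable lip_const)

lemma jet_lincomb:
  assumes J: "jet J" and K: "jet K"
  shows "jet (\<lambda>i. \<alpha> * J i + \<beta> * K i)"
proof -
  obtain \<sigma> where \<sigma>: "\<And>k::nat. simple_function m (\<sigma> k)" "\<And>k x. \<sigma> k x \<in> Lipb d"
      "\<And>x. (\<lambda>k. lip d (\<lambda>y. J (x, y) - \<sigma> k x y) x) \<longlonglongrightarrow> 0"
    by (rule jetE[OF J]) blast
  obtain \<tau> where \<tau>: "\<And>k::nat. simple_function m (\<tau> k)" "\<And>k x. \<tau> k x \<in> Lipb d"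
      "\<And>x. (\<lambda>k. lip d (\<lambda>y. K (x, y) - \<tau> k x y) x) \<longlonglongrightarrow> 0"
    by (rule jetE[OF K]) blast
  have [measurable]: "(\<lambda>x. J (x, x)) \<in> borel_measurable m" "(\<lambda>x. K (x, x)) \<in> borel_measurable m"
    using J K by (auto simp: jet_def)
  show ?thesis
    unfolding jet_def
  proof (intro conjI allI exI[of _ "\<lambda>k x y. \<alpha> * \<sigma> k x y + \<beta> * \<tau> k x y"])
    show "(\<lambda>y. \<alpha> * J (x, y) + \<beta> * K (x, y)) \<in> Lipb d" for x by (intro Lipb_lincomb jet_Lipb J K)
    show "(\<lambda>x. \<alpha> * J (x, x) + \<beta> * K (x, x)) \<in> borel_measurable m" by measurable
    show "simple_function m (\<lambda>x y. \<alpha> * \<sigma> k x y + \<beta> * \<tau> k x y)" for k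
      by (rule simple_function_compose2[OF \<sigma>(1) \<tau>(1), where h = "\<lambda>f g y. \<alpha> * f y + \<beta> * g y"])
    show "(\<lambda>y. \<alpha> * \<sigma> k x y + \<beta> * \<tau> k x y) \<in> Lipb d" for k x by (rule Lipb_lincomb[OF \<sigma>(2) \<tau>(2)])
    fix x
    show "(\<lambda>k. lip d (\<lambda>y. \<alpha> * J (x, y) + \<beta> * K (x, y) - (\<alpha> * \<sigma> k x y + \<beta> * \<tau> k x y)) x) \<longlonglongrightarrow> 0"
    proof (rule tendsto_zero_sandwich)
      have "(\<lambda>k. \<bar>\<alpha>\<bar> * lip d (\<lambda>y. J (x, y) - \<sigma> k x y) x + \<bar>\<beta>\<bar> * lip d (\<lambda>y. K (x, y) - \<tau> k x y) x) \<longlonglongrightarrow> \<bar>\<alpha>\<bar> * 0 + \<bar>\<beta>\<bar> * 0"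
        by (intro tendsto_intros \<sigma> \<tau>)
      then show "(\<lambda>k. \<bar>\<alpha>\<bar> * lip d (\<lambda>y. J (x, y) - \<sigma> k x y) x + \<bar>\<beta>\<bar> * lip d (\<lambda>y. K (x, y) - \<tau> k x y) x) \<longlonglongrightarrow> 0"
        by simp
      show "lip d (\<lambda>y. \<alpha> * J (x, y) + \<beta> * K (x, y) - (\<alpha> * \<sigma> k x y + \<beta> * \<tau> k x y)) x
          \<le> \<bar>\<alpha>\<bar> * lip d (\<lambda>y. J (x, y) - \<sigma> k x y) x + \<bar>\<beta>\<bar> * lip d (\<lambda>y. K (x, y) - \<tau> k x y) x" for k
        using lip_lincomb[OF Lipb_diff[OF jet_Lipb[OF J, of x] \<sigma>(2)[of k x]] Lipb_diff[OF jet_Lipb[OF K, of x] \<tau>(2)[of k x]], of \<alpha> \<beta> x]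
        by (simp add: algebra_simps)
    qed (rule lip_nonneg)
  qed
qed

text \<open>With simple approximations \<open>s k\<close> of \<open>h\<close> and
  \<open>\<sigma> k\<close> of \<open>J\<close>, the products \<open>s k \<sigma> k\<close> are
  again simple; the error is \<open>(h - s k) J + s k (J - \<sigma> k)\<close>, and each term has
  slope tending to 0.\<close>

lemma jet_mult:
  assumes J: "jet J" and h: "h \<in> borel_measurable m"
  shows "jet (\<lambda>i. h (fst i) * J i)"
proof -
  obtain \<sigma> where \<sigma>: "\<And>k::nat. simple_function m (\<sigma> k)" "\<And>k x. \<sigma> k x \<in> Lipb d"
      "\<And>x. (\<lambda>k. lip d (\<lambda>y. J (x, y) - \<sigma> k x y) x) \<longlonglongrightarrow> 0"
    by (rule jetE[OF J]) blast
  obtain s where s: "\<And>k::nat. simple_function m (s k)" "\<And>x. (\<lambda>k. s k x) \<longlonglongrightarrow> h x"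
    using borel_measurable_implies_sequence_metric[OF h, of 0] by (auto simp: space_UNIV)
  have [measurable]: "(\<lambda>x. J (x, x)) \<in> borel_measurable m" "h \<in> borel_measurable m"
    using J h by (auto simp: jet_def)
  show ?thesis
    unfolding jet_def
  proof (intro conjI allI exI[of _ "\<lambda>k x y. s k x * \<sigma> k x y"])
    show "(\<lambda>y. h (fst (x, y)) * J (x, y)) \<in> Lipb d" for x using Lipb_scale[OF jet_Lipb[OF J]] by simp
    show "(\<lambda>x. h (fst (x, x)) * J (x, x)) \<in> borel_measurable m" by simp
    show "simple_function m (\<lambda>x y. s k x * \<sigma> k x y)" for k
      by (rule simple_function_compose2[OF s(1) \<sigma>(1), where h = "\<lambda>c f y. c * f y"])
    show "(\<lambda>y. s k x * \<sigma> k x y) \<in> Lipb d" for k x by (rule Lipb_scale[OF \<sigma>(2)])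
    fix x
    show "(\<lambda>k. lip d (\<lambda>y. h (fst (x, y)) * J (x, y) - s k x * \<sigma> k x y) x) \<longlonglongrightarrow> 0"
      unfolding fst_conv
    proof (rule tendsto_zero_sandwich)
      have "(\<lambda>k. \<bar>h x - s k x\<bar> * lip d (\<lambda>y. J (x, y)) x + \<bar>s k x\<bar> * lip d (\<lambda>y. J (x, y) - \<sigma> k x y) x)
          \<longlonglongrightarrow> \<bar>h x - h x\<bar> * lip d (\<lambda>y. J (x, y)) x + \<bar>h x\<bar> * 0"
        by (intro tendsto_intros \<sigma> s)
      then show "(\<lambda>k. \<bar>h x - s k x\<bar> * lip d (\<lambda>y. J (x, y)) x + \<bar>s k x\<bar> * lip d (\<lambda>y. J (x, y) - \<sigma> k x y) x) \<longlonglongrightarrow> 0"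
        by simp
      show "lip d (\<lambda>y. h x * J (x, y) - s k x * \<sigma> k x y) x
          \<le> \<bar>h x - s k x\<bar> * lip d (\<lambda>y. J (x, y)) x + \<bar>s k x\<bar> * lip d (\<lambda>y. J (x, y) - \<sigma> k x y) x" for k
        using lip_lincomb[OF jet_Lipb[OF J, of x] Lipb_diff[OF jet_Lipb[OF J, of x] \<sigma>(2)[of k x]], of "h x - s k x" "s k x" x]
        by (simp add: algebra_simps)
    qed (rule lip_nonneg)
  qed
qed

text \<open>This is the purpose of the simple-function clause in \<open>jet\<close>: the germ varies
  with the point, so its slope need not be measurable by itself, but it is the pointwise limit of
  slopes of countably-patched approximants \<open>\<sigma> k\<close>, each using finitely many
  germs.\<close>

lemma jet_norm_measurable:
  assumes J: "jet J"
  shows "jet_norm l J \<in> borel_measurable m"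
proof -
  obtain \<sigma> where \<sigma>: "\<And>k::nat. simple_function m (\<sigma> k)" "\<And>k x. \<sigma> k x \<in> Lipb d"
      "\<And>x. (\<lambda>k. lip d (\<lambda>y. J (x, y) - \<sigma> k x y) x) \<longlonglongrightarrow> 0"
    by (rule jetE[OF J]) blast
  have [measurable]: "(\<lambda>x. J (x, x)) \<in> borel_measurable m" using J by (auto simp: jet_def)
  have [measurable]: "(\<lambda>x. lip d (\<sigma> k x) x) \<in> borel_measurable m" for k
  proof -
    have fin: "finite (range (\<sigma> k))" using simple_functionD(1)[OF \<sigma>(1)[of k]] by (simp add: space_UNIV)
    \<comment> \<open>A simple family takes finitely many values \<open>u\<close>, so its slope is a
      finite sum of \<open>lip d u\<close> restricted to measurable pieces.\<close>
    have eq: "(\<lambda>x. lip d (\<sigma> k x) x) = (\<lambda>x. \<Sum>u\<in>range (\<sigma> k). indicator (\<sigma> k -` {u}) x * lip d u x)"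
    proof
      fix x
      have "(\<Sum>u\<in>range (\<sigma> k). indicator (\<sigma> k -` {u}) x * lip d u x) = (\<Sum>u\<in>range (\<sigma> k). if \<sigma> k x = u then lip d u x else 0)"
        by (intro sum.cong) (auto simp: indicator_def)
      also have "\<dots> = lip d (\<sigma> k x) x" using fin by simp
      finally show "lip d (\<sigma> k x) x = (\<Sum>u\<in>range (\<sigma> k). indicator (\<sigma> k -` {u}) x * lip d u x)" by simp
    qed
    show ?thesis
      unfolding eq
    proof (intro borel_measurable_sum borel_measurable_times)
      fix u assume "u \<in> range (\<sigma> k)"
      then have "u \<in> Lipb d" using \<sigma>(2) by auto
      then show "lip d u \<in> borel_measurable m" by (rule lip_measurable)
      show "(indicator (\<sigma> k -` {u}) :: 'a \<Rightarrow> real) \<in> borel_measurable m"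
        using simple_functionD(2)[OF \<sigma>(1)[of k], of "{u}"] by (simp add: space_UNIV)
    qed
  qed
  have "(\<lambda>x. lip d (\<lambda>y. J (x, y)) x) \<in> borel_measurable m"
  proof (rule borel_measurable_LIMSEQ_real)
    fix x
    have bnd: "norm (lip d (\<sigma> k x) x - lip d (\<lambda>y. J (x, y)) x) \<le> lip d (\<lambda>y. J (x, y) - \<sigma> k x y) x" for k
      using lip_abs_diff[OF jet_Lipb[OF J, of x] \<sigma>(2)[of k x], of x] by (simp add: abs_minus_commute)
    have "(\<lambda>k. lip d (\<sigma> k x) x - lip d (\<lambda>y. J (x, y)) x) \<longlonglongrightarrow> 0"
      by (rule Lim_null_comparison[OF always_eventually \<sigma>(3)[of x]]) (use bnd in blast)
    then show "(\<lambda>k. lip d (\<sigma> k x) x) \<longlonglongrightarrow> lip d (\<lambda>y. J (x, y)) x" by (simp add: LIM_zero_iff)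
  qed simp
  then show ?thesis unfolding jet_norm_def by measurable
qed

lemma jet_norm_nonneg: "0 \<le> l \<Longrightarrow> 0 \<le> jet_norm l J x"
  by (simp add: jet_norm_def lip_nonneg)

lemma jet_norm_lincomb:
  assumes l: "0 \<le> l" and J: "jet J" and K: "jet K"
  shows "jet_norm l (\<lambda>i. \<alpha> * J i + \<beta> * K i) x \<le> \<bar>\<alpha>\<bar> * jet_norm l J x + \<bar>\<beta>\<bar> * jet_norm l K x"
proof -
  have 1: "lip d (\<lambda>y. \<alpha> * J (x, y) + \<beta> * K (x, y)) x \<le> \<bar>\<alpha>\<bar> * lip d (\<lambda>y. J (x, y)) x + \<bar>\<beta>\<bar> * lip d (\<lambda>y. K (x, y)) x"
    by (rule lip_lincomb[OF jet_Lipb[OF J] jet_Lipb[OF K]])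
  have "\<bar>\<alpha> * J (x, x) + \<beta> * K (x, x)\<bar> \<le> \<bar>\<alpha>\<bar> * \<bar>J (x, x)\<bar> + \<bar>\<beta>\<bar> * \<bar>K (x, x)\<bar>"
    by (metis abs_mult abs_triangle_ineq)
  then have 2: "l * \<bar>\<alpha> * J (x, x) + \<beta> * K (x, x)\<bar> \<le> l * (\<bar>\<alpha>\<bar> * \<bar>J (x, x)\<bar> + \<bar>\<beta>\<bar> * \<bar>K (x, x)\<bar>)"
    by (rule mult_left_mono[OF _ l])
  show ?thesis using add_mono[OF 2 1] by (simp add: jet_norm_def algebra_simps)
qed

lemma jet_norm_mult:
  assumes "jet J"
  shows "jet_norm l (\<lambda>i. h (fst i) * J i) x = \<bar>h x\<bar> * jet_norm l J x"
  using lip_scale[OF jet_Lipb[OF assms, of x], of "h x" x] by (simp add: jet_norm_def abs_mult algebra_simps)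

lemma jet_norm_scale:
  assumes "jet J"
  shows "jet_norm l (\<lambda>i. c * J i) x = \<bar>c\<bar> * jet_norm l J x"
  using jet_norm_mult[OF assms, of l "\<lambda>_. c"] by simp

lemma jets_jet: "J \<in> jets l \<Longrightarrow> jet J"
  by (simp add: jets_def)

lemma jets_I:
  assumes "0 \<le> l" "jet J" "G \<in> Lp p m" "\<And>x. jet_norm l J x \<le> G x"
  shows "J \<in> jets l"
  unfolding jets_def
proof (intro CollectI conjI)
  show "jet_norm l J \<in> Lp p m"
    by (rule Lp_bound[OF p0 assms(3) jet_norm_measurable[OF assms(2)]], rule AE_I2)
       (use assms(4) jet_norm_nonneg[OF assms(1)] in \<open>metis abs_of_nonneg order_trans\<close>)
qed (rule assms)

lemma jets_fun_space:
  assumes l: "0 \<le> l"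
  shows "fun_space (jets l)"
  unfolding fun_space_def
proof (intro conjI ballI allI)
  show "(\<lambda>_. 0) \<in> jets l"
    by (rule jets_I[OF l jet_zero_slope Lp_const[OF p0, of 0]])
       (auto simp: jet_norm_def Lipb_const lip_const)
  fix J K \<alpha> \<beta> assume J: "J \<in> jets l" and K: "K \<in> jets l"
  show "(\<lambda>i. \<alpha> * J i + \<beta> * K i) \<in> jets l"
  proof (rule jets_I[OF l jet_lincomb])
    show "(\<lambda>x. \<bar>\<alpha>\<bar> * jet_norm l J x + \<bar>\<beta>\<bar> * jet_norm l K x) \<in> Lp p m"
      using J K by (intro Lp_lincomb p0) (auto simp: jets_def)
    show "jet_norm l (\<lambda>i. \<alpha> * J i + \<beta> * K i) x \<le> \<bar>\<alpha>\<bar> * jet_norm l J x + \<bar>\<beta>\<bar> * jet_norm l K x" for x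
      by (rule jet_norm_lincomb[OF l jets_jet[OF J] jets_jet[OF K]])
  qed (use J K jets_jet in auto)
qed

lemma jets_mult:
  assumes l: "0 \<le> l" and J: "J \<in> jets l" and h: "h \<in> bdd_meas m"
  shows "(\<lambda>i. h (fst i) * J i) \<in> jets l"
proof (rule jets_I[OF l jet_mult[OF jets_jet[OF J] bdd_meas_measurable[OF h]]])
  obtain C where C: "C > 0" "\<And>x. \<bar>h x\<bar> \<le> C" using h by (metis bdd_measE)
  show "(\<lambda>x. \<bar>h x\<bar> * jet_norm l J x) \<in> Lp p m"
    using J C bdd_meas_abs[OF h] by (intro Lp_mult_bounded[OF p0, where C = C]) (auto simp: jets_def bdd_meas_def)
qed (simp add: jet_norm_mult[OF jets_jet[OF J]])

text \<open>Constancy in the second variable means value \<open>w\<close> with zero differential.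
  Together with the jets \<open>u (snd i) - u (fst i)\<close>, of zero value, these decompose the
  jet \<open>u (snd i)\<close> of a Lipschitz function.\<close>

lemma jets_value:
  assumes l: "0 \<le> l" and w: "w \<in> Lp p m"
  shows "(\<lambda>i. w (fst i)) \<in> jets l" and "jet_norm l (\<lambda>i. w (fst i)) x = l * \<bar>w x\<bar>"
proof -
  show n: "jet_norm l (\<lambda>i. w (fst i)) x = l * \<bar>w x\<bar>" for x by (simp add: jet_norm_def lip_const)
  show "(\<lambda>i. w (fst i)) \<in> jets l"
    by (rule jets_I[OF l jet_zero_slope Lp_scale[OF Lp_abs[OF w], of l]])
       (auto simp: Lipb_const lip_const n Lp_measurable[OF w])
qed

lemma jets_function:
  assumes l: "0 \<le> l" and u: "u \<in> Lipb d"
  shows "(\<lambda>i. u (snd i)) \<in> jets l"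
  by (rule jets_I[OF l jet_of_function[OF u] penalty_Lp[OF Lp_const[OF p0, of 0] u, of l]])
     (simp add: jet_norm_def penalty_def)

lemma jets_differential:
  assumes l: "0 \<le> l" and u: "u \<in> Lipb d"
  shows "(\<lambda>i. u (snd i) - u (fst i)) \<in> jets l" and "jet_norm l (\<lambda>i. u (snd i) - u (fst i)) x = lip d u x"
proof -
  have V: "fun_space (jets l)" by (rule jets_fun_space[OF l])
  show "(\<lambda>i. u (snd i) - u (fst i)) \<in> jets l"
    using fun_space_add[OF V jets_function[OF l u] fun_space_uminus[OF V jets_value(1)[OF l Lipb_Lp[OF u]]]] by simp
  show "jet_norm l (\<lambda>i. u (snd i) - u (fst i)) x = lip d u x"
    using lip_add_const[OF u, of "- u x" x] by (simp add: jet_norm_def)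
qed

lemma jets_product:
  assumes l: "0 \<le> l" and u: "u \<in> Lipb d" and v: "v \<in> Lipb d"
  shows "(\<lambda>i. (u (snd i) - u (fst i)) * (v (snd i) - v (fst i))) \<in> jets l"
    and "jet_norm l (\<lambda>i. (u (snd i) - u (fst i)) * (v (snd i) - v (fst i))) x = 0"
proof -
  show n: "jet_norm l (\<lambda>i. (u (snd i) - u (fst i)) * (v (snd i) - v (fst i))) x = 0" for x
    using lip_mult_vanishing[OF u v, of x] by (simp add: jet_norm_def)
  show "(\<lambda>i. (u (snd i) - u (fst i)) * (v (snd i) - v (fst i))) \<in> jets l"
    by (rule jets_I[OF l jet_zero_slope Lp_const[OF p0, of 0]])
       (use lip_mult_vanishing[OF u v] n in \<open>auto intro!: Lipb_mult Lipb_diff u v Lipb_const\<close>)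
qed

section \<open>Functionals on jets\<close>

text \<open>
  The density \<open>\<beta>\<close> represents the positive functional \<open>\<phi> \<mapsto> sup {T J | jet_norm l J \<le> \<phi>}\<close>, which is additive
  because jets may be multiplied by \<open>\<phi> / (\<phi> + \<psi>)\<close>.
\<close>

lemma jet_functional_density:
  assumes l: "0 \<le> l" and T: "linear_on_funs (jets l) T"
    and "\<forall>J\<in>jets l. T J \<le> Lp_norm p m (jet_norm l J)"
  obtains \<beta> where "\<beta> \<in> Lp_nonneg q m" "Lp_norm q m \<beta> \<le> 1"
    "\<forall>J\<in>jets l. jet_norm l J \<in> bdd_meas m \<longrightarrow> \<bar>T J\<bar> \<le> (\<integral>x. jet_norm l J x * \<beta> x \<partial>m)"
proof -
  note TP = bspec[OF assms(3)]
  note V = jets_fun_space[OF l]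
  have lin: "T (\<lambda>i. \<alpha> * J i + \<beta> * K i) = \<alpha> * T J + \<beta> * T K" if "J \<in> jets l" "K \<in> jets l" for J K \<alpha> \<beta>
    using T that by (simp add: linear_on_funs_def)
  have Tadd: "T (\<lambda>i. J i + K i) = T J + T K" if "J \<in> jets l" "K \<in> jets l" for J K
    using lin[OF that, of 1 1] by simp
  have Tscale: "T (\<lambda>i. c * J i) = c * T J" if "J \<in> jets l" for J c
    using lin[OF that that, of c 0] by simp
  have T0: "T (\<lambda>i. 0) = 0" using Tscale[OF fun_space_zero[OF V], of 0] by simp
  define A where "A = (\<lambda>\<phi>. {J \<in> jets l. \<forall>x. jet_norm l J x \<le> \<phi> x})"
  define \<Lambda> where "\<Lambda> = (\<lambda>\<phi>. SUP J\<in>A \<phi>. T J)"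
  have A0: "(\<lambda>i. 0) \<in> A \<phi>" if "\<And>x. 0 \<le> \<phi> x" for \<phi>
    using that fun_space_zero[OF V] by (simp add: A_def jet_norm_def lip_const)
  have ub: "T J \<le> Lp_norm p m \<phi>" if \<phi>: "\<phi> \<in> bdd_meas m" and J: "J \<in> A \<phi>" for J \<phi>
  proof -
    have JV: "J \<in> jets l" using J by (simp add: A_def)
    have "Lp_norm p m (jet_norm l J) \<le> Lp_norm p m \<phi>"
    proof (rule Lp_norm_mono[OF p0 bdd_meas_Lp[OF \<phi> p0] jet_norm_measurable[OF jets_jet[OF JV]]], rule AE_I2)
      fix x
      have "jet_norm l J x \<le> \<phi> x" "0 \<le> jet_norm l J x" using J jet_norm_nonneg[OF l] by (auto simp: A_def)
      then show "\<bar>jet_norm l J x\<bar> \<le> \<bar>\<phi> x\<bar>" by linarith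
    qed
    then show ?thesis using TP[OF JV] by linarith
  qed
  have bdd: "bdd_above (T ` A \<phi>)" if "\<phi> \<in> bdd_meas m" for \<phi>
    using ub[OF that] by (intro bdd_aboveI[of _ "Lp_norm p m \<phi>"]) auto
  have \<Lambda>ge: "T J \<le> \<Lambda> \<phi>" if "\<phi> \<in> bdd_meas m" "J \<in> A \<phi>" for J \<phi>
    unfolding \<Lambda>_def by (rule cSUP_upper[OF that(2) bdd[OF that(1)]])
  have \<Lambda>le: "\<Lambda> \<phi> \<le> c" if "\<And>x. 0 \<le> \<phi> x" "\<And>J. J \<in> A \<phi> \<Longrightarrow> T J \<le> c" for \<phi> c
    unfolding \<Lambda>_def using A0[of \<phi>, OF that(1)] by (intro cSUP_least that(2)) auto
  have \<Lambda>0: "0 \<le> \<Lambda> \<phi>" if "\<phi> \<in> bdd_meas m" "\<And>x. 0 \<le> \<phi> x" for \<phi>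
    using \<Lambda>ge[OF that(1) A0[of \<phi>, OF that(2)]] T0 by simp
  have \<Lambda>norm: "\<Lambda> \<phi> \<le> Lp_norm p m \<phi>" if "\<phi> \<in> bdd_meas m" "\<And>x. 0 \<le> \<phi> x" for \<phi>
    using ub[OF that(1)] by (rule \<Lambda>le[OF that(2)])
  \<comment> \<open>This single estimate yields both continuity at the empty set and vanishing on
    null sets.\<close>
  have \<Lambda>ind: "\<Lambda> (indicator E) \<le> measure m E powr (1 / p)" if "E \<in> sets m" for E
  proof -
    have "Lp_norm p m (indicator E) = measure m E powr (1 / p)"
    proof -
      have "(\<lambda>x. \<bar>indicator E x\<bar> powr p) = (indicator E :: 'a \<Rightarrow> real)" using p0 by (auto simp: indicator_def)
      then show ?thesis using that by (simp add: Lp_norm_def)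
    qed
    then show ?thesis using \<Lambda>norm[OF bdd_meas_indicator[OF that]] by simp
  qed
  obtain \<beta> where \<beta>: "integrable m \<beta>" "\<And>x. 0 \<le> \<beta> x"
    "\<And>\<phi>. \<phi> \<in> bdd_meas m \<Longrightarrow> (\<And>x. 0 \<le> \<phi> x) \<Longrightarrow> \<Lambda> \<phi> = (\<integral>x. \<phi> x * \<beta> x \<partial>m)"
  proof (rule positive_functional_density[OF space_UNIV, of \<Lambda>])
    show "0 \<le> \<Lambda> \<phi>" if "\<phi> \<in> bdd_meas m" "\<And>x. 0 \<le> \<phi> x" for \<phi> by (rule \<Lambda>0[OF that])
    have scale1: "c * \<Lambda> \<phi> \<le> \<Lambda> (\<lambda>x. c * \<phi> x)" if \<phi>: "\<phi> \<in> bdd_meas m" "\<And>x. 0 \<le> \<phi> x" and c: "0 < c" for \<phi> c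
    proof -
      have "\<Lambda> \<phi> \<le> \<Lambda> (\<lambda>x. c * \<phi> x) / c"
      proof (rule \<Lambda>le[OF \<phi>(2)])
        fix J assume J: "J \<in> A \<phi>"
        then have JV: "J \<in> jets l" by (simp add: A_def)
        have "(\<lambda>i. c * J i) \<in> A (\<lambda>x. c * \<phi> x)"
          using J c fun_space_scale[OF V JV] by (simp add: A_def jet_norm_scale[OF jets_jet[OF JV]])
        then have "T (\<lambda>i. c * J i) \<le> \<Lambda> (\<lambda>x. c * \<phi> x)" by (rule \<Lambda>ge[OF bdd_meas_scale[OF \<phi>(1)]])
        then show "T J \<le> \<Lambda> (\<lambda>x. c * \<phi> x) / c" using c by (simp add: Tscale[OF JV] field_simps)
      qed
      then show ?thesis using c by (simp add: field_simps)
    qed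
    show "\<Lambda> (\<lambda>x. c * \<phi> x) = c * \<Lambda> \<phi>" if \<phi>: "\<phi> \<in> bdd_meas m" "\<And>x. 0 \<le> \<phi> x" and c: "0 < c" for \<phi> c
    proof (rule antisym[OF _ scale1[OF \<phi> c]])
      have "(1 / c) * \<Lambda> (\<lambda>x. c * \<phi> x) \<le> \<Lambda> (\<lambda>x. (1 / c) * (c * \<phi> x))"
        by (rule scale1[OF bdd_meas_scale[OF \<phi>(1)]]) (use \<phi> c in auto)
      then show "\<Lambda> (\<lambda>x. c * \<phi> x) \<le> c * \<Lambda> \<phi>" using c by (simp add: field_simps)
    qed
    show "\<Lambda> (\<lambda>x. \<phi> x + \<psi> x) = \<Lambda> \<phi> + \<Lambda> \<psi>"
      if \<phi>: "\<phi> \<in> bdd_meas m" and \<psi>: "\<psi> \<in> bdd_meas m" and \<phi>0: "\<And>x. 0 \<le> \<phi> x" and \<psi>0: "\<And>x. 0 \<le> \<psi> x" for \<phi> \<psi>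
    proof (rule antisym)
      note sum = bdd_meas_add[OF \<phi> \<psi>]
      have "T J + T K \<le> \<Lambda> (\<lambda>x. \<phi> x + \<psi> x)" if J: "J \<in> A \<phi>" and K: "K \<in> A \<psi>" for J K
      proof -
        have JV: "J \<in> jets l" "K \<in> jets l" using J K by (auto simp: A_def)
        have "jet_norm l (\<lambda>i. J i + K i) x \<le> \<phi> x + \<psi> x" for x
          using jet_norm_lincomb[OF l jets_jet[OF JV(1)] jets_jet[OF JV(2)], of 1 1 x] J K
          by (simp add: A_def) (meson add_mono order_trans)
        then have "(\<lambda>i. J i + K i) \<in> A (\<lambda>x. \<phi> x + \<psi> x)" using fun_space_add[OF V JV] by (simp add: A_def)
        then show ?thesis using \<Lambda>ge[OF sum] Tadd[OF JV] by fastforce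
      qed
      then have "T J \<le> \<Lambda> (\<lambda>x. \<phi> x + \<psi> x) - T K" if "J \<in> A \<phi>" "K \<in> A \<psi>" for J K using that by fastforce
      then have "\<Lambda> \<phi> \<le> \<Lambda> (\<lambda>x. \<phi> x + \<psi> x) - T K" if "K \<in> A \<psi>" for K using that by (intro \<Lambda>le[OF \<phi>0])
      then have "T K \<le> \<Lambda> (\<lambda>x. \<phi> x + \<psi> x) - \<Lambda> \<phi>" if "K \<in> A \<psi>" for K using that by fastforce
      then have "\<Lambda> \<psi> \<le> \<Lambda> (\<lambda>x. \<phi> x + \<psi> x) - \<Lambda> \<phi>" by (intro \<Lambda>le[OF \<psi>0])
      then show "\<Lambda> \<phi> + \<Lambda> \<psi> \<le> \<Lambda> (\<lambda>x. \<phi> x + \<psi> x)" by simp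
      show "\<Lambda> (\<lambda>x. \<phi> x + \<psi> x) \<le> \<Lambda> \<phi> + \<Lambda> \<psi>"
      proof (rule \<Lambda>le)
        show "0 \<le> \<phi> x + \<psi> x" for x using \<phi>0 \<psi>0 by (simp add: add_nonneg_nonneg)
        fix J assume J: "J \<in> A (\<lambda>x. \<phi> x + \<psi> x)"
        then have JV: "J \<in> jets l" and Jle: "\<And>x. jet_norm l J x \<le> \<phi> x + \<psi> x" by (auto simp: A_def)
        \<comment> \<open>\<theta> splits \<open>J\<close> into a part below \<phi> and a part below
          \<psi>. Where both functions vanish, \<theta> is 0 by the convention
          \<open>x / 0 = 0\<close> and the two identities in \<open>prod\<close> still hold.\<close>
        define \<theta> where "\<theta> = (\<lambda>x. \<phi> x / (\<phi> x + \<psi> x))"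
        have \<theta>: "0 \<le> \<theta> x" "\<theta> x \<le> 1" for x using \<phi>0[of x] \<psi>0[of x] by (auto simp: \<theta>_def divide_le_eq_1)
        have [measurable]: "\<phi> \<in> borel_measurable m" "\<psi> \<in> borel_measurable m" using \<phi> \<psi> by (auto simp: bdd_meas_def)
        have \<theta>b: "\<theta> \<in> bdd_meas m"
        proof (rule bdd_measI[where C = 1])
          show "\<theta> \<in> borel_measurable m" unfolding \<theta>_def by measurable
          show "\<bar>\<theta> x\<bar> \<le> 1" for x using \<theta>[of x] by simp
        qed
        have \<theta>b': "(\<lambda>x. 1 - \<theta> x) \<in> bdd_meas m" by (rule bdd_meas_diff[OF bdd_meas_const \<theta>b])
        have prod: "\<theta> x * (\<phi> x + \<psi> x) = \<phi> x" "(1 - \<theta> x) * (\<phi> x + \<psi> x) = \<psi> x" for x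
        proof -
          show "\<theta> x * (\<phi> x + \<psi> x) = \<phi> x"
            using \<phi>0[of x] \<psi>0[of x] by (cases "\<phi> x + \<psi> x = 0") (auto simp: \<theta>_def add_nonneg_eq_0_iff)
          then show "(1 - \<theta> x) * (\<phi> x + \<psi> x) = \<psi> x" by (simp add: algebra_simps)
        qed
        have "\<theta> x * jet_norm l J x \<le> \<phi> x" for x
          using mult_left_mono[OF Jle[of x] \<theta>(1)[of x]] prod(1)[of x] by simp
        then have 1: "(\<lambda>i. \<theta> (fst i) * J i) \<in> A \<phi>"
          using jets_mult[OF l JV \<theta>b] \<theta> by (simp add: A_def jet_norm_mult[OF jets_jet[OF JV]])
        have "(1 - \<theta> x) * jet_norm l J x \<le> \<psi> x" for x
          using mult_left_mono[OF Jle[of x], of "1 - \<theta> x"] \<theta>(2)[of x] prod(2)[of x] by simp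
        then have 2: "(\<lambda>i. (1 - \<theta> (fst i)) * J i) \<in> A \<psi>"
          using jets_mult[OF l JV \<theta>b'] \<theta> jet_norm_mult[OF jets_jet[OF JV], of l "\<lambda>x. 1 - \<theta> x"] by (simp add: A_def)
        have "T J = T (\<lambda>i. \<theta> (fst i) * J i + (1 - \<theta> (fst i)) * J i)" by (simp add: algebra_simps)
        also have "\<dots> = T (\<lambda>i. \<theta> (fst i) * J i) + T (\<lambda>i. (1 - \<theta> (fst i)) * J i)"
          using 1 2 by (intro Tadd) (auto simp: A_def)
        finally show "T J \<le> \<Lambda> \<phi> + \<Lambda> \<psi>" using \<Lambda>ge[OF \<phi> 1] \<Lambda>ge[OF \<psi> 2] by linarith
      qed
    qed
    show "(\<lambda>i. \<Lambda> (indicator (E i))) \<longlonglongrightarrow> 0"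
      if E: "range E \<subseteq> sets m" "decseq E" "(\<Inter>i. E i) = {}" for E :: "nat \<Rightarrow> 'a set"
    proof (rule tendsto_sandwich[OF always_eventually always_eventually tendsto_const])
      have Es: "E i \<in> sets m" for i using E(1) by auto
      show "\<forall>i. 0 \<le> \<Lambda> (indicator (E i))" using \<Lambda>0[OF bdd_meas_indicator[OF Es]] by simp
      show "\<forall>i. \<Lambda> (indicator (E i)) \<le> measure m (E i) powr (1 / p)" using \<Lambda>ind[OF Es] by simp
      have "(\<lambda>i. measure m (E i)) \<longlonglongrightarrow> 0"
        using finite_Lim_measure_decseq[OF E(1,2)] E(3) by simp
      then show "(\<lambda>i. measure m (E i) powr (1 / p)) \<longlonglongrightarrow> 0"
        using p0 tendsto_powr'[of "\<lambda>i. measure m (E i)" 0 sequentially "\<lambda>_. 1 / p" "1 / p"] by simp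
    qed
    show "\<Lambda> (indicator E) = 0" if "E \<in> null_sets m" for E
    proof -
      have Es: "E \<in> sets m" and "measure m E = 0" using that by (auto simp: null_sets_def measure_def)
      then show ?thesis using \<Lambda>ind[OF Es] \<Lambda>0[OF bdd_meas_indicator[OF Es]] by simp
    qed
  qed blast
  have [measurable]: "\<beta> \<in> borel_measurable m" using \<beta>(1) by auto
  \<comment> \<open>Duality test with \<open>\<phi> = t powr (q - 1)\<close>: since
    \<open>(q - 1) * p = q\<close>, the norm bound on \<Lambda> reads
    \<open>X \<le> X powr (1 / p)\<close>, which forces \<open>X \<le> 1\<close>. Truncation at
    \<open>n\<close> keeps \<phi> bounded and hence admissible.\<close>
  have trunc: "(\<integral>x. min (\<beta> x) (real n) powr q \<partial>m) \<le> 1" for n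
  proof -
    define t where "t = (\<lambda>x. min (\<beta> x) (real n))"
    have t0: "0 \<le> t x" "t x \<le> real n" "t x \<le> \<beta> x" for x using \<beta>(2)[of x] by (auto simp: t_def)
    have [measurable]: "t \<in> borel_measurable m" unfolding t_def by measurable
    define \<phi> where "\<phi> = (\<lambda>x. t x powr (q - 1))"
    have \<phi>: "\<phi> \<in> bdd_meas m"
    proof (rule bdd_measI[where C = "real n powr (q - 1)"])
      show "\<bar>\<phi> x\<bar> \<le> real n powr (q - 1)" for x using t0[of x] q by (auto simp: \<phi>_def intro!: powr_mono2)
    qed (simp add: \<phi>_def)
    define X where "X = (\<integral>x. t x powr q \<partial>m)"
    have tq: "t x powr q = \<phi> x * t x" for x
      using t0(1)[of x] powr_mult_base[of "t x" "q - 1"] by (simp add: \<phi>_def mult.commute)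
    have X0: "0 \<le> X" by (simp add: X_def integral_nonneg_AE)
    have "X = (\<integral>x. \<phi> x * t x \<partial>m)" by (simp add: X_def tq)
    also have "\<dots> \<le> (\<integral>x. \<phi> x * \<beta> x \<partial>m)"
    proof (rule integral_mono)
      have "t \<in> bdd_meas m" by (rule bdd_measI[where C = "real n"]) (use t0 in \<open>auto simp: abs_le_iff intro: order_trans[of _ 0]\<close>)
      then show "integrable m (\<lambda>x. \<phi> x * t x)"
        using bdd_meas_integrable[OF bdd_meas_mult[OF \<phi>], of t "\<lambda>x. 1"] by simp
    qed (use bdd_meas_integrable[OF \<phi> \<beta>(1)] t0 in \<open>auto simp: \<phi>_def intro: mult_left_mono\<close>)
    also have "\<dots> = \<Lambda> \<phi>" using \<beta>(3)[OF \<phi>] by (simp add: \<phi>_def)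
    also have "\<dots> \<le> Lp_norm p m \<phi>" by (rule \<Lambda>norm[OF \<phi>]) (simp add: \<phi>_def)
    also have "\<dots> = X powr (1 / p)"
      unfolding Lp_norm_def X_def \<phi>_def using conj_exp(3)[OF p] by (simp add: powr_powr)
    finally have XX: "X \<le> X powr (1 / p)" .
    have "X \<le> 1"
    proof (rule ccontr)
      assume "\<not> X \<le> 1"
      then have "X powr (1 / p) < X powr 1" using p by (intro powr_less_mono) auto
      then show False using XX X0 by simp
    qed
    then show ?thesis by (simp add: X_def t_def)
  qed
  \<comment> \<open>Fatou's lemma removes the truncation, which at each point is eventually
    inactive.\<close>
  have nn: "(\<integral>\<^sup>+x. ennreal (\<beta> x powr q) \<partial>m) \<le> 1"
  proof -
    have "(\<integral>\<^sup>+x. ennreal (\<beta> x powr q) \<partial>m) = (\<integral>\<^sup>+x. liminf (\<lambda>n. ennreal (min (\<beta> x) (real n) powr q)) \<partial>m)"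
    proof (rule nn_integral_cong)
      fix x
      obtain N where N: "\<beta> x \<le> real N" using real_arch_simple by blast
      have "\<forall>\<^sub>F n in sequentially. ennreal (min (\<beta> x) (real n) powr q) = ennreal (\<beta> x powr q)"
        using N by (intro eventually_sequentiallyI[of N]) (simp add: min_def)
      then have "(\<lambda>n. ennreal (min (\<beta> x) (real n) powr q)) \<longlonglongrightarrow> ennreal (\<beta> x powr q)" by (rule tendsto_eventually)
      then show "ennreal (\<beta> x powr q) = liminf (\<lambda>n. ennreal (min (\<beta> x) (real n) powr q))"
        using lim_imp_Liminf[OF sequentially_bot] by metis
    qed
    also have "\<dots> \<le> liminf (\<lambda>n. \<integral>\<^sup>+x. ennreal (min (\<beta> x) (real n) powr q) \<partial>m)"
      by (rule nn_integral_liminf) measurable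
    also have "\<dots> \<le> 1"
    proof (rule Liminf_le)
      have "(\<integral>\<^sup>+x. ennreal (min (\<beta> x) (real n) powr q) \<partial>m) \<le> 1" for n
      proof -
        have "integrable m (\<lambda>x. min (\<beta> x) (real n) powr q)"
          by (rule integrable_const_bound[where B = "real n powr q"])
             (use \<beta>(2) q0 in \<open>auto intro!: AE_I2 powr_mono2\<close>)
        then show ?thesis using trunc[of n]
          by (subst nn_integral_eq_integral) (auto simp: ennreal_le_1)
      qed
      then show "\<forall>\<^sub>F n in sequentially. (\<integral>\<^sup>+x. ennreal (min (\<beta> x) (real n) powr q) \<partial>m) \<le> 1" by simp
    qed simp
    finally show ?thesis .
  qed
  have \<beta>q: "\<beta> \<in> Lp q m"
  proof -
    have "(\<integral>\<^sup>+x. ennreal (\<beta> x powr q) \<partial>m) < \<infinity>" using nn by (rule le_less_trans) simp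
    then show ?thesis using \<beta>(2) by (simp add: Lp_def integrable_iff_bounded)
  qed
  have "ennreal (\<integral>x. \<bar>\<beta> x\<bar> powr q \<partial>m) \<le> 1"
    using nn Lp_powr_integrable[OF \<beta>q] \<beta>(2) by (subst (asm) nn_integral_eq_integral) auto
  then have norm: "Lp_norm q m \<beta> \<le> 1" using q0 by (simp add: Lp_norm_le_iff ennreal_le_1)
  \<comment> \<open>\<open>J\<close> is itself a competitor in the supremum that defines \<Lambda>
    at \<open>jet_norm l J\<close>.\<close>
  have bound: "T J \<le> (\<integral>x. jet_norm l J x * \<beta> x \<partial>m)" if J: "J \<in> jets l" "jet_norm l J \<in> bdd_meas m" for J
    using \<Lambda>ge[OF J(2), of J] \<beta>(3)[OF J(2) jet_norm_nonneg[OF l]] J(1) by (simp add: A_def)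
  have "\<bar>T J\<bar> \<le> (\<integral>x. jet_norm l J x * \<beta> x \<partial>m)" if J: "J \<in> jets l" "jet_norm l J \<in> bdd_meas m" for J
  proof -
    have n: "jet_norm l (\<lambda>i. (-1) * J i) = jet_norm l J" using jet_norm_scale[OF jets_jet[OF J(1)], of l "-1"] by auto
    have "T (\<lambda>i. (-1) * J i) \<le> (\<integral>x. jet_norm l (\<lambda>i. (-1) * J i) x * \<beta> x \<partial>m)"
      by (rule bound[OF fun_space_scale[OF V J(1)]]) (simp only: n J(2))
    then show ?thesis unfolding n using bound[OF J] Tscale[OF J(1), of "-1"] by simp
  qed
  then show ?thesis using that \<beta>q norm \<beta>(2) by (auto simp: Lp_nonneg_def)
qed

text \<open>The Leibniz rule holds because the product of two differentials is a jet of norm zero.\<close>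

lemma jet_functional_derivation:
  assumes l: "0 \<le> l" and T: "linear_on_funs (jets l) T"
    and "\<forall>J\<in>jets l. T J \<le> Lp_norm p m (jet_norm l J)"
    and "\<forall>u\<in>Lipb d. T (\<lambda>i. u (snd i)) = 0"
    and \<beta>: "\<beta> \<in> Lp_nonneg q m"
    and "\<forall>J\<in>jets l. jet_norm l J \<in> bdd_meas m \<longrightarrow> \<bar>T J\<bar> \<le> (\<integral>x. jet_norm l J x * \<beta> x \<partial>m)"
  obtains b where "b \<in> Der_div q d m" "\<beta> \<in> deriv_bounds q d m b"
    "\<forall>w\<in>Lp p m. T (\<lambda>i. w (fst i)) = (\<integral>x. w x * divergence d m b x \<partial>m)"
proof -
  note TP = bspec[OF assms(3)] and Tu = bspec[OF assms(4)] and bound = mp[OF bspec[OF assms(6)]]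
  note V = jets_fun_space[OF l]
  have lin: "T (\<lambda>i. \<alpha> * J i + \<gamma> * K i) = \<alpha> * T J + \<gamma> * T K" if "J \<in> jets l" "K \<in> jets l" for J K \<alpha> \<gamma>
    using T that by (simp add: linear_on_funs_def)
  have Tadd: "T (\<lambda>i. J i + K i) = T J + T K" if "J \<in> jets l" "K \<in> jets l" for J K
    using lin[OF that, of 1 1] by simp
  have \<beta>Lq: "\<beta> \<in> Lp q m" by (rule Lp_nonneg_Lp[OF \<beta>])
  have \<beta>i: "integrable m \<beta>" by (rule Lp_integrable[OF q \<beta>Lq])
  define du where "du = (\<lambda>(u :: 'a \<Rightarrow> real) (i :: 'a \<times> 'a). u (snd i) - u (fst i))"
  have duV: "(\<lambda>i. h (fst i) * du u i) \<in> jets l" if "u \<in> Lipb d" "h \<in> bdd_meas m" for u h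
    unfolding du_def by (rule jets_mult[OF l jets_differential(1)[OF l that(1)] that(2)])
  have duN: "jet_norm l (\<lambda>i. h (fst i) * du u i) = (\<lambda>x. \<bar>h x\<bar> * lip d u x)" if u: "u \<in> Lipb d" for u h
    using jet_norm_mult[OF jets_jet[OF jets_differential(1)[OF l u]], of l h] jets_differential(2)[OF l u]
    by (simp add: du_def fun_eq_iff)
  have valV: "(\<lambda>i. h (fst i)) \<in> jets l" if "h \<in> bdd_meas m" for h
    by (rule jets_value(1)[OF l bdd_meas_Lp[OF that p0]])
  \<comment> \<open>\<open>Q u v\<close> says that \<open>v\<close> is the density of
    \<open>h \<mapsto> T (h du)\<close>; the derivation \<open>b\<close> picks such a density for
    each \<open>u\<close>.\<close>
  define Q where "Q = (\<lambda>u v. integrable m v \<and> (AE x in m. \<bar>v x\<bar> \<le> lip d u x * \<beta> x) \<and>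
      (\<forall>h\<in>bdd_meas m. T (\<lambda>i. h (fst i) * du u i) = (\<integral>x. h x * v x \<partial>m)))"
  have exb: "\<exists>v. Q u v" if u: "u \<in> Lipb d" for u
  proof -
    obtain v where "integrable m v" "AE x in m. \<bar>v x\<bar> \<le> lip d u x * \<beta> x"
      "\<And>h. h \<in> bdd_meas m \<Longrightarrow> T (\<lambda>i. h (fst i) * du u i) = (\<integral>x. h x * v x \<partial>m)"
    proof (rule dominated_functional_density[OF space_UNIV, of "\<lambda>h. T (\<lambda>i. h (fst i) * du u i)" "\<lambda>x. lip d u x * \<beta> x"])
      show "integrable m (\<lambda>x. lip d u x * \<beta> x)" by (rule bdd_meas_integrable[OF lip_bdd_meas[OF u] \<beta>i])
      fix h assume h: "h \<in> bdd_meas m"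
      show "\<bar>T (\<lambda>i. h (fst i) * du u i)\<bar> \<le> (\<integral>x. \<bar>h x\<bar> * (lip d u x * \<beta> x) \<partial>m)"
        using bound[OF duV[OF u h]] bdd_meas_mult[OF bdd_meas_abs[OF h] lip_bdd_meas[OF u]]
        by (simp add: duN[OF u] mult.assoc)
      fix g \<alpha> \<gamma> assume g: "g \<in> bdd_meas m"
      show "T (\<lambda>i. (\<alpha> * h (fst i) + \<gamma> * g (fst i)) * du u i)
          = \<alpha> * T (\<lambda>i. h (fst i) * du u i) + \<gamma> * T (\<lambda>i. g (fst i) * du u i)"
        using lin[OF duV[OF u h] duV[OF u g], of \<alpha> \<gamma>] by (simp add: distrib_right mult.assoc)
    qed blast
    then show ?thesis unfolding Q_def by blast
  qed
  define b where "b = (\<lambda>u. SOME v. Q u v)"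
  have Qb: "Q u (b u)" if "u \<in> Lipb d" for u
    unfolding b_def by (rule someI_ex[OF exb[OF that]])
  have b: "integrable m (b u)" "AE x in m. \<bar>b u x\<bar> \<le> lip d u x * \<beta> x"
    "\<And>h. h \<in> bdd_meas m \<Longrightarrow> T (\<lambda>i. h (fst i) * du u i) = (\<integral>x. h x * b u x \<partial>m)" if "u \<in> Lipb d" for u
    using Qb[OF that] unfolding Q_def by blast+
  \<comment> \<open>Density of \<open>T\<close> on pure values. The value part of the jet norm
    carries the weight \<open>l\<close>, so \<open>D\<close> is dominated by
    \<open>l * \<beta>\<close> and lies in \<open>L^q\<close>.\<close>
  obtain D where D: "integrable m D" "AE x in m. \<bar>D x\<bar> \<le> l * \<beta> x"
    "\<And>h. h \<in> bdd_meas m \<Longrightarrow> T (\<lambda>i. h (fst i)) = (\<integral>x. h x * D x \<partial>m)"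
  proof (rule dominated_functional_density[OF space_UNIV, of "\<lambda>h. T (\<lambda>i. h (fst i))" "\<lambda>x. l * \<beta> x"])
    show "integrable m (\<lambda>x. l * \<beta> x)" using \<beta>i by simp
    fix h assume h: "h \<in> bdd_meas m"
    have N: "jet_norm l (\<lambda>i. h (fst i)) = (\<lambda>x. l * \<bar>h x\<bar>)"
      using jets_value(2)[OF l bdd_meas_Lp[OF h p0]] by auto
    show "\<bar>T (\<lambda>i. h (fst i))\<bar> \<le> (\<integral>x. \<bar>h x\<bar> * (l * \<beta> x) \<partial>m)"
      using bound[OF valV[OF h]] bdd_meas_scale[OF bdd_meas_abs[OF h], of l] by (simp add: N ac_simps)
    fix g \<alpha> \<gamma> assume g: "g \<in> bdd_meas m"
    show "T (\<lambda>i. \<alpha> * h (fst i) + \<gamma> * g (fst i)) = \<alpha> * T (\<lambda>i. h (fst i)) + \<gamma> * T (\<lambda>i. g (fst i))"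
      by (rule lin[OF valV[OF h] valV[OF g]])
  qed blast
  have DLq: "D \<in> Lp q m"
  proof (rule Lp_bound[OF q0 Lp_scale[OF \<beta>Lq, of l]])
    show "D \<in> borel_measurable m" using D(1) by auto
    show "AE x in m. \<bar>D x\<bar> \<le> \<bar>l * \<beta> x\<bar>" using D(2) by eventually_elim simp
  qed
  have Tval: "T (\<lambda>i. w (fst i)) = (\<integral>x. w x * D x \<partial>m)" if w: "w \<in> Lp p m" for w
  proof -
    \<comment> \<open>The density formula is known only for bounded values. Cutting off where
      \<open>|w| > n\<close> extends it to \<open>w\<close> in \<open>L^p\<close>, since
      \<open>T\<close> is bounded by the \<open>L^p\<close> norm there.\<close>
    define t where "t = (\<lambda>(n::nat) x. if \<bar>w x\<bar> \<le> real n then w x else 0)"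
    have [measurable]: "w \<in> borel_measurable m" "D \<in> borel_measurable m" using w D(1) by (auto simp: Lp_def)
    have tb: "t n \<in> bdd_meas m" for n
      by (rule bdd_measI[where C = "real n"]) (auto simp: t_def)
    have wt: "(\<lambda>x. w x - t n x) \<in> Lp p m" for n by (rule Lp_diff[OF p0 w bdd_meas_Lp[OF tb p0]])
    have ev: "\<forall>\<^sub>F n in sequentially. t n x = w x" for x
    proof -
      obtain N where "\<bar>w x\<bar> \<le> real N" using real_arch_simple by blast
      then show ?thesis by (intro eventually_sequentiallyI[of N]) (auto simp: t_def)
    qed
    have "(\<lambda>n. \<integral>x. \<bar>w x - t n x\<bar> powr p \<partial>m) \<longlonglongrightarrow> (\<integral>x. 0 \<partial>m)"
    proof (rule integral_dominated_convergence[where w = "\<lambda>x. \<bar>w x\<bar> powr p"])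
      show "AE x in m. (\<lambda>n. \<bar>w x - t n x\<bar> powr p) \<longlonglongrightarrow> 0"
      proof (rule AE_I2, rule tendsto_eventually)
        fix x
        show "\<forall>\<^sub>F n in sequentially. \<bar>w x - t n x\<bar> powr p = 0" using ev[of x] by eventually_elim simp
      qed
      show "AE x in m. norm (\<bar>w x - t n x\<bar> powr p) \<le> \<bar>w x\<bar> powr p" for n by (auto simp: t_def)
      show "integrable m (\<lambda>x. \<bar>w x\<bar> powr p)" by (rule Lp_powr_integrable[OF w])
      show "(\<lambda>x. \<bar>w x - t n x\<bar> powr p) \<in> borel_measurable m" for n unfolding t_def by measurable
    qed simp
    then have "(\<lambda>n. Lp_norm p m (\<lambda>x. w x - t n x)) \<longlonglongrightarrow> 0" by (simp add: Lp_small_iff[OF p0])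
    then have lim0: "(\<lambda>n. l * Lp_norm p m (\<lambda>x. w x - t n x)) \<longlonglongrightarrow> 0" by (rule tendsto_mult_right_zero)
    have bnd: "norm ((\<integral>x. t n x * D x \<partial>m) - T (\<lambda>i. w (fst i))) \<le> l * Lp_norm p m (\<lambda>x. w x - t n x)" for n
    proof -
      have *: "T (\<lambda>i. v (fst i)) \<le> l * Lp_norm p m v" if v: "v \<in> Lp p m" for v
      proof -
        have "jet_norm l (\<lambda>i. v (fst i)) = (\<lambda>x. l * \<bar>v x\<bar>)" using jets_value(2)[OF l v] by auto
        then show ?thesis using TP[OF jets_value(1)[OF l v]] l by (simp add: Lp_norm_scale[OF p0] Lp_norm_abs)
      qed
      have d: "T (\<lambda>i. \<alpha> * w (fst i) + \<gamma> * t n (fst i)) = \<alpha> * T (\<lambda>i. w (fst i)) + \<gamma> * T (\<lambda>i. t n (fst i))" for \<alpha> \<gamma>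
        by (rule lin[OF jets_value(1)[OF l w] valV[OF tb]])
      have "T (\<lambda>i. w (fst i)) - T (\<lambda>i. t n (fst i)) \<le> l * Lp_norm p m (\<lambda>x. w x - t n x)"
        using *[OF wt[of n]] d[of 1 "-1"] by simp
      moreover have "T (\<lambda>i. t n (fst i)) - T (\<lambda>i. w (fst i)) \<le> l * Lp_norm p m (\<lambda>x. w x - t n x)"
        using *[OF Lp_diff[OF p0 bdd_meas_Lp[OF tb p0] w], of n] d[of "-1" 1]
        by (simp add: Lp_norm_minus_commute[of p m w])
      ultimately show ?thesis using D(3)[OF tb[of n]] by (simp add: abs_le_iff)
    qed
    have "(\<lambda>n. (\<integral>x. t n x * D x \<partial>m) - T (\<lambda>i. w (fst i))) \<longlonglongrightarrow> 0"
      by (rule Lim_null_comparison[OF always_eventually lim0]) (use bnd in blast)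
    then have "(\<lambda>n. \<integral>x. t n x * D x \<partial>m) \<longlonglongrightarrow> T (\<lambda>i. w (fst i))" by (simp add: LIM_zero_iff)
    moreover have "(\<lambda>n. \<integral>x. t n x * D x \<partial>m) \<longlonglongrightarrow> (\<integral>x. w x * D x \<partial>m)"
    proof (rule integral_dominated_convergence[where w = "\<lambda>x. \<bar>w x * D x\<bar>"])
      show "AE x in m. (\<lambda>n. t n x * D x) \<longlonglongrightarrow> w x * D x"
      proof (rule AE_I2, rule tendsto_eventually)
        fix x
        show "\<forall>\<^sub>F n in sequentially. t n x * D x = w x * D x" using ev[of x] by eventually_elim simp
      qed
      show "AE x in m. norm (t n x * D x) \<le> \<bar>w x * D x\<bar>" for n by (auto simp: t_def)
      show "integrable m (\<lambda>x. \<bar>w x * D x\<bar>)" using Lp_holder(1)[OF p w DLq] by simp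
      show "(\<lambda>x. t n x * D x) \<in> borel_measurable m" for n unfolding t_def by measurable
    qed simp
    ultimately show ?thesis by (rule LIMSEQ_unique)
  qed
  have AE_eq: "AE x in m. v x = v' x"
    if "integrable m v" "integrable m v'" "\<And>h. h \<in> bdd_meas m \<Longrightarrow> (\<integral>x. h x * v x \<partial>m) = (\<integral>x. h x * v' x \<partial>m)" for v v'
  proof -
    have "AE x in m. v x - v' x = 0"
    proof (rule AE_eq_zero_of_Lipb_test)
      fix h assume "h \<in> Lipb d"
      then have h: "h \<in> bdd_meas m" by (rule Lipb_bdd_meas)
      show "(\<integral>x. h x * (v x - v' x) \<partial>m) = 0"
        using that(3)[OF h] bdd_meas_integrable[OF h that(1)] bdd_meas_integrable[OF h that(2)]
        by (simp add: right_diff_distrib)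
    qed (use that in auto)
    then show ?thesis by eventually_elim simp
  qed
  have der: "lipschitz_derivation d m b"
    unfolding lipschitz_derivation_def
  proof (intro conjI ballI allI)
    fix u assume u: "u \<in> Lipb d"
    show "b u \<in> borel_measurable m" using b(1)[OF u] by auto
    fix v assume v: "v \<in> Lipb d"
    note bu = b[OF u] and bv = b[OF v]
    show "AE x in m. b (\<lambda>y. \<alpha> * u y + \<gamma> * v y) x = \<alpha> * b u x + \<gamma> * b v x" for \<alpha> \<gamma>
    proof (rule AE_eq)
      note uv = Lipb_lincomb[OF u v, of \<alpha> \<gamma>]
      show "integrable m (b (\<lambda>y. \<alpha> * u y + \<gamma> * v y))" by (rule b(1)[OF uv])
      show "integrable m (\<lambda>x. \<alpha> * b u x + \<gamma> * b v x)" using bu(1) bv(1) by simp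
      fix h assume h: "h \<in> bdd_meas m"
      have "(\<integral>x. h x * b (\<lambda>y. \<alpha> * u y + \<gamma> * v y) x \<partial>m) = T (\<lambda>i. h (fst i) * du (\<lambda>y. \<alpha> * u y + \<gamma> * v y) i)"
        by (rule b(3)[OF uv h, symmetric])
      also have "(\<lambda>i. h (fst i) * du (\<lambda>y. \<alpha> * u y + \<gamma> * v y) i)
          = (\<lambda>i. \<alpha> * (h (fst i) * du u i) + \<gamma> * (h (fst i) * du v i))"
        by (auto simp: du_def algebra_simps)
      also have "T \<dots> = \<alpha> * T (\<lambda>i. h (fst i) * du u i) + \<gamma> * T (\<lambda>i. h (fst i) * du v i)"
        by (rule lin[OF duV[OF u h] duV[OF v h]])
      also have "\<dots> = (\<integral>x. h x * (\<alpha> * b u x + \<gamma> * b v x) \<partial>m)"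
        using bdd_meas_integrable[OF h bu(1)] bdd_meas_integrable[OF h bv(1)]
        by (simp add: bu(3)[OF h] bv(3)[OF h] distrib_left mult.left_commute[of _ \<alpha>] mult.left_commute[of _ \<gamma>])
      finally show "(\<integral>x. h x * b (\<lambda>y. \<alpha> * u y + \<gamma> * v y) x \<partial>m) = (\<integral>x. h x * (\<alpha> * b u x + \<gamma> * b v x) \<partial>m)" .
    qed
    show "AE x in m. b (\<lambda>y. u y * v y) x = u x * b v x + v x * b u x"
    proof (rule AE_eq)
      note uv = Lipb_mult[OF u v]
      note ub = Lipb_bdd_meas[OF u] and vb = Lipb_bdd_meas[OF v]
      show "integrable m (b (\<lambda>y. u y * v y))" by (rule b(1)[OF uv])
      show "integrable m (\<lambda>x. u x * b v x + v x * b u x)"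
        using bdd_meas_integrable[OF ub bv(1)] bdd_meas_integrable[OF vb bu(1)] by simp
      fix h assume h: "h \<in> bdd_meas m"
      note hu = bdd_meas_mult[OF h ub] and hv = bdd_meas_mult[OF h vb]
      \<comment> \<open>Second-order remainder of the product: the difference of \<open>u v\<close>
        between \<open>y\<close> and \<open>x\<close> is \<open>u(x) dv + v(x) du + du dv\<close>.
        The jet norm of \<open>R\<close> vanishes, so the density bound gives
        \<open>T R = 0\<close>.\<close>
      define R where "R = (\<lambda>i. h (fst i) * ((u (snd i) - u (fst i)) * (v (snd i) - v (fst i))))"
      have RV: "R \<in> jets l" unfolding R_def by (rule jets_mult[OF l jets_product(1)[OF l u v] h])
      have RN: "jet_norm l R = (\<lambda>x. 0)"
        using jet_norm_mult[OF jets_jet[OF jets_product(1)[OF l u v]], of l h] jets_product(2)[OF l u v]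
        by (simp add: R_def fun_eq_iff)
      have TR: "T R = 0" using bound[OF RV] bdd_meas_const[of 0 m] by (simp add: RN)
      have sV: "(\<lambda>i. (h (fst i) * u (fst i)) * du v i + (h (fst i) * v (fst i)) * du u i) \<in> jets l"
        by (rule fun_space_add[OF V duV[OF v hu] duV[OF u hv]])
      have "(\<integral>x. h x * b (\<lambda>y. u y * v y) x \<partial>m) = T (\<lambda>i. h (fst i) * du (\<lambda>y. u y * v y) i)"
        by (rule b(3)[OF uv h, symmetric])
      also have "(\<lambda>i. h (fst i) * du (\<lambda>y. u y * v y) i)
          = (\<lambda>i. ((h (fst i) * u (fst i)) * du v i + (h (fst i) * v (fst i)) * du u i) + R i)"
        by (auto simp: du_def R_def algebra_simps)
      also have "T \<dots> = (T (\<lambda>i. (h (fst i) * u (fst i)) * du v i) + T (\<lambda>i. (h (fst i) * v (fst i)) * du u i)) + T R"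
        unfolding Tadd[OF sV RV] Tadd[OF duV[OF v hu] duV[OF u hv]] ..
      also have "\<dots> = (\<integral>x. (h x * u x) * b v x \<partial>m) + (\<integral>x. (h x * v x) * b u x \<partial>m)"
        using bv(3)[OF hu] bu(3)[OF hv] TR by simp
      also have "\<dots> = (\<integral>x. h x * (u x * b v x + v x * b u x) \<partial>m)"
        using bdd_meas_integrable[OF hu bv(1)] bdd_meas_integrable[OF hv bu(1)]
        by (simp add: distrib_left mult.assoc)
      finally show "(\<integral>x. h x * b (\<lambda>y. u y * v y) x \<partial>m) = (\<integral>x. h x * (u x * b v x + v x * b u x) \<partial>m)" .
    qed
  qed
  have bounds: "\<beta> \<in> deriv_bounds q d m b"
    unfolding deriv_bounds_def
  proof (intro CollectI conjI ballI)
    show "AE x in m. \<bar>b u x\<bar> \<le> \<beta> x * lip d u x" if "u \<in> Lipb d" for u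
      using b(2)[OF that] by (simp add: mult.commute)
  qed (rule \<beta>)
  have div: "is_divergence d m b D"
    unfolding is_divergence_def
  proof (intro conjI ballI)
    fix u assume u: "u \<in> Lipb d"
    have one: "(\<lambda>x. 1) \<in> bdd_meas m" by (rule bdd_meas_const)
    \<comment> \<open>The jet of \<open>u\<close>, on which \<open>T\<close> vanishes, is its value
      part plus its differential; the densities \<open>D\<close> and \<open>b u\<close> of the two
      parts give the divergence identity.\<close>
    have "0 = T (\<lambda>i. u (fst i) + 1 * du u i)" using Tu[OF u] by (simp add: du_def)
    also have "\<dots> = T (\<lambda>i. u (fst i)) + T (\<lambda>i. 1 * du u i)"
      by (rule Tadd[OF valV[OF Lipb_bdd_meas[OF u]] duV[OF u one]])
    also have "T (\<lambda>i. 1 * du u i) = (\<integral>x. b u x \<partial>m)" using b(3)[OF u one] by simp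
    finally show "(\<integral>x. b u x \<partial>m) = - (\<integral>x. u x * D x \<partial>m)" using Tval[OF Lipb_Lp[OF u]] by simp
  qed (rule D)
  have bD: "b \<in> Der_div q d m" by (rule Der_divI[OF der bounds b(1) div DLq])
  show ?thesis
  proof (rule that[OF bD bounds], rule ballI)
    fix w assume w: "w \<in> Lp p m"
    have "AE x in m. divergence d m b x = D x" by (rule divergence_unique[OF Der_divD(5)[OF bD] div])
    then have "(\<integral>x. w x * divergence d m b x \<partial>m) = (\<integral>x. w x * D x \<partial>m)"
      using Lp_measurable[OF w] Lp_measurable[OF Der_divD(4)[OF bD]] Lp_measurable[OF DLq]
      by (intro integral_cong_AE) auto
    then show "T (\<lambda>i. w (fst i)) = (\<integral>x. w x * divergence d m b x \<partial>m)" using Tval[OF w] by simp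
  qed
qed

text \<open>\<open>P\<close> is the quotient seminorm: the distance in jet norm to the jets of
  Lipschitz functions. Sublinearity holds because those jets form a linear space.\<close>

lemma Lipb_translate_sublinear:
  assumes l: "0 \<le> l"
  defines "P \<equiv> (\<lambda>J. INF u\<in>Lipb d. Lp_norm p m (jet_norm l (\<lambda>i. J i - u (snd i))))"
  shows "sublinear_on (jets l) P"
    and "\<And>J u. u \<in> Lipb d \<Longrightarrow> P J \<le> Lp_norm p m (jet_norm l (\<lambda>i. J i - u (snd i)))"
    and "\<And>J c. (\<And>u. u \<in> Lipb d \<Longrightarrow> c \<le> Lp_norm p m (jet_norm l (\<lambda>i. J i - u (snd i)))) \<Longrightarrow> c \<le> P J"
proof -
  note V = jets_fun_space[OF l]
  define N where "N = (\<lambda>J (u :: 'a \<Rightarrow> real). Lp_norm p m (jet_norm l (\<lambda>i. J i - u (snd i))))"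
  have ne: "Lipb d \<noteq> {}" using Lipb_const by blast
  have le: "P J \<le> N J u" if "u \<in> Lipb d" for J u
    unfolding P_def N_def by (rule cINF_lower[OF _ that]) (intro bdd_belowI[of _ 0], auto simp: Lp_norm_nonneg)
  have ge: "c \<le> P J" if "\<And>u. u \<in> Lipb d \<Longrightarrow> c \<le> N J u" for J c
    using that unfolding P_def N_def by (intro cINF_greatest[OF ne])
  show "\<And>J u. u \<in> Lipb d \<Longrightarrow> P J \<le> Lp_norm p m (jet_norm l (\<lambda>i. J i - u (snd i)))" using le by (simp add: N_def)
  show "\<And>J c. (\<And>u. u \<in> Lipb d \<Longrightarrow> c \<le> Lp_norm p m (jet_norm l (\<lambda>i. J i - u (snd i)))) \<Longrightarrow> c \<le> P J"
    using ge by (simp add: N_def)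
  have JuV: "(\<lambda>i. J i - u (snd i)) \<in> jets l" if "J \<in> jets l" "u \<in> Lipb d" for J u
    using fun_space_add[OF V that(1) fun_space_uminus[OF V jets_function[OF l that(2)]]] by simp
  have NLp: "jet_norm l J \<in> Lp p m" if "J \<in> jets l" for J using that by (simp add: jets_def)
  have add: "P (\<lambda>i. J i + K i) \<le> P J + P K" if J: "J \<in> jets l" and K: "K \<in> jets l" for J K
  proof -
    have *: "P (\<lambda>i. J i + K i) \<le> N J u + N K v" if u: "u \<in> Lipb d" and v: "v \<in> Lipb d" for u v
    proof -
      define J' K' where "J' = (\<lambda>i. J i - u (snd i))" and "K' = (\<lambda>i. K i - v (snd i))"
      have J': "J' \<in> jets l" and K': "K' \<in> jets l" unfolding J'_def K'_def by (intro JuV J K u v)+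
      have "P (\<lambda>i. J i + K i) \<le> N (\<lambda>i. J i + K i) (\<lambda>y. u y + v y)" by (rule le[OF Lipb_add[OF u v]])
      also have "\<dots> = Lp_norm p m (jet_norm l (\<lambda>i. J' i + K' i))" by (simp add: N_def J'_def K'_def algebra_simps)
      also have "\<dots> \<le> Lp_norm p m (\<lambda>x. jet_norm l J' x + jet_norm l K' x)"
      proof (rule Lp_norm_mono[OF p0 Lp_add[OF p0 NLp[OF J'] NLp[OF K']]])
        show "jet_norm l (\<lambda>i. J' i + K' i) \<in> borel_measurable m"
          by (rule jet_norm_measurable[OF jets_jet[OF fun_space_add[OF V J' K']]])
        show "AE x in m. \<bar>jet_norm l (\<lambda>i. J' i + K' i) x\<bar> \<le> \<bar>jet_norm l J' x + jet_norm l K' x\<bar>"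
          using jet_norm_lincomb[OF l jets_jet[OF J'] jets_jet[OF K'], of 1 1] jet_norm_nonneg[OF l]
          by (intro AE_I2) (simp add: add_nonneg_nonneg)
      qed
      also have "\<dots> \<le> Lp_norm p m (jet_norm l J') + Lp_norm p m (jet_norm l K')"
        by (rule Lp_norm_triangle[OF p NLp[OF J'] NLp[OF K']])
      finally show ?thesis by (simp add: N_def J'_def K'_def)
    qed
    have "P (\<lambda>i. J i + K i) - N J u \<le> P K" if "u \<in> Lipb d" for u
      by (rule ge) (use *[OF that] in \<open>simp add: algebra_simps\<close>)
    then have "P (\<lambda>i. J i + K i) - P K \<le> P J" by (intro ge) (simp add: algebra_simps)
    then show ?thesis by simp
  qed
  have scale1: "c * P J \<le> P (\<lambda>i. c * J i)" if J: "J \<in> jets l" and c: "0 < c" for J c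
  proof (rule ge)
    fix u assume u: "u \<in> Lipb d"
    define w where "w = (\<lambda>y. (1 / c) * u y)"
    have w: "w \<in> Lipb d" unfolding w_def by (rule Lipb_scale[OF u])
    have eq: "(\<lambda>i. c * J i - u (snd i)) = (\<lambda>i. c * (J i - w (snd i)))"
      using c by (auto simp: w_def right_diff_distrib)
    have "jet_norm l (\<lambda>i. c * (J i - w (snd i))) = (\<lambda>x. c * jet_norm l (\<lambda>i. J i - w (snd i)) x)"
      using jet_norm_scale[OF jets_jet[OF JuV[OF J w]], of l c] c by auto
    then have "N (\<lambda>i. c * J i) u = c * N J w"
      unfolding N_def eq using c by (simp add: Lp_norm_scale[OF p0])
    then show "c * P J \<le> N (\<lambda>i. c * J i) u" using le[OF w, of J] c by simp
  qed
  have scale: "P (\<lambda>i. c * J i) = c * P J" if J: "J \<in> jets l" and c: "0 < c" for J c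
  proof (rule antisym[OF _ scale1[OF J c]])
    have "(1 / c) * P (\<lambda>i. c * J i) \<le> P (\<lambda>i. (1 / c) * (c * J i))"
      by (rule scale1[OF fun_space_scale[OF V J]]) (use c in simp)
    then show "P (\<lambda>i. c * J i) \<le> c * P J" using c by (simp add: field_simps)
  qed
  show "sublinear_on (jets l) P" unfolding sublinear_on_def using add scale by blast
qed

lemma penalty_bounded_by_weak_slope:
  assumes f: "f \<in> Lp p m" and L: "is_weak_diff p d m f L" and g: "g \<in> slope_bounds p d m L"
  shows "\<forall>l\<ge>0. \<forall>e>0. \<exists>u\<in>Lipb d. Lp_norm p m (penalty f l u) \<le> Lp_norm p m g + e"
proof (intro allI impI)
  fix l e :: real assume l: "0 \<le> l" and e: "0 < e"
  note V = jets_fun_space[OF l]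
  define P where "P = (\<lambda>J. INF u\<in>Lipb d. Lp_norm p m (jet_norm l (\<lambda>i. J i - u (snd i))))"
  have P: "sublinear_on (jets l) P"
    and Ple: "\<And>J u. u \<in> Lipb d \<Longrightarrow> P J \<le> Lp_norm p m (jet_norm l (\<lambda>i. J i - u (snd i)))"
    and Pge: "\<And>J c. (\<And>u. u \<in> Lipb d \<Longrightarrow> c \<le> Lp_norm p m (jet_norm l (\<lambda>i. J i - u (snd i)))) \<Longrightarrow> c \<le> P J"
    unfolding P_def using Lipb_translate_sublinear[OF l] by blast+
  define F where "F = (\<lambda>i::'a \<times> 'a. f (fst i))"
  have FV: "F \<in> jets l" unfolding F_def by (rule jets_value(1)[OF l f])
  obtain T where T: "linear_on_funs (jets l) T" and TP: "\<And>J. J \<in> jets l \<Longrightarrow> T J \<le> P J" and TF: "T F = P F"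
    using hahn_banach_funs[OF V P FV] by blast
  \<comment> \<open>The competitor \<open>u = 0\<close> in \<open>P\<close> gives the plain jet
    norm.\<close>
  have TN: "\<forall>J\<in>jets l. T J \<le> Lp_norm p m (jet_norm l J)"
    using order_trans[OF TP Ple[OF Lipb_const[of 0]]] by simp
  have Tu: "\<forall>u\<in>Lipb d. T (\<lambda>i. u (snd i)) = 0"
  proof
    fix u assume u: "u \<in> Lipb d"
    \<comment> \<open>A Lipschitz jet has distance 0 to itself, so \<open>T\<close> is nonpositive
      on it; applying this to \<open>u\<close> and to \<open>-1\<close> times \<open>u\<close> gives
      equality.\<close>
    have le0: "T (\<lambda>i. v (snd i)) \<le> 0" if v: "v \<in> Lipb d" for v
    proof -
      have "jet_norm l (\<lambda>i. v (snd i) - v (snd i)) = (\<lambda>x. 0)" by (simp add: jet_norm_def lip_const)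
      then show ?thesis using TP[OF jets_function[OF l v]] Ple[OF v, of "\<lambda>i. v (snd i)"] by (simp add: Lp_norm_zero)
    qed
    have "T (\<lambda>i. \<alpha> * u (snd i) + \<gamma> * u (snd i)) = \<alpha> * T (\<lambda>i. u (snd i)) + \<gamma> * T (\<lambda>i. u (snd i))" for \<alpha> \<gamma>
      using T jets_function[OF l u] by (simp add: linear_on_funs_def)
    from this[of "-1" 0] show "T (\<lambda>i. u (snd i)) = 0" using le0[OF u] le0[OF Lipb_scale[OF u, of "-1"]] by simp
  qed
  obtain \<beta> where \<beta>: "\<beta> \<in> Lp_nonneg q m" "Lp_norm q m \<beta> \<le> 1"
    "\<forall>J\<in>jets l. jet_norm l J \<in> bdd_meas m \<longrightarrow> \<bar>T J\<bar> \<le> (\<integral>x. jet_norm l J x * \<beta> x \<partial>m)"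
    by (rule jet_functional_density[OF l T TN]) blast
  obtain b where b: "b \<in> Der_div q d m" "\<beta> \<in> deriv_bounds q d m b"
    and Tw: "\<forall>w\<in>Lp p m. T (\<lambda>i. w (fst i)) = (\<integral>x. w x * divergence d m b x \<partial>m)"
    by (rule jet_functional_derivation[OF l T TN Tu \<beta>(1,3)]) blast
  note D = Der_divD[OF b(1)]
  have gLp: "g \<in> Lp p m" and g0: "AE x in m. 0 \<le> g x"
    and Lg: "AE x in m. \<bar>L b x\<bar> \<le> g x * deriv_norm q d m b x"
    using g b(1) by (auto simp: slope_bounds_def Lp_nonneg_def)
  have iL: "integrable m (L b)" using L b(1) by (simp add: is_weak_diff_def)
  note g\<beta> = Lp_holder[OF p gLp Lp_nonneg_Lp[OF \<beta>(1)]]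
  have "P F = (\<integral>x. f x * divergence d m b x \<partial>m)" using TF bspec[OF Tw f] by (simp add: F_def)
  also have "\<dots> = - (\<integral>x. L b x \<partial>m)" using L b(1) by (simp add: is_weak_diff_def)
  also have "\<dots> \<le> (\<integral>x. \<bar>L b x\<bar> \<partial>m)" by (rule order_trans[OF abs_ge_minus_self integral_abs_bound])
  also have "\<dots> \<le> (\<integral>x. \<bar>g x * \<beta> x\<bar> \<partial>m)"
  proof (rule integral_mono_AE)
    show "AE x in m. \<bar>L b x\<bar> \<le> \<bar>g x * \<beta> x\<bar>"
      using Lg g0 D(9)[OF b(2)]
    proof eventually_elim
      case (elim x)
      then show ?case using mult_left_mono[of "deriv_norm q d m b x" "\<beta> x" "g x"] by linarith
    qed
  qed (use iL g\<beta>(1) in auto)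
  also have "\<dots> \<le> Lp_norm p m g * Lp_norm q m \<beta>" by (rule g\<beta>(2))
  also have "\<dots> \<le> Lp_norm p m g" using mult_left_mono[OF \<beta>(2) Lp_norm_nonneg[of p m g]] by simp
  finally have PF: "P F \<le> Lp_norm p m g" .
  show "\<exists>u\<in>Lipb d. Lp_norm p m (penalty f l u) \<le> Lp_norm p m g + e"
  proof (rule ccontr)
    assume "\<not> ?thesis"
    then have ns: "Lp_norm p m g + e < Lp_norm p m (penalty f l u)" if "u \<in> Lipb d" for u
      using that by (meson not_le)
    have "Lp_norm p m g + e \<le> P F"
    proof (rule Pge)
      fix u assume u: "u \<in> Lipb d"
      \<comment> \<open>In the germ \<open>f x - u y\<close> the value \<open>f x\<close> is a
        constant, which the slope ignores. Hence \<open>P F\<close> is exactly the infimum of the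
        penalized norms.\<close>
      have "jet_norm l (\<lambda>i. F i - u (snd i)) = penalty f l u"
      proof
        fix x
        have "lip d (\<lambda>y. f x - u y) x = lip d u x"
          using lip_add_const[OF Lipb_scale[OF u, of "-1"], of "f x" x] lip_scale[OF u, of "-1" x] by simp
        then show "jet_norm l (\<lambda>i. F i - u (snd i)) x = penalty f l u x"
          by (simp add: jet_norm_def penalty_def F_def abs_minus_commute)
      qed
      then show "Lp_norm p m g + e \<le> Lp_norm p m (jet_norm l (\<lambda>i. F i - u (snd i)))" using ns[OF u] by simp
    qed
    then show False using PF e by simp
  qed
qed

section \<open>Identification of the Sobolev spaces\<close>

text \<open>Both inclusions pass through a sequence with strongly convergent slopes. They differ in
  the source of the bound \<open>R\<close>: a finite energy in one case, the norm of any member of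
  \<open>slope_bounds\<close> in the other.\<close>

lemma H1p_eq_W1p: "H1p p d m = W1p p d m"
proof (intro equalityI subsetI)
  fix f assume f: "f \<in> H1p p d m"
  then have fLp: "f \<in> Lp p m" by (simp add: H1p_def)
  obtain R where R: "\<forall>l\<ge>0. \<forall>e>0. \<exists>u\<in>Lipb d. Lp_norm p m (penalty f l u) \<le> R + e"
    by (rule cheeger_energy_finite_imp_penalty[OF f])
  obtain u G where "\<forall>n. u n \<in> Lipb d" "Lp_tendsto p m u f" "G \<in> Lp_nonneg p m"
    "Lp_tendsto p m (\<lambda>n. lip d (u n)) G"
    by (rule penalized_sequence_converges[OF fLp R]) blast
  then show "f \<in> W1p p d m" using weak_diff_exists[of u f G] fLp by (auto simp: W1p_def Lp_nonneg_def)
next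
  fix f assume "f \<in> W1p p d m"
  then obtain L where fLp: "f \<in> Lp p m" and L: "is_weak_diff p d m f L" by (auto simp: W1p_def)
  then obtain g where g: "g \<in> slope_bounds p d m L" by (auto simp: is_weak_diff_def)
  obtain u G where "\<forall>n. u n \<in> Lipb d" "Lp_tendsto p m u f" "Lp_tendsto p m (\<lambda>n. lip d (u n)) G"
    by (rule penalized_sequence_converges[OF fLp penalty_bounded_by_weak_slope[OF fLp L g]]) blast
  then show "f \<in> H1p p d m" by (intro strong_sequence_imp_H1p) auto
qed

text \<open>The essential infimum is itself a member of \<open>slope_bounds\<close>, so the
  penalized construction may be run with its own norm as \<open>R\<close>. Its output
  \<open>G\<close> is a relaxed slope, hence above the weak slope, with no larger norm.\<close>

lemma weak_slope_minimal:
  assumes f: "f \<in> W1p p d m"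
  shows "relaxed_slope p d m f (weak_slope p d m f)"
    and "relaxed_slope p d m f G \<Longrightarrow> AE x in m. weak_slope p d m f x \<le> G x"
proof -
  define L where "L = weak_diff p d m f"
  have fLp: "f \<in> Lp p m" and L: "is_weak_diff p d m f L"
    using f someI_ex[of "is_weak_diff p d m f"] by (auto simp: W1p_def L_def weak_diff_def)
  define g where "g = weak_slope p d m f"
  have ge: "g = ess_inf m (slope_bounds p d m L)" by (simp add: g_def weak_slope_def L_def)
  have "slope_bounds p d m L \<noteq> {}" using L by (simp add: is_weak_diff_def)
  then have gS: "g \<in> slope_bounds p d m L" and gmin: "\<And>h. h \<in> slope_bounds p d m L \<Longrightarrow> AE x in m. g x \<le> h x"
    using ess_inf_of_bounds[OF finite_measure_axioms p, of "Der_div q d m" "\<lambda>b. deriv_norm q d m b" "\<lambda>b x. \<bar>L b x\<bar>"]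
    unfolding ge slope_bounds_def by (auto simp: Der_divD(7))
  have low: "AE x in m. g x \<le> G x" if rs: "relaxed_slope p d m f G" for G
  proof -
    obtain G' where G': "G' \<in> slope_bounds p d m L" "AE x in m. G' x \<le> G x"
      by (rule relaxed_slope_bounds_weak_diff[OF L rs]) blast
    show ?thesis using gmin[OF G'(1)] G'(2) by eventually_elim simp
  qed
  then show "relaxed_slope p d m f G \<Longrightarrow> AE x in m. weak_slope p d m f x \<le> G x" by (simp add: g_def)
  obtain u G where u: "\<forall>n. u n \<in> Lipb d" "Lp_tendsto p m u f" and G: "G \<in> Lp_nonneg p m"
    and uG: "Lp_tendsto p m (\<lambda>n. lip d (u n)) G" and norm: "Lp_norm p m G \<le> Lp_norm p m g"
    by (rule penalized_sequence_converges[OF fLp penalty_bounded_by_weak_slope[OF fLp L gS]]) blast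
  have g: "g \<in> Lp_nonneg p m" using gS by (simp add: slope_bounds_def)
  have GG: "relaxed_slope p d m f G" by (rule strong_sequence_imp_relaxed_slope[OF spec[OF u(1)] u(2) uG G G]) simp
  have "AE x in m. 0 \<le> g x \<and> g x \<le> G x"
    using low[OF GG] Lp_nonneg_AE[OF g] by eventually_elim simp
  then have "AE x in m. G x = g x"
    by (rule Lp_norm_eq_imp_AE_eq[OF p0 Lp_nonneg_Lp[OF G] Lp_measurable[OF Lp_nonneg_Lp[OF g]] _ norm])
  then have "AE x in m. G x \<le> g x" by eventually_elim simp
  then show "relaxed_slope p d m f (weak_slope p d m f)"
    using strong_sequence_imp_relaxed_slope[OF spec[OF u(1)] u(2) uG G g] by (simp add: g_def)
qed

text \<open>The weak slope shows that the choice in \<open>min_relaxed_slope\<close> is from a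
  nonempty set; two minimal relaxed slopes bound each other.\<close>

lemma weak_slope_eq_min_relaxed_slope:
  assumes f: "f \<in> W1p p d m"
  shows "AE x in m. weak_slope p d m f x = min_relaxed_slope p d m f x"
proof -
  define M where "M = min_relaxed_slope p d m f"
  have "relaxed_slope p d m f M \<and> (\<forall>G'. relaxed_slope p d m f G' \<longrightarrow> (AE x in m. M x \<le> G' x))"
    unfolding M_def min_relaxed_slope_def
    by (rule someI[of _ "weak_slope p d m f"]) (use weak_slope_minimal[OF f] in blast)
  then have "AE x in m. M x \<le> weak_slope p d m f x" "AE x in m. weak_slope p d m f x \<le> M x"
    using weak_slope_minimal[OF f] by auto
  then show ?thesis unfolding M_def by eventually_elim simp
qed

end

theorem theorem5p4:
  fixes d :: "'a::t2_space \<Rightarrow> 'a \<Rightarrow> ennreal" and m :: "'a measure" and p :: real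
  assumes "ext_metric_top_measure_space d m" and "1 < p"
  shows "H1p p d m = W1p p d m \<and>
    (\<forall>f\<in>W1p p d m. AE x in m. weak_slope p d m f x = min_relaxed_slope p d m f x)"
proof -
  interpret sobolev_setting d m p
    using assms by (simp add: sobolev_setting_def sobolev_setting_axioms_def)
  show ?thesis using H1p_eq_W1p weak_slope_eq_min_relaxed_slope by blast
qed

end
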